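(* Let $\mathbf{C}$ be a quasi-topos, let $\mathcal{M}$ be the class of regular monomorphisms of $\mathbf{C}$, let $X_0$ be an object of $\mathbf{C}$, and let $r_1=(O_1\xleftarrow{o_1}K_1\xrightarrow{i_1}I_1)$ and $r_2=(O_2\xleftarrow{o_2}K_2\xrightarrow{i_2}I_2)$ be arbitrary spans in $\mathbf{C}$ (rules; no monicity assumed). 1. (Synthesis) For every SqPO-admissible match $m_1$ of $r_1$ into $X_0$ and every SqPO-admissible match $m_2$ of $r_2$ into $X_1:=r_{1_{m_1}}(X_0)$, there exist an SqPO-admissible match $\mu$ of $r_2$ into $r_1$ and an SqPO-admissible match $m_{21}$ of the composite rule $r_{21}:=r_2\,{}^{\mu}\!\circledcirc\, r_1$ into $X_0$ such that $r_{21_{m_{21}}}(X_0)\cong r_{2_{m_2}}(r_{1_{m_1}}(X_0))$. 2. (Analysis) For every SqPO-admissible match $\mu$ of $r_2$ into $r_1$ and every SqPO-admissible match $m_{21}$ of $r_{21}:=r_2\,{}^{\mu}\!\circledcirc\, r_1$ into $X_0$, there exist an SqPO-admissible match $m_1$ of $r_1$ into $X_0$ and an SqPO-admissible match $m_2$ of $r_2$ into $r_{1_{m_1}}(X_0)$ such that $r_{2_{m_2}}(r_{1_{m_1}}(X_0))\cong r_{21_{m_{21}}}(X_0)$. 3. (Compatibility) If in addition $\mathbf{C}$ is finitary (every object has only finitely many regular subobjects up to isomorphism), then the set of pairs $(m_1,m_2)$ as in 1. and the set of pairs $(\mu,m_{21})$ as in 2. are in bijection, once the former is quotiented by the universal isomorphisms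 of $X_1=r_{1_{m_1}}(X_0)$ and $X_2=r_{2_{m_2}}(X_1)$, and the latter by the universal isomorphisms of multi-sums, multi-pushout complements and FPC-augmentations.
   Context: A quasi-topos is a category with finite limits and colimits, which is locally Cartesian closed and has a regular-subobject classifier. $\mathcal{M}$ denotes the class of regular monos; every quasi-topos has an (epi, $\mathcal{M}$)-factorization and binary coproducts. Final pullback complement (FPC): given $A\xrightarrow{f}B\xrightarrow{m}C$, a pair $A\xrightarrow{n}F\xrightarrow{g}C$ is an FPC of $(f,m)$ if $m\circ f=g\circ n$, this square is a pullback, and for every $X\xrightarrow{x}A$, $X\xrightarrow{y}D$, $D\xrightarrow{d}C$ such that $m\circ f\circ x=d\circ y$ is a pullback square, there is a unique $w:D\to F$ with $g\circ w=d$ and $w\circ y=n\circ x$. (FPCs exist when $m\in\mathcal{M}$.) Multi-sum $\mathrm{Msum}(A,B)$: a family of cospans $A\xrightarrow{f}Y\xleftarrow{g}B$ with $f,g\in\mathcal{M}$ such that for every cospan $A\xrightarrow{a}Z\xleftarrow{b}B$ with $a,b\in\mathcal{M}$ there exist an element $(f,g)$ of the family and $y:Y\to Z$ in $\mathcal{M}$ with $a=y\circ f$, $b=y\circ g$, unique up to universal isomorphism. Multi-pushout complement: for $A\xrightarrow{f}B\xrightarrow{b}D$ with $b\in\mathcal{M}$, $\mathrm{mPOC}(f,b)$ is the set of pairs $(A\xrightarrow{a}P,P\xrightarrow{d}D)$ with $a\in\mathcal{M}$ such that $B\xrightarrow{b}D\xleftarrow{d}P$ is a pushout of $B\xleftarrow{f}A\xrightarrow{a}P$.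 FPC-augmentation (FPA): given $A\xrightarrow{\alpha}C$ with $\alpha\in\mathcal{M}$ and $A\xrightarrow{a}B$, let $B\xrightarrow{\bar\alpha}D\xleftarrow{\bar a}C$ be the pushout of $(a,\alpha)$ (so $\bar\alpha\in\mathcal{M}$). $\mathrm{FPA}(\alpha,a)$ is the class of triples $(n:C\to F,\ f:F\to E,\ e:D\to E)$ such that $e$ is an epimorphism, $e\circ\bar\alpha\in\mathcal{M}$, $(\bar\alpha,\mathrm{id}_B)$ is a pullback of $(e,e\circ\bar\alpha)$, $(n\circ\alpha,f)$ is an FPC of $(a,e\circ\bar\alpha)$, $f\circ n=e\circ\bar a$ (i.e. $n$ is the morphism induced by the FPC universal property), and $n\in\mathcal{M}$. SqPO direct derivation: an SqPO-admissible match of a rule $r=(O\xleftarrow{o}K\xrightarrow{i}I)$ into $X$ is any $m:I\to X$ in $\mathcal{M}$. Form the FPC $K\xrightarrow{\bar m}\bar X\xrightarrow{\bar i}X$ of $(i,m)$, then the pushout $X'$ of $O\xleftarrow{o}K\xrightarrow{\bar m}\bar X$; write $r_m(X):=X'$. SqPO-admissible matches of $r_2$ into $r_1$: tuples consisting of $(j_2:I_2\to J_{21},\ j_1:O_1\to J_{21})\in\mathrm{Msum}(I_2,O_1)$; $(\bar j_1:K_1\to\bar K_1,\ \bar o_1:\bar K_1\to J_{21})\in\mathrm{mPOC}(o_1,j_1)$; and, letting $I_1\to I_{21}\xleftarrow{}\bar K_1$ be the pushout of $I_1\xleftarrow{i_1}K_1\xrightarrow{\bar j_1}\bar K_1$,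 a triple $(\bar{\bar j}_1:\bar K_1\to\bar{\bar K}_1,\ \bar{\bar i}_1:\bar{\bar K}_1\to\bar I_{21},\ \iota_{21}:I_{21}\to\bar I_{21})\in\mathrm{FPA}(\bar j_1,i_1)$; taken modulo the compatible universal isomorphisms of multi-sums, multi-POCs and FPAs. SqPO rule composition along such $\mu$: form the FPC $K_2\to\bar K_2\xrightarrow{}J_{21}$ of $(i_2,j_2)$; the pushout $O_{21}$ of $O_2\xleftarrow{o_2}K_2\to\bar K_2$; the pushout $\bar J_{21}$ of $J_{21}\xleftarrow{\bar o_1}\bar K_1\xrightarrow{\bar{\bar j}_1}\bar{\bar K}_1$; the FPC $\bar K_2\to\bar{\bar K}_2\to\bar J_{21}$ of $(\bar K_2\to J_{21},\ J_{21}\to\bar J_{21})$; and the pushout $\bar O_{21}$ of $O_{21}\leftarrow\bar K_2\to\bar{\bar K}_2$. The composite rule $r_2\,{}^{\mu}\!\circledcirc\, r_1$ is the span composite (via pullback over $\bar J_{21}$) of $(\bar O_{21}\leftarrow\bar{\bar K}_2\to\bar J_{21})$ with $(\bar J_{21}\leftarrow\bar{\bar K}_1\xrightarrow{\bar{\bar i}_1}\bar I_{21})$. *)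

theory Defs
  imports Main
begin

section \<open>Categories\<close>

record ('o, 'a) cat =
  Ob :: "'o set"
  Arr :: "'a set"
  Dom :: "'a \<Rightarrow> 'o"
  Cod :: "'a \<Rightarrow> 'o"
  Id :: "'o \<Rightarrow> 'a"
  Comp :: "'a \<Rightarrow> 'a \<Rightarrow> 'a"  (infixl "\<cdot>\<index>" 70)

definition hom :: "('o, 'a) cat \<Rightarrow> 'o \<Rightarrow> 'o \<Rightarrow> 'a set" where
  "hom C A B = {f \<in> Arr C. Dom C f = A \<and> Cod C f = B}"

text \<open>Composition is in applicative order and unspecified on non-composable pairs.\<close>

locale category =
  fixes C :: "('o, 'a) cat" (structure)
  assumes Dom_Ob: "f \<in> Arr C \<Longrightarrow> Dom C f \<in> Ob C"
    and Cod_Ob: "f \<in> Arr C \<Longrightarrow> Cod C f \<in> Ob C"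
    and Id_hom: "A \<in> Ob C \<Longrightarrow> Id C A \<in> hom C A A"
    and Comp_hom: "f \<in> hom C A B \<Longrightarrow> g \<in> hom C B D \<Longrightarrow> g \<cdot> f \<in> hom C A D"
    and Comp_Id: "f \<in> hom C A B \<Longrightarrow> f \<cdot> Id C A = f"
    and Id_Comp: "f \<in> hom C A B \<Longrightarrow> Id C B \<cdot> f = f"
    and Comp_assoc: "f \<in> hom C A B \<Longrightarrow> g \<in> hom C B D \<Longrightarrow> h \<in> hom C D E \<Longrightarrow>
      h \<cdot> (g \<cdot> f) = (h \<cdot> g) \<cdot> f"

definition opposite :: "('o, 'a) cat \<Rightarrow> ('o, 'a) cat" where
  "opposite C = \<lparr>Ob = Ob C, Arr = Arr C, Dom = Cod C, Cod = Dom C, Id = Id C,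
     Comp = (\<lambda>g f. f \<cdot>\<^bsub>C\<^esub> g)\<rparr>"

text \<open>An object of the slice over \<open>X\<close> is an arrow into \<open>X\<close>; \<open>(f, g, h)\<close> is the arrow
  \<open>h\<close> viewed as a morphism from \<open>f\<close> to \<open>g\<close>.\<close>

definition slice :: "('o, 'a) cat \<Rightarrow> 'o \<Rightarrow> ('a, 'a \<times> 'a \<times> 'a) cat" where
  "slice C X =
    \<lparr>Ob = {f \<in> Arr C. Cod C f = X},
     Arr = {(f, g, h). f \<in> Arr C \<and> Cod C f = X \<and> g \<in> Arr C \<and> Cod C g = X \<and>
              h \<in> hom C (Dom C f) (Dom C g) \<and> g \<cdot>\<^bsub>C\<^esub> h = f},
     Dom = (\<lambda>(f, g, h). f),
     Cod = (\<lambda>(f, g, h). g),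
     Id = (\<lambda>f. (f, f, Id C (Dom C f))),
     Comp = (\<lambda>(g, k, v) (f, g', u). (f, k, v \<cdot>\<^bsub>C\<^esub> u))\<rparr>"

definition iso_between :: "('o, 'a) cat \<Rightarrow> 'o \<Rightarrow> 'o \<Rightarrow> 'a \<Rightarrow> bool" where
  "iso_between C X Y f \<longleftrightarrow> f \<in> hom C X Y \<and>
     (\<exists>g \<in> hom C Y X. g \<cdot>\<^bsub>C\<^esub> f = Id C X \<and> f \<cdot>\<^bsub>C\<^esub> g = Id C Y)"

definition isomorphic :: "('o, 'a) cat \<Rightarrow> 'o \<Rightarrow> 'o \<Rightarrow> bool" where
  "isomorphic C X Y \<longleftrightarrow> (\<exists>f. iso_between C X Y f)"

definition epi :: "('o, 'a) cat \<Rightarrow> 'a \<Rightarrow> bool" where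
  "epi C e \<longleftrightarrow> e \<in> Arr C \<and>
     (\<forall>u \<in> Arr C. \<forall>v \<in> Arr C. Dom C u = Cod C e \<and> Dom C v = Cod C e \<and> Cod C u = Cod C v \<and>
        u \<cdot>\<^bsub>C\<^esub> e = v \<cdot>\<^bsub>C\<^esub> e \<longrightarrow> u = v)"


section \<open>Limits and colimits\<close>

definition is_terminal :: "('o, 'a) cat \<Rightarrow> 'o \<Rightarrow> bool" where
  "is_terminal C T \<longleftrightarrow> T \<in> Ob C \<and> (\<forall>X \<in> Ob C. \<exists>!u. u \<in> hom C X T)"

definition is_product :: "('o, 'a) cat \<Rightarrow> 'o \<Rightarrow> 'o \<Rightarrow> 'a \<Rightarrow> 'a \<Rightarrow> bool" where
  "is_product C A B p q \<longleftrightarrow>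
     p \<in> Arr C \<and> q \<in> Arr C \<and> Dom C p = Dom C q \<and> Cod C p = A \<and> Cod C q = B \<and>
     (\<forall>x y. x \<in> Arr C \<and> y \<in> Arr C \<and> Dom C x = Dom C y \<and> Cod C x = A \<and> Cod C y = B \<longrightarrow>
        (\<exists>!u. u \<in> hom C (Dom C x) (Dom C p) \<and> p \<cdot>\<^bsub>C\<^esub> u = x \<and> q \<cdot>\<^bsub>C\<^esub> u = y))"

definition is_equalizer :: "('o, 'a) cat \<Rightarrow> 'a \<Rightarrow> 'a \<Rightarrow> 'a \<Rightarrow> bool" where
  "is_equalizer C f g m \<longleftrightarrow>
     f \<in> Arr C \<and> g \<in> Arr C \<and> Dom C f = Dom C g \<and> Cod C f = Cod C g \<and>
     m \<in> Arr C \<and> Cod C m = Dom C f \<and> f \<cdot>\<^bsub>C\<^esub> m = g \<cdot>\<^bsub>C\<^esub> m \<and>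
     (\<forall>h. h \<in> Arr C \<and> Cod C h = Dom C f \<and> f \<cdot>\<^bsub>C\<^esub> h = g \<cdot>\<^bsub>C\<^esub> h \<longrightarrow>
        (\<exists>!u. u \<in> hom C (Dom C h) (Dom C m) \<and> m \<cdot>\<^bsub>C\<^esub> u = h))"

definition regular_mono :: "('o, 'a) cat \<Rightarrow> 'a \<Rightarrow> bool" where
  "regular_mono C m \<longleftrightarrow> (\<exists>f g. is_equalizer C f g m)"

text \<open>\<open>is_pullback C f g p q\<close>: the pair of projections \<open>(p, q)\<close> is a pullback of the
  cospan \<open>(f, g)\<close>, with \<open>f \<cdot> p = g \<cdot> q\<close>.\<close>

definition is_pullback :: "('o, 'a) cat \<Rightarrow> 'a \<Rightarrow> 'a \<Rightarrow> 'a \<Rightarrow> 'a \<Rightarrow> bool" where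
  "is_pullback C f g p q \<longleftrightarrow>
     f \<in> Arr C \<and> g \<in> Arr C \<and> p \<in> Arr C \<and> q \<in> Arr C \<and>
     Cod C f = Cod C g \<and> Dom C p = Dom C q \<and> Cod C p = Dom C f \<and> Cod C q = Dom C g \<and>
     f \<cdot>\<^bsub>C\<^esub> p = g \<cdot>\<^bsub>C\<^esub> q \<and>
     (\<forall>x y. x \<in> Arr C \<and> y \<in> Arr C \<and> Dom C x = Dom C y \<and>
        Cod C x = Dom C f \<and> Cod C y = Dom C g \<and> f \<cdot>\<^bsub>C\<^esub> x = g \<cdot>\<^bsub>C\<^esub> y \<longrightarrow>
        (\<exists>!u. u \<in> hom C (Dom C x) (Dom C p) \<and> p \<cdot>\<^bsub>C\<^esub> u = x \<and> q \<cdot>\<^bsub>C\<^esub> u = y))"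

text \<open>\<open>is_pushout C f g p q\<close>: the pair of injections \<open>(p, q)\<close> is a pushout of the
  span \<open>(f, g)\<close>, with \<open>p \<cdot> f = q \<cdot> g\<close>.\<close>

definition is_pushout :: "('o, 'a) cat \<Rightarrow> 'a \<Rightarrow> 'a \<Rightarrow> 'a \<Rightarrow> 'a \<Rightarrow> bool" where
  "is_pushout C f g p q \<longleftrightarrow>
     f \<in> Arr C \<and> g \<in> Arr C \<and> p \<in> Arr C \<and> q \<in> Arr C \<and>
     Dom C f = Dom C g \<and> Cod C p = Cod C q \<and> Dom C p = Cod C f \<and> Dom C q = Cod C g \<and>
     p \<cdot>\<^bsub>C\<^esub> f = q \<cdot>\<^bsub>C\<^esub> g \<and>
     (\<forall>x y. x \<in> Arr C \<and> y \<in> Arr C \<and> Cod C x = Cod C y \<and>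
        Dom C x = Cod C f \<and> Dom C y = Cod C g \<and> x \<cdot>\<^bsub>C\<^esub> f = y \<cdot>\<^bsub>C\<^esub> g \<longrightarrow>
        (\<exists>!u. u \<in> hom C (Cod C p) (Cod C x) \<and> u \<cdot>\<^bsub>C\<^esub> p = x \<and> u \<cdot>\<^bsub>C\<^esub> q = y))"

text \<open>The shape of a finite diagram is a finite graph with vertices \<open>V\<close>, edges \<open>E\<close>, source
  \<open>s\<close> and target \<open>t\<close>. Every finite category is the shape of such a diagram via its underlying
  graph, and the limit of a functor depends only on the underlying graph diagram.\<close>

definition finite_diagram ::
  "('o, 'a) cat \<Rightarrow> nat set \<Rightarrow> nat set \<Rightarrow> (nat \<Rightarrow> nat) \<Rightarrow> (nat \<Rightarrow> nat) \<Rightarrow>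
   (nat \<Rightarrow> 'o) \<Rightarrow> (nat \<Rightarrow> 'a) \<Rightarrow> bool" where
  "finite_diagram C V E s t D M \<longleftrightarrow> finite V \<and> finite E \<and> (\<forall>v \<in> V. D v \<in> Ob C) \<and>
     (\<forall>e \<in> E. s e \<in> V \<and> t e \<in> V \<and> M e \<in> hom C (D (s e)) (D (t e)))"

definition is_cone ::
  "('o, 'a) cat \<Rightarrow> nat set \<Rightarrow> nat set \<Rightarrow> (nat \<Rightarrow> nat) \<Rightarrow> (nat \<Rightarrow> nat) \<Rightarrow>
   (nat \<Rightarrow> 'o) \<Rightarrow> (nat \<Rightarrow> 'a) \<Rightarrow> 'o \<Rightarrow> (nat \<Rightarrow> 'a) \<Rightarrow> bool" where
  "is_cone C V E s t D M L p \<longleftrightarrow> L \<in> Ob C \<and> (\<forall>v \<in> V. p v \<in> hom C L (D v)) \<and>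
     (\<forall>e \<in> E. M e \<cdot>\<^bsub>C\<^esub> p (s e) = p (t e))"

definition has_finite_limits :: "('o, 'a) cat \<Rightarrow> bool" where
  "has_finite_limits C \<longleftrightarrow>
     (\<forall>V E s t D M. finite_diagram C V E s t D M \<longrightarrow>
        (\<exists>L p. is_cone C V E s t D M L p \<and>
           (\<forall>L' p'. is_cone C V E s t D M L' p' \<longrightarrow>
              (\<exists>!u. u \<in> hom C L' L \<and> (\<forall>v \<in> V. p v \<cdot>\<^bsub>C\<^esub> u = p' v)))))"

definition has_finite_colimits :: "('o, 'a) cat \<Rightarrow> bool" where
  "has_finite_colimits C \<longleftrightarrow> has_finite_limits (opposite C)"


section \<open>Quasi-toposes\<close>

text \<open>\<open>ev\<close> is an evaluation map from the product \<open>(p, q)\<close> of \<open>E\<close> and \<open>A\<close> to \<open>B\<close>. The arrow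
  \<open>k\<close> is the product of \<open>u\<close> with the identity of \<open>A\<close>.\<close>

definition is_exponential ::
  "('o, 'a) cat \<Rightarrow> 'o \<Rightarrow> 'o \<Rightarrow> 'o \<Rightarrow> 'a \<Rightarrow> 'a \<Rightarrow> 'a \<Rightarrow> bool" where
  "is_exponential C A B E p q ev \<longleftrightarrow> is_product C E A p q \<and> ev \<in> hom C (Dom C p) B \<and>
     (\<forall>X p' q' h. is_product C X A p' q' \<and> h \<in> hom C (Dom C p') B \<longrightarrow>
        (\<exists>!u. u \<in> hom C X E \<and>
           (\<exists>k \<in> hom C (Dom C p') (Dom C p).
              p \<cdot>\<^bsub>C\<^esub> k = u \<cdot>\<^bsub>C\<^esub> p' \<and> q \<cdot>\<^bsub>C\<^esub> k = q' \<and> ev \<cdot>\<^bsub>C\<^esub> k = h)))"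

definition cartesian_closed :: "('o, 'a) cat \<Rightarrow> bool" where
  "cartesian_closed C \<longleftrightarrow>
     (\<exists>T. is_terminal C T) \<and>
     (\<forall>A \<in> Ob C. \<forall>B \<in> Ob C. \<exists>p q. is_product C A B p q) \<and>
     (\<forall>A \<in> Ob C. \<forall>B \<in> Ob C. \<exists>E p q ev. is_exponential C A B E p q ev)"

definition locally_cartesian_closed :: "('o, 'a) cat \<Rightarrow> bool" where
  "locally_cartesian_closed C \<longleftrightarrow> (\<forall>X \<in> Ob C. cartesian_closed (slice C X))"

definition is_regular_subobject_classifier ::
  "('o, 'a) cat \<Rightarrow> 'o \<Rightarrow> 'o \<Rightarrow> 'a \<Rightarrow> bool" where
  "is_regular_subobject_classifier C T \<Omega> tr \<longleftrightarrow> is_terminal C T \<and> tr \<in> hom C T \<Omega> \<and>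
     (\<forall>m. regular_mono C m \<longrightarrow>
        (\<exists>!\<chi>. \<chi> \<in> hom C (Cod C m) \<Omega> \<and> (\<exists>b \<in> hom C (Dom C m) T. is_pullback C \<chi> tr m b)))"

locale quasi_topos = category C for C :: "('o, 'a) cat" (structure) +
  assumes finite_limits: "has_finite_limits C"
    and finite_colimits: "has_finite_colimits C"
    and lcc: "locally_cartesian_closed C"
    and classifier: "\<exists>T \<Omega> tr. is_regular_subobject_classifier C T \<Omega> tr"

definition finitary :: "('o, 'a) cat \<Rightarrow> bool" where
  "finitary C \<longleftrightarrow> (\<forall>X \<in> Ob C.
     finite ({m. regular_mono C m \<and> Cod C m = X} //
       {(m, m'). regular_mono C m \<and> Cod C m = X \<and> regular_mono C m' \<and> Cod C m' = X \<and>
          (\<exists>\<phi>. iso_between C (Dom C m) (Dom C m') \<phi> \<and> m' \<cdot>\<^bsub>C\<^esub> \<phi> = m)}))"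


section \<open>Universal constructions for rewriting\<close>

text \<open>\<open>is_fpc C f m n g\<close>: the pair \<open>(n, g)\<close> is a final pullback complement of \<open>(f, m)\<close>.\<close>

definition is_fpc :: "('o, 'a) cat \<Rightarrow> 'a \<Rightarrow> 'a \<Rightarrow> 'a \<Rightarrow> 'a \<Rightarrow> bool" where
  "is_fpc C f m n g \<longleftrightarrow> is_pullback C m g f n \<and>
     (\<forall>x y d. x \<in> Arr C \<and> Cod C x = Dom C f \<and> is_pullback C m d (f \<cdot>\<^bsub>C\<^esub> x) y \<longrightarrow>
        (\<exists>!w. w \<in> hom C (Dom C d) (Dom C g) \<and> g \<cdot>\<^bsub>C\<^esub> w = d \<and> w \<cdot>\<^bsub>C\<^esub> y = n \<cdot>\<^bsub>C\<^esub> x))"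

definition is_multi_sum :: "('o, 'a) cat \<Rightarrow> 'o \<Rightarrow> 'o \<Rightarrow> ('a \<times> 'a) set \<Rightarrow> bool" where
  "is_multi_sum C A B S \<longleftrightarrow>
     (\<forall>(f, g) \<in> S. regular_mono C f \<and> regular_mono C g \<and>
        Dom C f = A \<and> Dom C g = B \<and> Cod C f = Cod C g) \<and>
     (\<forall>a b. regular_mono C a \<and> regular_mono C b \<and>
        Dom C a = A \<and> Dom C b = B \<and> Cod C a = Cod C b \<longrightarrow>
        (\<exists>(f, g) \<in> S. \<exists>y \<in> hom C (Cod C f) (Cod C a).
           regular_mono C y \<and> a = y \<cdot>\<^bsub>C\<^esub> f \<and> b = y \<cdot>\<^bsub>C\<^esub> g) \<and>
        (\<forall>(f, g) \<in> S. \<forall>y \<in> hom C (Cod C f) (Cod C a).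
         \<forall>(f', g') \<in> S. \<forall>y' \<in> hom C (Cod C f') (Cod C a).
           regular_mono C y \<and> a = y \<cdot>\<^bsub>C\<^esub> f \<and> b = y \<cdot>\<^bsub>C\<^esub> g \<and>
           regular_mono C y' \<and> a = y' \<cdot>\<^bsub>C\<^esub> f' \<and> b = y' \<cdot>\<^bsub>C\<^esub> g' \<longrightarrow>
           (\<exists>!\<phi>. iso_between C (Cod C f) (Cod C f') \<phi> \<and>
              \<phi> \<cdot>\<^bsub>C\<^esub> f = f' \<and> \<phi> \<cdot>\<^bsub>C\<^esub> g = g' \<and> y' \<cdot>\<^bsub>C\<^esub> \<phi> = y)))"

text \<open>Multi-sums of \<open>A\<close> and \<open>B\<close> are determined up to isomorphism of their members. The set
  below collects all cospans that occur in some multi-sum, so that, like \<open>mPOC\<close> and \<open>FPA\<close>, it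
  is closed under isomorphism and involves no choice.\<close>

definition Msum :: "('o, 'a) cat \<Rightarrow> 'o \<Rightarrow> 'o \<Rightarrow> ('a \<times> 'a) set" where
  "Msum C A B = \<Union> {S. is_multi_sum C A B S}"

definition mPOC :: "('o, 'a) cat \<Rightarrow> 'a \<Rightarrow> 'a \<Rightarrow> ('a \<times> 'a) set" where
  "mPOC C f b = {(a, d). regular_mono C b \<and> regular_mono C a \<and> is_pushout C f a b d}"

text \<open>In \<open>FPA C \<alpha> a \<alpha>' a'\<close> the arguments \<open>\<alpha>'\<close> and \<open>a'\<close> name the chosen pushout of
  \<open>(a, \<alpha>)\<close>.\<close>

definition FPA :: "('o, 'a) cat \<Rightarrow> 'a \<Rightarrow> 'a \<Rightarrow> 'a \<Rightarrow> 'a \<Rightarrow> ('a \<times> 'a \<times> 'a) set" where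
  "FPA C \<alpha> a \<alpha>' a' = {(n, f, e).
     regular_mono C \<alpha> \<and> is_pushout C a \<alpha> \<alpha>' a' \<and>
     epi C e \<and> Dom C e = Cod C \<alpha>' \<and>
     regular_mono C (e \<cdot>\<^bsub>C\<^esub> \<alpha>') \<and>
     is_pullback C e (e \<cdot>\<^bsub>C\<^esub> \<alpha>') \<alpha>' (Id C (Cod C a)) \<and>
     n \<in> hom C (Cod C \<alpha>) (Dom C f) \<and>
     is_fpc C a (e \<cdot>\<^bsub>C\<^esub> \<alpha>') (n \<cdot>\<^bsub>C\<^esub> \<alpha>) f \<and>
     f \<cdot>\<^bsub>C\<^esub> n = e \<cdot>\<^bsub>C\<^esub> a' \<and>
     regular_mono C n}"


section \<open>Rules and SqPO direct derivations\<close>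

text \<open>A rule is a span; \<open>out_leg\<close> is the arrow \<open>o\<close> from \<open>K\<close> to \<open>O\<close> and \<open>in_leg\<close> the arrow
  \<open>i\<close> from \<open>K\<close> to \<open>I\<close>.\<close>

record 'a rewrite_rule =
  out_leg :: 'a
  in_leg :: 'a

definition is_rule :: "('o, 'a) cat \<Rightarrow> 'a rewrite_rule \<Rightarrow> bool" where
  "is_rule C r \<longleftrightarrow> out_leg r \<in> Arr C \<and> in_leg r \<in> Arr C \<and>
     Dom C (out_leg r) = Dom C (in_leg r)"

definition sqpo_match :: "('o, 'a) cat \<Rightarrow> 'a rewrite_rule \<Rightarrow> 'o \<Rightarrow> 'a \<Rightarrow> bool" where
  "sqpo_match C r X m \<longleftrightarrow> regular_mono C m \<and> m \<in> hom C (Cod C (in_leg r)) X"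

text \<open>FPCs and pushouts are unique only up to isomorphism, so the notation \<open>r\<^sub>m(X)\<close> involves
  a choice. A record of the following type holds one choice of the FPC
  (\<open>fpc_n\<close> from \<open>K\<close> to \<open>X\<^sup>-\<close>, \<open>fpc_g\<close> from \<open>X\<^sup>-\<close> to \<open>X\<close>) and of the pushout (\<open>comatch\<close> from \<open>O\<close>
  to \<open>X'\<close>, \<open>po_x\<close> from \<open>X\<^sup>-\<close> to \<open>X'\<close>), and \<open>result\<close> is the corresponding value of \<open>r\<^sub>m(X)\<close>.\<close>

record 'a derivation =
  fpc_n :: 'a
  fpc_g :: 'a
  comatch :: 'a
  po_x :: 'a

definition sqpo_derivation ::
  "('o, 'a) cat \<Rightarrow> 'a rewrite_rule \<Rightarrow> 'o \<Rightarrow> 'a \<Rightarrow> 'a derivation \<Rightarrow> bool" where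
  "sqpo_derivation C r X m d \<longleftrightarrow> sqpo_match C r X m \<and>
     is_fpc C (in_leg r) m (fpc_n d) (fpc_g d) \<and>
     is_pushout C (out_leg r) (fpc_n d) (comatch d) (po_x d)"

definition result :: "('o, 'a) cat \<Rightarrow> 'a derivation \<Rightarrow> 'o" where
  "result C d = Cod C (comatch d)"

text \<open>\<open>(k, y)\<close> is the isomorphism between two choices of direct derivation, lying over the
  isomorphism \<open>x\<close> between the objects to which the rule is applied.\<close>

definition derivation_iso ::
  "('o, 'a) cat \<Rightarrow> 'a \<Rightarrow> 'a \<Rightarrow> 'a \<Rightarrow> 'a \<Rightarrow> 'a derivation \<Rightarrow> 'a \<Rightarrow> 'a derivation \<Rightarrow> bool" where
  "derivation_iso C x k y m d m' d' \<longleftrightarrow>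
     iso_between C (Cod C m) (Cod C m') x \<and>
     iso_between C (Dom C (fpc_g d)) (Dom C (fpc_g d')) k \<and>
     iso_between C (result C d) (result C d') y \<and>
     x \<cdot>\<^bsub>C\<^esub> m = m' \<and>
     k \<cdot>\<^bsub>C\<^esub> fpc_n d = fpc_n d' \<and>
     x \<cdot>\<^bsub>C\<^esub> fpc_g d = fpc_g d' \<cdot>\<^bsub>C\<^esub> k \<and>
     y \<cdot>\<^bsub>C\<^esub> comatch d = comatch d' \<and>
     y \<cdot>\<^bsub>C\<^esub> po_x d = po_x d' \<cdot>\<^bsub>C\<^esub> k"


section \<open>SqPO rule composition\<close>

text \<open>The data of an SqPO-admissible match of \<open>r\<^sub>2\<close> into \<open>r\<^sub>1\<close>. The arrows are
  \<open>j2\<close> from \<open>I\<^sub>2\<close> to \<open>J\<^sub>2\<^sub>1\<close>, \<open>j1\<close> from \<open>O\<^sub>1\<close> to \<open>J\<^sub>2\<^sub>1\<close>,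
  \<open>kj\<close> from \<open>K\<^sub>1\<close> to \<open>K\<^sub>1\<^sup>-\<close>, \<open>ko\<close> from \<open>K\<^sub>1\<^sup>-\<close> to \<open>J\<^sub>2\<^sub>1\<close>,
  \<open>pI\<close> from \<open>I\<^sub>1\<close> to \<open>I\<^sub>2\<^sub>1\<close>, \<open>pK\<close> from \<open>K\<^sub>1\<^sup>-\<close> to \<open>I\<^sub>2\<^sub>1\<close>,
  \<open>kkj\<close> from \<open>K\<^sub>1\<^sup>-\<close> to \<open>K\<^sub>1\<^sup>=\<close>, \<open>kki\<close> from \<open>K\<^sub>1\<^sup>=\<close> to \<open>I\<^sub>2\<^sub>1\<^sup>-\<close>, and
  \<open>iota\<close> from \<open>I\<^sub>2\<^sub>1\<close> to \<open>I\<^sub>2\<^sub>1\<^sup>-\<close>, where the superscripts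
  \<open>-\<close> and \<open>=\<close> stand for single and double overlining.\<close>

record 'a rule_match =
  j2 :: 'a
  j1 :: 'a
  kj :: 'a
  ko :: 'a
  pI :: 'a
  pK :: 'a
  kkj :: 'a
  kki :: 'a
  iota :: 'a

definition sqpo_rule_match ::
  "('o, 'a) cat \<Rightarrow> 'a rewrite_rule \<Rightarrow> 'a rewrite_rule \<Rightarrow> 'a rule_match \<Rightarrow> bool" where
  "sqpo_rule_match C r2 r1 \<mu> \<longleftrightarrow>
     (j2 \<mu>, j1 \<mu>) \<in> Msum C (Cod C (in_leg r2)) (Cod C (out_leg r1)) \<and>
     (kj \<mu>, ko \<mu>) \<in> mPOC C (out_leg r1) (j1 \<mu>) \<and>
     is_pushout C (in_leg r1) (kj \<mu>) (pI \<mu>) (pK \<mu>) \<and>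
     (kkj \<mu>, kki \<mu>, iota \<mu>) \<in> FPA C (kj \<mu>) (in_leg r1) (pI \<mu>) (pK \<mu>)"

text \<open>\<open>r21\<close> is a composite of \<open>r2\<close> with \<open>r1\<close> along \<open>\<mu>\<close>, for some choice of the intermediate
  constructions: the FPC \<open>(n2, g2)\<close> through \<open>K\<^sub>2\<^sup>-\<close>, the pushout \<open>(u, v)\<close> with apex
  \<open>O\<^sub>2\<^sub>1\<close>, the pushout \<open>(jj, kk)\<close> with apex \<open>J\<^sub>2\<^sub>1\<^sup>-\<close>, the FPC \<open>(nn2, gg2)\<close> through
  \<open>K\<^sub>2\<^sup>=\<close>, the pushout \<open>(w, z)\<close> with apex \<open>O\<^sub>2\<^sub>1\<^sup>-\<close>, and the pullback \<open>(p, q)\<close> that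
  composes the two spans.\<close>

definition sqpo_composite ::
  "('o, 'a) cat \<Rightarrow> 'a rewrite_rule \<Rightarrow> 'a rewrite_rule \<Rightarrow> 'a rule_match \<Rightarrow> 'a rewrite_rule \<Rightarrow> bool"
  where
  "sqpo_composite C r2 r1 \<mu> r21 \<longleftrightarrow>
     (\<exists>n2 g2 u v jj kk nn2 gg2 w z p q.
        is_fpc C (in_leg r2) (j2 \<mu>) n2 g2 \<and>
        is_pushout C (out_leg r2) n2 u v \<and>
        is_pushout C (ko \<mu>) (kkj \<mu>) jj kk \<and>
        is_fpc C g2 jj nn2 gg2 \<and>
        is_pushout C v nn2 w z \<and>
        is_pullback C gg2 kk p q \<and>
        r21 = \<lparr>out_leg = z \<cdot>\<^bsub>C\<^esub> p, in_leg = kki \<mu> \<cdot>\<^bsub>C\<^esub> q\<rparr>)"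

text \<open>\<open>(J, K, I, KK, II)\<close> are compatible isomorphisms of the multi-sum, multi-POC, pushout and
  FPA data of \<open>\<mu>\<close> and \<open>\<mu>'\<close>.\<close>

definition rule_match_iso ::
  "('o, 'a) cat \<Rightarrow> 'a \<Rightarrow> 'a \<Rightarrow> 'a \<Rightarrow> 'a \<Rightarrow> 'a \<Rightarrow> 'a rule_match \<Rightarrow> 'a rule_match \<Rightarrow> bool" where
  "rule_match_iso C J K I KK II \<mu> \<mu>' \<longleftrightarrow>
     iso_between C (Cod C (j1 \<mu>)) (Cod C (j1 \<mu>')) J \<and>
     iso_between C (Cod C (kj \<mu>)) (Cod C (kj \<mu>')) K \<and>
     iso_between C (Cod C (pI \<mu>)) (Cod C (pI \<mu>')) I \<and>
     iso_between C (Cod C (kkj \<mu>)) (Cod C (kkj \<mu>')) KK \<and>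
     iso_between C (Cod C (iota \<mu>)) (Cod C (iota \<mu>')) II \<and>
     J \<cdot>\<^bsub>C\<^esub> j2 \<mu> = j2 \<mu>' \<and>
     J \<cdot>\<^bsub>C\<^esub> j1 \<mu> = j1 \<mu>' \<and>
     K \<cdot>\<^bsub>C\<^esub> kj \<mu> = kj \<mu>' \<and>
     J \<cdot>\<^bsub>C\<^esub> ko \<mu> = ko \<mu>' \<cdot>\<^bsub>C\<^esub> K \<and>
     I \<cdot>\<^bsub>C\<^esub> pI \<mu> = pI \<mu>' \<and>
     I \<cdot>\<^bsub>C\<^esub> pK \<mu> = pK \<mu>' \<cdot>\<^bsub>C\<^esub> K \<and>
     KK \<cdot>\<^bsub>C\<^esub> kkj \<mu> = kkj \<mu>' \<cdot>\<^bsub>C\<^esub> K \<and>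
     II \<cdot>\<^bsub>C\<^esub> kki \<mu> = kki \<mu>' \<cdot>\<^bsub>C\<^esub> KK \<and>
     II \<cdot>\<^bsub>C\<^esub> iota \<mu> = iota \<mu>' \<cdot>\<^bsub>C\<^esub> I"


section \<open>The two sets of pairs of matches\<close>

text \<open>The pairs \<open>(m\<^sub>1, m\<^sub>2)\<close>. They are recorded together with the chosen derivations, since the
  codomain of \<open>m\<^sub>2\<close> is only determined once a choice of \<open>X\<^sub>1\<close> has been made. The isomorphisms
  fix \<open>X\<^sub>0\<close>, hence \<open>m\<^sub>1\<close>, and transport \<open>m\<^sub>2\<close> along the isomorphism \<open>y1\<close> of the objects
  \<open>X\<^sub>1\<close>.\<close>

definition sequential_matches ::
  "('o, 'a) cat \<Rightarrow> 'a rewrite_rule \<Rightarrow> 'a rewrite_rule \<Rightarrow> 'o \<Rightarrow>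
   (('a \<times> 'a derivation) \<times> ('a \<times> 'a derivation)) set" where
  "sequential_matches C r2 r1 X0 = {((m1, d1), (m2, d2)).
     sqpo_derivation C r1 X0 m1 d1 \<and> sqpo_derivation C r2 (result C d1) m2 d2}"

definition sequential_matches_rel ::
  "('o, 'a) cat \<Rightarrow> 'a rewrite_rule \<Rightarrow> 'a rewrite_rule \<Rightarrow> 'o \<Rightarrow>
   ((('a \<times> 'a derivation) \<times> ('a \<times> 'a derivation)) \<times>
    (('a \<times> 'a derivation) \<times> ('a \<times> 'a derivation))) set" where
  "sequential_matches_rel C r2 r1 X0 = {(((m1, d1), (m2, d2)), ((m1', d1'), (m2', d2'))).
     ((m1, d1), (m2, d2)) \<in> sequential_matches C r2 r1 X0 \<and>
     ((m1', d1'), (m2', d2')) \<in> sequential_matches C r2 r1 X0 \<and>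
     (\<exists>k1 y1 k2 y2. derivation_iso C (Id C X0) k1 y1 m1 d1 m1' d1' \<and>
        derivation_iso C y1 k2 y2 m2 d2 m2' d2')}"

definition composite_matches ::
  "('o, 'a) cat \<Rightarrow> 'a rewrite_rule \<Rightarrow> 'a rewrite_rule \<Rightarrow> 'o \<Rightarrow> ('a rule_match \<times> 'a) set" where
  "composite_matches C r2 r1 X0 = {(\<mu>, m21). sqpo_rule_match C r2 r1 \<mu> \<and>
     (\<exists>r21. sqpo_composite C r2 r1 \<mu> r21 \<and> sqpo_match C r21 X0 m21)}"

definition composite_matches_rel ::
  "('o, 'a) cat \<Rightarrow> 'a rewrite_rule \<Rightarrow> 'a rewrite_rule \<Rightarrow> 'o \<Rightarrow>
   (('a rule_match \<times> 'a) \<times> ('a rule_match \<times> 'a)) set" where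
  "composite_matches_rel C r2 r1 X0 = {((\<mu>, m21), (\<mu>', m21')).
     (\<mu>, m21) \<in> composite_matches C r2 r1 X0 \<and> (\<mu>', m21') \<in> composite_matches C r2 r1 X0 \<and>
     (\<exists>J K I KK II. rule_match_iso C J K I KK II \<mu> \<mu>' \<and> m21' \<cdot>\<^bsub>C\<^esub> II = m21)}"

end

theory Submission
  imports Defs
begin

text \<open>In a quasi-topos the final pullback complement of \<open>f\<close> along a monomorphism \<open>m\<close> is a slice
  exponential, pushouts are stable under pullback, and partial map classifiers show that regular
  monomorphisms compose and that pushouts along them are pullbacks. Given two consecutive
  derivations, the jointly epic part \<open>J\<^sub>2\<^sub>1\<close> of the images of \<open>O\<^sub>1\<close> and \<open>I\<^sub>2\<close> in \<open>X\<^sub>1\<close> and the image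
  of \<open>I\<^sub>2\<^sub>1\<close> in \<open>X\<^sub>0\<close> determine \<open>\<mu>\<close> and \<open>m\<^sub>2\<^sub>1\<close>. Conversely, \<open>\<mu>\<close> enlarges both rules to rules that
  overlap in all of \<open>J\<^sub>2\<^sub>1\<^sup>-\<close>, for which composing derivations amounts to composing spans. The
  relation \<open>compatible_via\<close> between the two kinds of data is total and unique up to isomorphism in
  both directions, so it induces the bijection.\<close>

section \<open>Arrows and isomorphisms\<close>

text \<open>The obstacle is that neither leg of a rule is assumed monic. On the input side a final
  pullback complement then clones: in directed graphs, if two vertices of \<open>K1\<close> lie over
  one matched vertex, an edge of \<open>X0\<close> from that vertex to one outside the match has a
  copy for each of them. The pushout \<open>I\<^sub>2\<^sub>1\<close> identifies the two vertices
  but can keep both copies of the edge, while \<open>X0\<close> has only one, so the induced arrow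
  from \<open>I\<^sub>2\<^sub>1\<close> to \<open>X0\<close> need not be monic. Its epi part is what
  an FPC-augmentation records; its regular mono part is \<open>m21\<close>. On the output side a
  pushout complement of a non-monic leg is not unique, and the first derivation singles one out.
  Squares are therefore moved only in directions that hold for arbitrary legs: pushouts and
  complements restrict along pullbacks, and they paste and cancel along regular monos. Complements,
  pushouts and images are fixed only up to isomorphism, so each choice is carried as data and the
  two kinds of data are linked by a relation instead of a function.\<close>

lemma ex1_unique: "\<exists>!x. P x \<Longrightarrow> P a \<Longrightarrow> P b \<Longrightarrow> a = b"
  by auto

definition monic :: "('o, 'a) cat \<Rightarrow> 'a \<Rightarrow> bool" where
  "monic C m \<longleftrightarrow> m \<in> Arr C \<and>
     (\<forall>T u v. u \<in> hom C T (Dom C m) \<and> v \<in> hom C T (Dom C m) \<and> m \<cdot>\<^bsub>C\<^esub> u = m \<cdot>\<^bsub>C\<^esub> v \<longrightarrow> u = v)"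

context category
begin

lemma homD: "f \<in> hom C A B \<Longrightarrow> f \<in> Arr C" "f \<in> hom C A B \<Longrightarrow> Dom C f = A"
  "f \<in> hom C A B \<Longrightarrow> Cod C f = B"
  by (auto simp: hom_def)

lemma hom_conj: "f \<in> hom C A B \<Longrightarrow> f \<in> Arr C \<and> Dom C f = A \<and> Cod C f = B"
  by (simp add: hom_def)

lemma homI: "f \<in> Arr C \<Longrightarrow> f \<in> hom C (Dom C f) (Cod C f)"
  by (simp add: hom_def)

lemma hom_Ob: assumes "f \<in> hom C A B" shows "A \<in> Ob C" "B \<in> Ob C"
  using assms Dom_Ob Cod_Ob by (auto simp: hom_def)

lemma comp_arr [simp]:
  assumes "f \<in> Arr C" "g \<in> Arr C" "Dom C g = Cod C f"
  shows "g \<cdot> f \<in> Arr C" "Dom C (g \<cdot> f) = Dom C f" "Cod C (g \<cdot> f) = Cod C g"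
  using Comp_hom[of f "Dom C f" "Cod C f" g "Cod C g"] assms by (auto simp: hom_def)

lemma comp_assoc [simp]:
  assumes "f \<in> Arr C" "g \<in> Arr C" "h \<in> Arr C" "Dom C g = Cod C f" "Dom C h = Cod C g"
  shows "(h \<cdot> g) \<cdot> f = h \<cdot> (g \<cdot> f)"
  using Comp_assoc[of f "Dom C f" "Cod C f" g "Cod C g" h "Cod C h"] assms
  by (auto simp: hom_def)

lemma id_arr [simp]:
  assumes "A \<in> Ob C"
  shows "Id C A \<in> Arr C" "Dom C (Id C A) = A" "Cod C (Id C A) = A"
  using Id_hom[OF assms] by (auto simp: hom_def)

lemma comp_id [simp]: "f \<in> Arr C \<Longrightarrow> Dom C f = A \<Longrightarrow> f \<cdot> Id C A = f"
  using Comp_Id by (auto simp: hom_def)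

lemma id_comp [simp]: "f \<in> Arr C \<Longrightarrow> Cod C f = A \<Longrightarrow> Id C A \<cdot> f = f"
  using Id_Comp by (auto simp: hom_def)

declare Dom_Ob [simp] Cod_Ob [simp]

text \<open>With \<open>comp_assoc\<close> as a simp rule, composites are bracketed to the right,
  and an equation \<open>a \<cdot> b = c\<close> no longer matches inside a longer one. Equations
  are therefore passed on through this rule, with the tail \<open>x\<close> left open.\<close>

lemma comp_cancel:
  assumes "a \<cdot> b = c" "a \<in> Arr C" "b \<in> Arr C" "x \<in> Arr C" "Dom C a = Cod C b" "Dom C b = Cod C x"
  shows "a \<cdot> (b \<cdot> x) = c \<cdot> x"
  using assms comp_assoc by metis

lemma iso_betweenE:
  assumes "iso_between C X Y f"
  obtains g where "f \<in> hom C X Y" "g \<in> hom C Y X" "g \<cdot> f = Id C X" "f \<cdot> g = Id C Y"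
    "iso_between C Y X g"
  using assms by (auto simp: iso_between_def)

lemma iso_between_hom: "iso_between C X Y f \<Longrightarrow> f \<in> hom C X Y"
  by (simp add: iso_between_def)

lemma iso_between_id: "X \<in> Ob C \<Longrightarrow> iso_between C X X (Id C X)"
  by (auto simp: iso_between_def hom_def intro!: bexI[of _ "Id C X"])

lemma iso_between_comp:
  assumes "iso_between C X Y f" "iso_between C Y Z g"
  shows "iso_between C X Z (g \<cdot> f)"
proof -
  obtain f' where f': "f \<in> hom C X Y" "f' \<in> hom C Y X" "f' \<cdot> f = Id C X" "f \<cdot> f' = Id C Y"
    using assms iso_betweenE by metis
  obtain g' where g': "g \<in> hom C Y Z" "g' \<in> hom C Z Y" "g' \<cdot> g = Id C Y" "g \<cdot> g' = Id C Z"
    using assms iso_betweenE by metis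
  have "(f' \<cdot> g') \<cdot> (g \<cdot> f) = Id C X" "(g \<cdot> f) \<cdot> (f' \<cdot> g') = Id C Z"
    using f' g' f'(4)[THEN comp_cancel] g'(3)[THEN comp_cancel] by (auto simp: hom_def)
  then show ?thesis
    using f' g' Comp_hom unfolding iso_between_def by blast
qed

lemma isomorphic_sym: "isomorphic C X Y \<Longrightarrow> isomorphic C Y X"
  by (metis isomorphic_def iso_betweenE)

lemma isomorphic_trans: "isomorphic C X Y \<Longrightarrow> isomorphic C Y Z \<Longrightarrow> isomorphic C X Z"
  by (metis isomorphic_def iso_between_comp)

lemma monicD:
  "monic C m \<Longrightarrow> m \<in> hom C A B \<Longrightarrow> u \<in> hom C T A \<Longrightarrow> v \<in> hom C T A \<Longrightarrow> m \<cdot> u = m \<cdot> v \<Longrightarrow> u = v"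
  unfolding monic_def by (metis homD(2))

lemma monicI:
  assumes "m \<in> hom C A B"
    "\<And>T u v. u \<in> hom C T A \<Longrightarrow> v \<in> hom C T A \<Longrightarrow> m \<cdot> u = m \<cdot> v \<Longrightarrow> u = v"
  shows "monic C m"
  using assms unfolding monic_def by (metis homD(1,2))

lemma monic_cancel:
  assumes "monic C (n \<cdot> m)" "m \<in> hom C A B" "n \<in> hom C B D"
  shows "monic C m"
proof (rule monicI[OF assms(2)])
  fix T u v
  assume uv: "u \<in> hom C T A" "v \<in> hom C T A" "m \<cdot> u = m \<cdot> v"
  then have "n \<cdot> m \<cdot> u = n \<cdot> m \<cdot> v"
    using assms by (auto simp: hom_def)
  then show "u = v"
    using monicD[OF assms(1) _ uv(1,2), of D] assms by (auto simp: hom_def)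
qed

lemma iso_monic: "iso_between C X Y f \<Longrightarrow> monic C f"
proof -
  assume "iso_between C X Y f"
  then obtain g where g: "f \<in> hom C X Y" "g \<in> hom C Y X" "g \<cdot> f = Id C X"
    using iso_betweenE by metis
  have "monic C (Id C X)"
    using hom_Ob[OF g(1)] by (intro monicI[of _ X X]) (auto simp: hom_def)
  then show ?thesis
    using monic_cancel[of g f X Y X] g by simp
qed

lemma epiD:
  "epi C e \<Longrightarrow> e \<in> hom C A B \<Longrightarrow> u \<in> hom C B T \<Longrightarrow> v \<in> hom C B T \<Longrightarrow> u \<cdot> e = v \<cdot> e \<Longrightarrow> u = v"
  unfolding epi_def by (metis homD)

lemma epiI:
  assumes "e \<in> hom C A B"
    "\<And>T u v. u \<in> hom C B T \<Longrightarrow> v \<in> hom C B T \<Longrightarrow> u \<cdot> e = v \<cdot> e \<Longrightarrow> u = v"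
  shows "epi C e"
  unfolding epi_def using assms by (metis homD homI)

section \<open>Pullbacks and pushouts\<close>

lemma pullbackE:
  assumes "is_pullback C f g p q"
  obtains P X Y Z where "f \<in> hom C X Z" "g \<in> hom C Y Z" "p \<in> hom C P X" "q \<in> hom C P Y"
    "f \<cdot> p = g \<cdot> q"
  using assms unfolding is_pullback_def hom_def by (auto)

lemma pullback_hom:
  assumes "is_pullback C f g p q" "f \<in> hom C X Z" "g \<in> hom C Y Z'"
  shows "Z' = Z" "p \<in> hom C (Dom C p) X" "q \<in> hom C (Dom C p) Y" "f \<cdot> p = g \<cdot> q"
  using assms unfolding is_pullback_def hom_def by auto

lemma pullback_ex:
  assumes "is_pullback C f g p q" "p \<in> hom C P X" "q \<in> hom C P Y"
    "x \<in> hom C T X" "y \<in> hom C T Y" "f \<cdot> x = g \<cdot> y"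
  obtains u where "u \<in> hom C T P" "p \<cdot> u = x" "q \<cdot> u = y"
proof -
  have "\<exists>!u. u \<in> hom C T P \<and> p \<cdot> u = x \<and> q \<cdot> u = y"
    using assms(1)[unfolded is_pullback_def, THEN conjunct2, THEN conjunct2, THEN conjunct2,
      THEN conjunct2, THEN conjunct2, THEN conjunct2, THEN conjunct2, THEN conjunct2,
      THEN conjunct2, THEN spec[of _ x], THEN spec[of _ y]] assms
    by (auto simp: hom_def is_pullback_def)
  then show ?thesis using that by blast
qed

lemma pullback_unique:
  assumes "is_pullback C f g p q" "p \<in> hom C P X"
    "u \<in> hom C T P" "v \<in> hom C T P" "p \<cdot> u = p \<cdot> v" "q \<cdot> u = q \<cdot> v"
  shows "u = v"
proof -
  have *: "f \<cdot> (p \<cdot> u) = g \<cdot> (q \<cdot> u)"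
    using assms unfolding is_pullback_def hom_def by simp (metis comp_assoc)
  have "\<exists>!w. w \<in> hom C (Dom C (p \<cdot> u)) (Dom C p) \<and> p \<cdot> w = p \<cdot> u \<and> q \<cdot> w = q \<cdot> u"
    using assms(1)[unfolded is_pullback_def, THEN conjunct2, THEN conjunct2, THEN conjunct2,
      THEN conjunct2, THEN conjunct2, THEN conjunct2, THEN conjunct2, THEN conjunct2,
      THEN conjunct2, THEN spec[of _ "p \<cdot> u"], THEN spec[of _ "q \<cdot> u"]] * assms(1-4)
    by (simp add: hom_def is_pullback_def)
  moreover have "Dom C (p \<cdot> u) = T" "Dom C p = P"
    using assms(2,3) by (auto simp: hom_def)
  ultimately show ?thesis
    using assms(3-6) by metis
qed

lemma pullbackI:
  assumes "f \<in> hom C X Z" "g \<in> hom C Y Z" "p \<in> hom C P X" "q \<in> hom C P Y" "f \<cdot> p = g \<cdot> q"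
    "\<And>T x y. x \<in> hom C T X \<Longrightarrow> y \<in> hom C T Y \<Longrightarrow> f \<cdot> x = g \<cdot> y \<Longrightarrow>
       \<exists>u \<in> hom C T P. p \<cdot> u = x \<and> q \<cdot> u = y"
    "\<And>T u v. u \<in> hom C T P \<Longrightarrow> v \<in> hom C T P \<Longrightarrow> p \<cdot> u = p \<cdot> v \<Longrightarrow> q \<cdot> u = q \<cdot> v \<Longrightarrow> u = v"
  shows "is_pullback C f g p q"
proof -
  have "\<exists>!u. u \<in> hom C (Dom C x) P \<and> p \<cdot> u = x \<and> q \<cdot> u = y"
    if "x \<in> Arr C" "y \<in> Arr C" "Dom C x = Dom C y" "Cod C x = X" "Cod C y = Y" "f \<cdot> x = g \<cdot> y"
    for x y
    using assms(6)[of x "Dom C x" y] assms(7)[of _ "Dom C x"] that by (fastforce simp: hom_def)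
  then show ?thesis
    using assms(1-5) unfolding is_pullback_def by (auto simp: hom_def)
qed

lemma pullback_sym:
  assumes "is_pullback C f g p q"
  shows "is_pullback C g f q p"
proof -
  obtain X Y Z P where 1: "f \<in> hom C X Z" "g \<in> hom C Y Z" "p \<in> hom C P X" "q \<in> hom C P Y"
    "f \<cdot> p = g \<cdot> q"
    using pullbackE[OF assms] by metis
  show ?thesis
  proof (rule pullbackI[OF 1(2,1,4,3) 1(5)[symmetric]])
    fix T x y
    assume "x \<in> hom C T Y" "y \<in> hom C T X" "g \<cdot> x = f \<cdot> y"
    then show "\<exists>u \<in> hom C T P. q \<cdot> u = x \<and> p \<cdot> u = y"
      using pullback_ex[OF assms 1(3,4)] by metis
  next
    fix T u v
    assume "u \<in> hom C T P" "v \<in> hom C T P" "q \<cdot> u = q \<cdot> v" "p \<cdot> u = p \<cdot> v"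
    then show "u = v"
      using pullback_unique[OF assms 1(3)] by metis
  qed
qed

lemma pullback_paste:
  assumes r: "is_pullback C f g p q" and l: "is_pullback C x p a b"
  shows "is_pullback C (f \<cdot> x) g a (q \<cdot> b)"
proof -
  obtain X Y Z P where 1: "f \<in> hom C X Z" "g \<in> hom C Y Z" "p \<in> hom C P X" "q \<in> hom C P Y"
    "f \<cdot> p = g \<cdot> q"
    using pullbackE[OF r] by metis
  obtain X' P' where 2: "x \<in> hom C X' X" "a \<in> hom C P' X'" "b \<in> hom C P' P" "x \<cdot> a = p \<cdot> b"
    using pullbackE[OF l] 1 by (metis homD)
  note T = 1(1-4)[THEN hom_conj] 2(1-3)[THEN hom_conj]
  show ?thesis
  proof (rule pullbackI[of _ X' Z _ Y _ P'])
    fix T s t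
    assume st: "s \<in> hom C T X'" "t \<in> hom C T Y" "f \<cdot> x \<cdot> s = g \<cdot> t"
    then have "f \<cdot> (x \<cdot> s) = g \<cdot> t" using T by (simp add: hom_def)
    then obtain u where u: "u \<in> hom C T P" "p \<cdot> u = x \<cdot> s" "q \<cdot> u = t"
      using pullback_ex[OF r 1(3,4), of "x \<cdot> s" T t] st T by (auto simp: hom_def)
    obtain v where "v \<in> hom C T P'" "a \<cdot> v = s" "b \<cdot> v = u"
      using pullback_ex[OF l 2(2,3), of s T u] st u by auto
    then show "\<exists>v \<in> hom C T P'. a \<cdot> v = s \<and> q \<cdot> b \<cdot> v = t"
      using u T by (intro bexI[of _ v]) (auto simp: hom_def)
  next
    fix T u v
    assume uv: "u \<in> hom C T P'" "v \<in> hom C T P'" "a \<cdot> u = a \<cdot> v" "q \<cdot> b \<cdot> u = q \<cdot> b \<cdot> v"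
    have "p \<cdot> (b \<cdot> u) = p \<cdot> (b \<cdot> v)"
      using uv T 2(4)[symmetric, THEN comp_cancel] by (auto simp: hom_def)
    then have "b \<cdot> u = b \<cdot> v"
      using uv T apply - by (rule pullback_unique[OF r 1(3), of _ T]) (auto simp: hom_def)
    then show "u = v"
      using pullback_unique[OF l 2(2) uv(1-3)] by simp
  qed (use T 1(5)[THEN comp_cancel] 2(4) in \<open>auto simp: hom_def\<close>)
qed

text \<open>The outer square supplies the mediating arrow, and uniqueness in the right-hand square
  forces its image under \<open>b\<close> to be the prescribed one. Later this is how a square
  inside a larger one is recognised as a pullback.\<close>

lemma pullback_unpaste:
  assumes r: "is_pullback C f g p q" and o: "is_pullback C (f \<cdot> x) g a c"
    and x: "x \<in> hom C X' X" "f \<in> hom C X Z" and b: "b \<in> hom C (Dom C a) (Dom C p)"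
    and e: "x \<cdot> a = p \<cdot> b" "q \<cdot> b = c"
  shows "is_pullback C x p a b"
proof -
  obtain Y P where 1: "g \<in> hom C Y Z" "p \<in> hom C P X" "q \<in> hom C P Y" "f \<cdot> p = g \<cdot> q"
    using pullbackE[OF r] x by (metis homD)
  have fx: "f \<cdot> x \<in> hom C X' Z"
    using x by (auto simp: hom_def)
  obtain P' where 2: "a \<in> hom C P' X'" "c \<in> hom C P' Y" "f \<cdot> x \<cdot> a = g \<cdot> c"
    using pullback_hom[OF o fx 1(1)] by blast
  have b': "b \<in> hom C P' P" using b 1 2 by (simp add: hom_def)
  note T = 1(1-3)[THEN hom_conj] 2(1-2)[THEN hom_conj]
    x[THEN hom_conj] b'[THEN hom_conj]
  show ?thesis
  proof (rule pullbackI[OF x(1) 1(2) 2(1) b' e(1)])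
    fix T s t
    assume st: "s \<in> hom C T X'" "t \<in> hom C T P" "x \<cdot> s = p \<cdot> t"
    then have "(f \<cdot> x) \<cdot> s = g \<cdot> (q \<cdot> t)"
      using T 1(4)[symmetric, THEN comp_cancel] by (auto simp: hom_def)
    then obtain u where u: "u \<in> hom C T P'" "a \<cdot> u = s" "c \<cdot> u = q \<cdot> t"
      using pullback_ex[OF o 2(1,2) st(1), of "q \<cdot> t"] st T by (auto simp: hom_def)
    have "q \<cdot> (b \<cdot> u) = c \<cdot> u"
      using u T e(2)[THEN comp_cancel] by (auto simp: hom_def)
    moreover have "p \<cdot> (b \<cdot> u) = p \<cdot> t"
      using u T e(1)[symmetric, THEN comp_cancel] st by (auto simp: hom_def)
    ultimately have "b \<cdot> u = t"
      using u st T apply - by (rule pullback_unique[OF r 1(2), of _ T]) (auto simp: hom_def)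
    then show "\<exists>u \<in> hom C T P'. a \<cdot> u = s \<and> b \<cdot> u = t"
      using u by blast
  next
    fix T u v
    assume uv: "u \<in> hom C T P'" "v \<in> hom C T P'" "a \<cdot> u = a \<cdot> v" "b \<cdot> u = b \<cdot> v"
    have "c \<cdot> u = c \<cdot> v"
      using e(2) uv T by (auto simp: hom_def)
    then show "u = v"
      using pullback_unique[OF o 2(1) uv(1-3)] by simp
  qed
qed

lemma pullback_monic:
  assumes "is_pullback C f g p q" "monic C g"
  shows "monic C p"
proof -
  obtain X Y Z P where 1: "f \<in> hom C X Z" "g \<in> hom C Y Z" "p \<in> hom C P X" "q \<in> hom C P Y"
    "f \<cdot> p = g \<cdot> q"
    using pullbackE[OF assms(1)] by metis
  note T = 1(1-4)[THEN hom_conj]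
  show ?thesis
  proof (rule monicI[OF 1(3)])
    fix T u v
    assume uv: "u \<in> hom C T P" "v \<in> hom C T P" "p \<cdot> u = p \<cdot> v"
    then have "g \<cdot> (q \<cdot> u) = g \<cdot> (q \<cdot> v)"
      using T 1(5)[symmetric, THEN comp_cancel] by (auto simp: hom_def)
    then have "q \<cdot> u = q \<cdot> v"
      using uv T apply - by (rule monicD[OF assms(2) 1(2), of _ T]) (auto simp: hom_def)
    then show "u = v"
      using pullback_unique[OF assms(1) 1(3) uv] by simp
  qed
qed

text \<open>A monic \<open>m\<close> reflects commutation, so both cospans admit the same commuting
  squares. This moves pullbacks between an object and its subobjects.\<close>

lemma pullback_mono_comp:
  assumes "monic C m" "m \<in> hom C Z W" "f \<in> hom C X Z" "g \<in> hom C Y Z"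
  shows "is_pullback C (m \<cdot> f) (m \<cdot> g) p q \<longleftrightarrow> is_pullback C f g p q"
proof -
  have *: "m \<cdot> f \<cdot> x = m \<cdot> g \<cdot> y \<longleftrightarrow> f \<cdot> x = g \<cdot> y"
    if "x \<in> Arr C" "y \<in> Arr C" "Dom C x = Dom C y" "Cod C x = X" "Cod C y = Y" for x y
    using monicD[OF assms(1,2), of "f \<cdot> x" "Dom C x" "g \<cdot> y"] assms that by (auto simp: hom_def)
  have T: "Dom C f = X" "Dom C g = Y" "Dom C (m \<cdot> f) = X" "Dom C (m \<cdot> g) = Y"
    "f \<in> Arr C" "g \<in> Arr C" "m \<cdot> f \<in> Arr C" "m \<cdot> g \<in> Arr C"
    "Cod C f = Z" "Cod C g = Z" "Cod C (m \<cdot> f) = W" "Cod C (m \<cdot> g) = W"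
    using assms by (auto simp: hom_def)
  show ?thesis
    unfolding is_pullback_def T by (simp add: * T del: comp_assoc cong: conj_cong)
qed

text \<open>It turns a factorization through a subobject into a pullback square, the form that
  pasting and stability of pushouts work with.\<close>

lemma pullback_mono_self:
  assumes "monic C m" "m \<in> hom C Y Z" "f \<in> hom C X Y"
  shows "is_pullback C m (m \<cdot> f) f (Id C X)"
proof (rule pullbackI[of _ Y Z _ X _ X])
  fix T x y
  assume xy: "x \<in> hom C T Y" "y \<in> hom C T X" "m \<cdot> x = m \<cdot> f \<cdot> y"
  then have "x = f \<cdot> y"
    using assms apply - by (rule monicD[OF assms(1,2), of _ T]) (auto simp: hom_def)
  then show "\<exists>u \<in> hom C T X. f \<cdot> u = x \<and> Id C X \<cdot> u = y"
    using xy by (intro bexI[of _ y]) (auto simp: hom_def)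
qed (use assms in \<open>auto simp: hom_def\<close>)

lemma pullback_iso_apex:
  assumes "is_pullback C f g p q" "iso_between C P' (Dom C p) \<phi>"
  shows "is_pullback C f g (p \<cdot> \<phi>) (q \<cdot> \<phi>)"
proof -
  obtain X Y Z P where 1: "f \<in> hom C X Z" "g \<in> hom C Y Z" "p \<in> hom C P X" "q \<in> hom C P Y"
    "f \<cdot> p = g \<cdot> q"
    using pullbackE[OF assms(1)] by metis
  obtain \<psi> where 2: "\<phi> \<in> hom C P' P" "\<psi> \<in> hom C P P'" "\<phi> \<cdot> \<psi> = Id C P"
    using iso_betweenE[OF assms(2)] 1 by (metis homD(2))
  note T = 1(1-4)[THEN hom_conj] 2(1-2)[THEN hom_conj]
  note m = monicD[OF iso_monic[OF assms(2)] 2(1)]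
  show ?thesis
  proof (rule pullbackI[OF 1(1,2), of _ P'])
    fix T x y
    assume xy: "x \<in> hom C T X" "y \<in> hom C T Y" "f \<cdot> x = g \<cdot> y"
    then obtain u where u: "u \<in> hom C T P" "p \<cdot> u = x" "q \<cdot> u = y"
      using pullback_ex[OF assms(1) 1(3,4)] by metis
    then show "\<exists>u \<in> hom C T P'. p \<cdot> \<phi> \<cdot> u = x \<and> q \<cdot> \<phi> \<cdot> u = y"
      using T 2(3)[THEN comp_cancel] by (intro bexI[of _ "\<psi> \<cdot> u"]) (auto simp: hom_def)
  next
    fix T u v
    assume uv: "u \<in> hom C T P'" "v \<in> hom C T P'" "p \<cdot> \<phi> \<cdot> u = p \<cdot> \<phi> \<cdot> v" "q \<cdot> \<phi> \<cdot> u = q \<cdot> \<phi> \<cdot> v"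
    then have "\<phi> \<cdot> u = \<phi> \<cdot> v"
      using T apply - by (rule pullback_unique[OF assms(1) 1(3), of _ T]) (auto simp: hom_def)
    then show "u = v"
      using m uv by auto
  qed (use T 1(5)[THEN comp_cancel] in \<open>auto simp: hom_def\<close>)
qed

lemma pullback_iso:
  assumes a: "is_pullback C f g p q" and b: "is_pullback C f g p' q'"
  obtains \<phi> where "iso_between C (Dom C p) (Dom C p') \<phi>" "p' \<cdot> \<phi> = p" "q' \<cdot> \<phi> = q"
proof -
  obtain X Y Z P where 1: "f \<in> hom C X Z" "g \<in> hom C Y Z" "p \<in> hom C P X" "q \<in> hom C P Y"
    "f \<cdot> p = g \<cdot> q"
    using pullbackE[OF a] by metis
  obtain P' where 2: "p' \<in> hom C P' X" "q' \<in> hom C P' Y" "f \<cdot> p' = g \<cdot> q'"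
    using pullback_hom[OF b 1(1,2)] by metis
  note T = 1(1-4)[THEN hom_conj] 2(1-2)[THEN hom_conj]
  obtain u where u: "u \<in> hom C P P'" "p' \<cdot> u = p" "q' \<cdot> u = q"
    using pullback_ex[OF b 2(1,2) 1(3-5)] .
  obtain v where v: "v \<in> hom C P' P" "p \<cdot> v = p'" "q \<cdot> v = q'"
    using pullback_ex[OF a 1(3,4) 2] .
  have "v \<cdot> u = Id C P"
    using u v T u(2,3)[THEN comp_cancel] v(2,3)[THEN comp_cancel] hom_Ob[OF 1(3)]
    apply - by (rule pullback_unique[OF a 1(3), of _ P]) (auto simp: hom_def)
  moreover have "u \<cdot> v = Id C P'"
    using u v T u(2,3)[THEN comp_cancel] v(2,3)[THEN comp_cancel] hom_Ob[OF 2(1)]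
    apply - by (rule pullback_unique[OF b 2(1), of _ P']) (auto simp: hom_def)
  ultimately have "iso_between C P P' u"
    using u v by (auto simp: iso_between_def)
  then show ?thesis
    using that u T by metis
qed

section \<open>Duality: pushouts as pullbacks in the opposite category\<close>

lemma opposite_category: "category (opposite C)"
  by unfold_locales (auto simp: opposite_def hom_def)

end

lemma hom_opposite [simp]: "hom (opposite C) A B = hom C B A"
  by (auto simp: hom_def opposite_def)

lemma Comp_opposite [simp]: "Comp (opposite C) g f = f \<cdot>\<^bsub>C\<^esub> g"
  by (simp add: opposite_def)

lemma sel_opposite [simp]: "Dom (opposite C) = Cod C" "Cod (opposite C) = Dom C"
  "Arr (opposite C) = Arr C" "Ob (opposite C) = Ob C" "Id (opposite C) = Id C"
  by (simp_all add: opposite_def)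

lemma iso_between_opposite [simp]: "iso_between (opposite C) X Y f = iso_between C Y X f"
  unfolding iso_between_def by auto

lemma pullback_opposite [simp]: "is_pullback (opposite C) f g p q = is_pushout C f g p q"
  unfolding is_pullback_def is_pushout_def by simp

context category
begin

lemma pushoutE:
  assumes "is_pushout C f g p q"
  obtains P X Y Z where "f \<in> hom C Z X" "g \<in> hom C Z Y" "p \<in> hom C X P" "q \<in> hom C Y P"
    "p \<cdot> f = q \<cdot> g"
  using assms unfolding is_pushout_def hom_def by (auto)

lemma pushout_hom:
  assumes "is_pushout C f g p q" "f \<in> hom C Z X" "g \<in> hom C Z' Y"
  shows "Z' = Z" "p \<in> hom C X (Cod C p)" "q \<in> hom C Y (Cod C p)" "p \<cdot> f = q \<cdot> g"
  using assms unfolding is_pushout_def hom_def by auto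

lemma pushout_ex:
  assumes "is_pushout C f g p q" "p \<in> hom C X P" "q \<in> hom C Y P"
    "x \<in> hom C X T" "y \<in> hom C Y T" "x \<cdot> f = y \<cdot> g"
  obtains u where "u \<in> hom C P T" "u \<cdot> p = x" "u \<cdot> q = y"
  using category.pullback_ex[OF opposite_category, of f g p q] assms that by simp metis

lemma pushout_unique:
  assumes "is_pushout C f g p q" "p \<in> hom C X P"
    "u \<in> hom C P T" "v \<in> hom C P T" "u \<cdot> p = v \<cdot> p" "u \<cdot> q = v \<cdot> q"
  shows "u = v"
  using category.pullback_unique[OF opposite_category, of f g p q] assms by simp

lemma pushoutI:
  assumes "f \<in> hom C Z X" "g \<in> hom C Z Y" "p \<in> hom C X P" "q \<in> hom C Y P" "p \<cdot> f = q \<cdot> g"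
    "\<And>T x y. x \<in> hom C X T \<Longrightarrow> y \<in> hom C Y T \<Longrightarrow> x \<cdot> f = y \<cdot> g \<Longrightarrow>
       \<exists>u \<in> hom C P T. u \<cdot> p = x \<and> u \<cdot> q = y"
    "\<And>T u v. u \<in> hom C P T \<Longrightarrow> v \<in> hom C P T \<Longrightarrow> u \<cdot> p = v \<cdot> p \<Longrightarrow> u \<cdot> q = v \<cdot> q \<Longrightarrow> u = v"
  shows "is_pushout C f g p q"
  using category.pullbackI[OF opposite_category, of f X Z g Y p P q] assms by simp

lemma pushout_sym: "is_pushout C f g p q \<Longrightarrow> is_pushout C g f q p"
  using category.pullback_sym[OF opposite_category] by simp

lemma pushout_paste:
  assumes "is_pushout C f g p q" "is_pushout C x p a b"
  shows "is_pushout C (x \<cdot> f) g a (b \<cdot> q)"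
  using category.pullback_paste[OF opposite_category] assms by simp

lemma pushout_unpaste:
  assumes "is_pushout C f g p q" "is_pushout C (x \<cdot> f) g a c"
    "x \<in> hom C X X'" "f \<in> hom C Z X" "b \<in> hom C (Cod C p) (Cod C a)"
    "a \<cdot> x = b \<cdot> p" "b \<cdot> q = c"
  shows "is_pushout C x p a b"
  using category.pullback_unpaste[OF opposite_category, of f g p q x a c] assms by simp

lemma pushout_iso:
  assumes "is_pushout C f g p q" "is_pushout C f g p' q'"
  obtains \<phi> where "iso_between C (Cod C p) (Cod C p') \<phi>" "\<phi> \<cdot> p = p'" "\<phi> \<cdot> q = q'"
  using category.pullback_iso[OF opposite_category, of f g p' q' p q] assms that by simp metis

lemma pushout_id:
  assumes "f \<in> hom C A B"
  shows "is_pushout C f (Id C A) (Id C B) f"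
proof (rule pushoutI[OF assms, of _ A _ B])
  fix T x y
  assume "x \<in> hom C B T" "y \<in> hom C A T" "x \<cdot> f = y \<cdot> Id C A"
  then show "\<exists>u \<in> hom C B T. u \<cdot> Id C B = x \<and> u \<cdot> f = y"
    by (intro bexI[of _ x]) (auto simp: hom_def)
qed (use hom_Ob[OF assms] assms in \<open>auto simp: hom_def\<close>)

section \<open>Existence of limits and exponentials\<close>


lemma terminal_exists:
  assumes "has_finite_limits C"
  obtains T where "is_terminal C T"
proof -
  have "finite_diagram C {} {} s t D M" for s t :: "nat \<Rightarrow> nat" and D M
    by (simp add: finite_diagram_def)
  then show ?thesis
    using assms that unfolding has_finite_limits_def is_terminal_def is_cone_def
    by (metis (no_types, lifting) empty_iff)
qed

lemma pullback_exists:
  assumes lim: "has_finite_limits C" and f: "f \<in> hom C X Z" and g: "g \<in> hom C Y Z"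
  obtains P p q where "p \<in> hom C P X" "q \<in> hom C P Y" "is_pullback C f g p q"
proof -
  let ?D = "\<lambda>v::nat. if v = 0 then X else if v = 1 then Y else Z"
  let ?M = "\<lambda>e::nat. if e = 0 then f else g"
  let ?cone = "is_cone C {0,1,2} {0,1} (\<lambda>e. e) (\<lambda>e. 2) ?D ?M"
  have fd: "finite_diagram C {0,1,2} {0,1} (\<lambda>e. e) (\<lambda>e. 2) ?D ?M"
    using f g hom_Ob[OF f] hom_Ob[OF g] by (auto simp: finite_diagram_def)
  obtain L p where L: "?cone L p"
    and univ: "\<And>L' p'. ?cone L' p' \<Longrightarrow> \<exists>!u. u \<in> hom C L' L \<and> (\<forall>v \<in> {0,1,2}. p v \<cdot> u = p' v)"
    using lim[unfolded has_finite_limits_def, rule_format, OF fd] by blast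
  have p: "p 0 \<in> hom C L X" "p 1 \<in> hom C L Y" "f \<cdot> p 0 = p 2" "g \<cdot> p 1 = p 2"
    using L by (auto simp: is_cone_def)
  have cone: "?cone T (\<lambda>v. if v = 0 then x else if v = 1 then y else f \<cdot> x)"
    if "x \<in> hom C T X" "y \<in> hom C T Y" "f \<cdot> x = g \<cdot> y" for T x y
    using that hom_Ob[OF that(1)] f g Comp_hom by (auto simp: is_cone_def)
  have "is_pullback C f g (p 0) (p 1)"
  proof (rule pullbackI[OF f g p(1,2)])
    fix T x y
    assume "x \<in> hom C T X" "y \<in> hom C T Y" "f \<cdot> x = g \<cdot> y"
    from univ[OF cone[OF this]] show "\<exists>u \<in> hom C T L. p 0 \<cdot> u = x \<and> p 1 \<cdot> u = y"
      by auto
  next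
    fix T u v
    assume uv: "u \<in> hom C T L" "v \<in> hom C T L" "p 0 \<cdot> u = p 0 \<cdot> v" "p 1 \<cdot> u = p 1 \<cdot> v"
    have "f \<cdot> (p 0 \<cdot> u) = g \<cdot> (p 1 \<cdot> u)"
      using Comp_assoc[OF uv(1) p(1) f] Comp_assoc[OF uv(1) p(2) g] p(3,4) by metis
    moreover have "p 0 \<cdot> u \<in> hom C T X" "p 1 \<cdot> u \<in> hom C T Y"
      using p uv Comp_hom by blast+
    ultimately have "\<exists>!w. w \<in> hom C T L \<and> p 0 \<cdot> w = p 0 \<cdot> u \<and> p 1 \<cdot> w = p 1 \<cdot> u \<and>
        p 2 \<cdot> w = f \<cdot> (p 0 \<cdot> u)"
      using univ[OF cone, of "p 0 \<cdot> u" T "p 1 \<cdot> u"] by simp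
    moreover have "p 2 \<cdot> u = f \<cdot> (p 0 \<cdot> u)" "p 2 \<cdot> v = f \<cdot> (p 0 \<cdot> u)"
      using p(3) uv(3) Comp_assoc[OF uv(1) p(1) f] Comp_assoc[OF uv(2) p(1) f] by metis+
    ultimately show "u = v"
      using uv by metis
  qed (use p in auto)
  then show ?thesis
    using that p by blast
qed

text \<open>The product is a pullback over a terminal object. Its universal property is spelled out
  instead of using \<open>is_product\<close>, so that reading it in the opposite category directly
  gives binary coproducts.\<close>

lemma product_exists:
  assumes lim: "has_finite_limits C" and "X \<in> Ob C" "Y \<in> Ob C"
  obtains P p q where "p \<in> hom C P X" "q \<in> hom C P Y"
    "\<And>T x y. x \<in> hom C T X \<Longrightarrow> y \<in> hom C T Y \<Longrightarrow> \<exists>u \<in> hom C T P. p \<cdot> u = x \<and> q \<cdot> u = y"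
    "\<And>T u v. u \<in> hom C T P \<Longrightarrow> v \<in> hom C T P \<Longrightarrow> p \<cdot> u = p \<cdot> v \<Longrightarrow> q \<cdot> u = q \<cdot> v \<Longrightarrow> u = v"
proof -
  obtain T where T: "is_terminal C T"
    using terminal_exists[OF lim] .
  have t: "\<exists>!u. u \<in> hom C A T" if "A \<in> Ob C" for A
    using T that by (simp add: is_terminal_def)
  obtain x y where xy: "x \<in> hom C X T" "y \<in> hom C Y T"
    using t[OF assms(2)] t[OF assms(3)] by blast
  obtain P p q where P: "p \<in> hom C P X" "q \<in> hom C P Y" "is_pullback C x y p q"
    using pullback_exists[OF lim xy] .
  have "x \<cdot> u = y \<cdot> v" if "u \<in> hom C A X" "v \<in> hom C A Y" for u v A
    using t[of A] that hom_Ob[OF that(1)] Comp_hom xy by metis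
  then show ?thesis
    using that[OF P(1,2)] pullback_ex[OF P(3,1,2)] pullback_unique[OF P(3,1)] by metis
qed

lemma equalizer_exists:
  assumes lim: "has_finite_limits C" and f: "f \<in> hom C X Y" and g: "g \<in> hom C X Y"
  obtains E m where "m \<in> hom C E X" "is_equalizer C f g m"
proof -
  let ?D = "\<lambda>v::nat. if v = 0 then X else Y"
  let ?M = "\<lambda>e::nat. if e = 0 then f else g"
  let ?cone = "is_cone C {0,1} {0,1} (\<lambda>e. 0) (\<lambda>e. 1) ?D ?M"
  have fd: "finite_diagram C {0,1} {0,1} (\<lambda>e. 0) (\<lambda>e. 1) ?D ?M"
    using f g hom_Ob[OF f] hom_Ob[OF g] by (auto simp: finite_diagram_def)
  obtain L p where L: "?cone L p"
    and univ: "\<And>L' p'. ?cone L' p' \<Longrightarrow> \<exists>!u. u \<in> hom C L' L \<and> (\<forall>v \<in> {0,1}. p v \<cdot> u = p' v)"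
    using lim[unfolded has_finite_limits_def, rule_format, OF fd] by blast
  have p: "p 0 \<in> hom C L X" "p 1 = f \<cdot> p 0" "f \<cdot> p 0 = g \<cdot> p 0"
    using L by (auto simp: is_cone_def)
  have "\<exists>!u. u \<in> hom C (Dom C h) L \<and> p 0 \<cdot> u = h"
    if h: "h \<in> Arr C" "Cod C h = X" "f \<cdot> h = g \<cdot> h" for h
  proof -
    have "?cone (Dom C h) (\<lambda>v. if v = 0 then h else f \<cdot> h)"
      using h f g by (auto simp: is_cone_def hom_def)
    from univ[OF this] have "\<exists>!u. u \<in> hom C (Dom C h) L \<and> p 0 \<cdot> u = h \<and> p 1 \<cdot> u = f \<cdot> h"
      by auto
    moreover have "p 1 \<cdot> u = f \<cdot> (p 0 \<cdot> u)" if "u \<in> hom C (Dom C h) L" for u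
      using p f g that p(3)[THEN comp_cancel] by (auto simp: hom_def)
    ultimately show ?thesis by metis
  qed
  then have "is_equalizer C f g (p 0)"
    unfolding is_equalizer_def using f g p by (auto simp: hom_def)
  then show ?thesis
    using that p by blast
qed

section \<open>Pullbacks and exponentials in slices\<close>

lemma slice_sel [simp]:
  "Ob (slice C D) = {f \<in> Arr C. Cod C f = D}"
  "Dom (slice C D) (f, g, h) = f" "Cod (slice C D) (f, g, h) = g"
  "Comp (slice C D) (g', k, v) (f, g, h) = (f, k, v \<cdot> h)"
  by (simp_all add: slice_def)

lemma slice_arr [simp]: "(f, g, h) \<in> Arr (slice C D) \<longleftrightarrow>
    f \<in> Arr C \<and> Cod C f = D \<and> g \<in> Arr C \<and> Cod C g = D \<and>
    h \<in> hom C (Dom C f) (Dom C g) \<and> g \<cdot> h = f"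
  by (simp add: slice_def)

lemma slice_hom: "w \<in> hom (slice C D) f g \<longleftrightarrow>
    (\<exists>h. w = (f, g, h) \<and> f \<in> Arr C \<and> Cod C f = D \<and> g \<in> Arr C \<and> Cod C g = D \<and>
    h \<in> hom C (Dom C f) (Dom C g) \<and> g \<cdot> h = f)"
  by (cases w) (auto simp: hom_def[of "slice C D"])

text \<open>An arrow of the slice carries its source and target, so the two projections must share
  the source \<open>a \<cdot> p\<close>; what remains is a universal commuting square over
  \<open>D\<close>.\<close>

lemma slice_product_pullback:
  assumes "is_product (slice C D) a c \<pi> \<pi>'"
  obtains p q where "\<pi> = (a \<cdot> p, a, p)" "\<pi>' = (a \<cdot> p, c, q)" "is_pullback C a c p q"
proof -
  obtain x p where \<pi>: "\<pi> = (x, a, p)"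
    using assms by (cases \<pi>) (auto simp: is_product_def)
  obtain q where \<pi>': "\<pi>' = (x, c, q)"
    using assms \<pi> by (cases \<pi>') (auto simp: is_product_def)
  note pr = assms[unfolded is_product_def \<pi> \<pi>', simplified]
  have 1: "a \<in> hom C (Dom C a) D" "c \<in> hom C (Dom C c) D" "p \<in> hom C (Dom C x) (Dom C a)"
    "q \<in> hom C (Dom C x) (Dom C c)" "a \<cdot> p = x" "c \<cdot> q = x" "x \<in> Arr C" "Cod C x = D"
    using pr by (auto simp: hom_def)
  have univ: "\<exists>!w. w \<in> hom (slice C D) (a \<cdot> s) x \<and>
      Comp (slice C D) (x, a, p) w = (a \<cdot> s, a, s) \<and> Comp (slice C D) (x, c, q) w = (a \<cdot> s, c, t)"
    if st: "s \<in> hom C T (Dom C a)" "t \<in> hom C T (Dom C c)" "a \<cdot> s = c \<cdot> t" for s t T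
  proof -
    have "(a \<cdot> s, a, s) \<in> Arr (slice C D)" "(a \<cdot> s, c, t) \<in> Arr (slice C D)"
      using st 1 by (auto simp: hom_def)
    then show ?thesis
      using assms[unfolded is_product_def \<pi> \<pi>', THEN conjunct2, THEN conjunct2, THEN conjunct2,
        THEN conjunct2, THEN conjunct2, rule_format, of "(a \<cdot> s, a, s)" "(a \<cdot> s, c, t)"]
      by simp
  qed
  have "is_pullback C a c p q"
  proof (rule pullbackI[OF 1(1-4)])
    fix T s t
    assume st: "s \<in> hom C T (Dom C a)" "t \<in> hom C T (Dom C c)" "a \<cdot> s = c \<cdot> t"
    obtain w where w: "w \<in> hom (slice C D) (a \<cdot> s) x"
      "Comp (slice C D) (x, a, p) w = (a \<cdot> s, a, s)" "Comp (slice C D) (x, c, q) w = (a \<cdot> s, c, t)"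
      using univ[OF st] by blast
    then obtain u where "w = (a \<cdot> s, x, u)" "u \<in> hom C (Dom C (a \<cdot> s)) (Dom C x)"
      unfolding slice_hom by blast
    then show "\<exists>u \<in> hom C T (Dom C x). p \<cdot> u = s \<and> q \<cdot> u = t"
      using w st 1 by (auto simp: hom_def)
  next
    fix T u v
    assume uv: "u \<in> hom C T (Dom C x)" "v \<in> hom C T (Dom C x)" "p \<cdot> u = p \<cdot> v" "q \<cdot> u = q \<cdot> v"
    have st: "p \<cdot> u \<in> hom C T (Dom C a)" "q \<cdot> u \<in> hom C T (Dom C c)"
      using uv 1 Comp_hom by blast+
    have e: "a \<cdot> (p \<cdot> w) = x \<cdot> w" "c \<cdot> (q \<cdot> w) = x \<cdot> w" if "w \<in> hom C T (Dom C x)" for w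
      using that 1 Comp_assoc by metis+
    have "(a \<cdot> (p \<cdot> u), x, w) \<in> hom (slice C D) (a \<cdot> (p \<cdot> u)) x"
      if "w \<in> hom C T (Dom C x)" "x \<cdot> w = x \<cdot> u" for w
      unfolding slice_hom using that st 1 uv(1) e[OF that(1)] e[OF uv(1)] by (simp add: hom_def)
    moreover have "x \<cdot> v = x \<cdot> u" "a \<cdot> (p \<cdot> u) = c \<cdot> (q \<cdot> u)"
      using uv e by metis+
    ultimately have "(a \<cdot> (p \<cdot> u), x, u) = (a \<cdot> (p \<cdot> u), x, v)"
      using uv by (intro ex1_unique[OF univ[OF st]]) simp_all
    then show "u = v" by simp
  qed (use 1 in auto)
  then show ?thesis
    using that 1 \<pi> \<pi>' by simp
qed

lemma pullback_slice_product:
  assumes "is_pullback C a c p q" "Cod C a = D"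
  shows "is_product (slice C D) a c (a \<cdot> p, a, p) (a \<cdot> p, c, q)"
proof -
  obtain X Y P where 1: "a \<in> hom C X D" "c \<in> hom C Y D" "p \<in> hom C P X" "q \<in> hom C P Y"
    "a \<cdot> p = c \<cdot> q"
    using pullbackE[OF assms(1)] assms(2) by (metis homD(3))
  note T = 1(1-4)[THEN hom_conj]
  have "\<exists>!w. w \<in> hom (slice C D) (Dom (slice C D) s) (a \<cdot> p) \<and>
      Comp (slice C D) (a \<cdot> p, a, p) w = s \<and> Comp (slice C D) (a \<cdot> p, c, q) w = t"
    if st: "s \<in> Arr (slice C D)" "t \<in> Arr (slice C D)" "Dom (slice C D) s = Dom (slice C D) t"
      "Cod (slice C D) s = a" "Cod (slice C D) t = c" for s t
  proof -
    obtain y s' t' where s: "s = (y, a, s')" and t: "t = (y, c, t')"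
      using st by (cases s; cases t) auto
    have 2: "s' \<in> hom C (Dom C y) X" "t' \<in> hom C (Dom C y) Y" "a \<cdot> s' = y" "c \<cdot> t' = y"
      "y \<in> Arr C" "Cod C y = D"
      using st T s t by auto
    obtain u where u: "u \<in> hom C (Dom C y) P" "p \<cdot> u = s'" "q \<cdot> u = t'"
      using pullback_ex[OF assms(1) 1(3,4) 2(1,2)] 2 by metis
    show ?thesis
    proof (rule ex1I[of _ "(y, a \<cdot> p, u)"])
      show "(y, a \<cdot> p, u) \<in> hom (slice C D) (Dom (slice C D) s) (a \<cdot> p) \<and>
        Comp (slice C D) (a \<cdot> p, a, p) (y, a \<cdot> p, u) = s \<and>
        Comp (slice C D) (a \<cdot> p, c, q) (y, a \<cdot> p, u) = t"
        unfolding slice_hom using s t u 2 T by (auto simp: hom_def)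
    next
      fix w
      assume w: "w \<in> hom (slice C D) (Dom (slice C D) s) (a \<cdot> p) \<and>
        Comp (slice C D) (a \<cdot> p, a, p) w = s \<and> Comp (slice C D) (a \<cdot> p, c, q) w = t"
      then obtain v where v: "w = (y, a \<cdot> p, v)" "v \<in> hom C (Dom C y) P"
        unfolding slice_hom using s T by auto
      then have "u = v"
        using w u s t pullback_unique[OF assms(1) 1(3) u(1), of v] by simp
      then show "w = (y, a \<cdot> p, u)"
        using v by simp
    qed
  qed
  then show ?thesis
    unfolding is_product_def using T 1(5) by (auto simp: hom_def[of C])
qed

text \<open>Since products in a slice are pullbacks, the exponential of \<open>b\<close> by
  \<open>c\<close> over \<open>D\<close> can be freed of slice triples: \<open>u\<close> is the
  transpose of \<open>h\<close>, and \<open>k\<close> is the product of \<open>u\<close> with the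
  identity of \<open>c\<close>. The clause ranges over all pullbacks of \<open>t\<close> along
  \<open>c\<close>, so that each use can supply the one at hand.\<close>

lemma slice_exponential:
  assumes lcc: "locally_cartesian_closed C" and c: "c \<in> hom C D' D" and b: "b \<in> hom C Z D"
  obtains e E p P q ev where "e \<in> hom C E D" "p \<in> hom C P E" "q \<in> hom C P D'" "ev \<in> hom C P Z"
    "is_pullback C e c p q" "b \<cdot> ev = e \<cdot> p"
    "\<forall>T t P' p' q' h. t \<in> hom C T D \<longrightarrow> is_pullback C t c p' q' \<longrightarrow> p' \<in> hom C P' T \<longrightarrow>
      h \<in> hom C P' Z \<longrightarrow> b \<cdot> h = t \<cdot> p' \<longrightarrow>
      (\<exists>!u. u \<in> hom C T E \<and> e \<cdot> u = t \<and> (\<exists>k \<in> hom C P' P. p \<cdot> k = u \<cdot> p' \<and> q \<cdot> k = q' \<and> ev \<cdot> k = h))"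
proof -
  have "cartesian_closed (slice C D)"
    using lcc hom_Ob[OF c] by (auto simp: locally_cartesian_closed_def)
  then obtain e \<pi> \<pi>' \<epsilon> where ex: "is_exponential (slice C D) c b e \<pi> \<pi>' \<epsilon>"
    using b c unfolding cartesian_closed_def hom_def slice_sel by blast
  then have pr: "is_product (slice C D) e c \<pi> \<pi>'"
    by (simp add: is_exponential_def)
  obtain p q where \<pi>: "\<pi> = (e \<cdot> p, e, p)" "\<pi>' = (e \<cdot> p, c, q)" and pb: "is_pullback C e c p q"
    using slice_product_pullback[OF pr] .
  obtain E P where 1: "e \<in> hom C E D" "p \<in> hom C P E" "q \<in> hom C P D'"
    using pullbackE[OF pb] c by (metis homD)
  note T = 1[THEN hom_conj] b[THEN hom_conj] c[THEN hom_conj]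
  have "\<epsilon> \<in> hom (slice C D) (e \<cdot> p) b"
    using ex \<pi> by (simp add: is_exponential_def)
  then obtain ev where \<epsilon>: "\<epsilon> = (e \<cdot> p, b, ev)" and ev: "ev \<in> hom C P Z" "b \<cdot> ev = e \<cdot> p"
    unfolding slice_hom using T by auto
  have "\<exists>!u. u \<in> hom C S E \<and> e \<cdot> u = t \<and> (\<exists>k \<in> hom C P' P. p \<cdot> k = u \<cdot> p' \<and> q \<cdot> k = q' \<and> ev \<cdot> k = h)"
    if t: "t \<in> hom C S D" and pb': "is_pullback C t c p' q'" and p': "p' \<in> hom C P' S"
      and h: "h \<in> hom C P' Z" "b \<cdot> h = t \<cdot> p'" for S t P' p' q' h
  proof -
    have "is_product (slice C D) t c (t \<cdot> p', t, p') (t \<cdot> p', c, q')"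
      using pullback_slice_product[OF pb'] t by (simp add: hom_def)
    moreover have "(t \<cdot> p', b, h) \<in> hom (slice C D) (Dom (slice C D) (t \<cdot> p', t, p')) b"
      unfolding slice_hom using t p' h T by (auto simp: hom_def)
    ultimately have ex1: "\<exists>!w. w \<in> hom (slice C D) t e \<and>
        (\<exists>k \<in> hom (slice C D) (t \<cdot> p') (e \<cdot> p).
          Comp (slice C D) (e \<cdot> p, e, p) k = Comp (slice C D) w (t \<cdot> p', t, p') \<and>
          Comp (slice C D) (e \<cdot> p, c, q) k = (t \<cdot> p', c, q') \<and>
          Comp (slice C D) (e \<cdot> p, b, ev) k = (t \<cdot> p', b, h))"
      using ex[unfolded is_exponential_def \<pi> \<epsilon>, THEN conjunct2, THEN conjunct2, rule_format,
        of t "(t \<cdot> p', t, p')" "(t \<cdot> p', c, q')" "(t \<cdot> p', b, h)"]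
      by simp
    have lift: "(t, e, u) \<in> hom (slice C D) t e \<and>
        (\<exists>k \<in> hom (slice C D) (t \<cdot> p') (e \<cdot> p).
          Comp (slice C D) (e \<cdot> p, e, p) k = Comp (slice C D) (t, e, u) (t \<cdot> p', t, p') \<and>
          Comp (slice C D) (e \<cdot> p, c, q) k = (t \<cdot> p', c, q') \<and>
          Comp (slice C D) (e \<cdot> p, b, ev) k = (t \<cdot> p', b, h))"
      if u: "u \<in> hom C S E" "e \<cdot> u = t" and k: "k \<in> hom C P' P" "p \<cdot> k = u \<cdot> p'" "q \<cdot> k = q'" "ev \<cdot> k = h"
      for u k
    proof -
      have "e \<cdot> (p \<cdot> k) = t \<cdot> p'"
        using u k(2) T p' comp_cancel[OF u(2)] by (auto simp: hom_def)
      then show ?thesis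
        using u k T t p' unfolding slice_hom
        by (intro conjI bexI[of _ "(t \<cdot> p', e \<cdot> p, k)"]) (auto simp: slice_hom hom_def[of C])
    qed
    from ex1 obtain w K where w: "w \<in> hom (slice C D) t e"
      and K: "K \<in> hom (slice C D) (t \<cdot> p') (e \<cdot> p)"
        "Comp (slice C D) (e \<cdot> p, e, p) K = Comp (slice C D) w (t \<cdot> p', t, p')"
        "Comp (slice C D) (e \<cdot> p, c, q) K = (t \<cdot> p', c, q')"
        "Comp (slice C D) (e \<cdot> p, b, ev) K = (t \<cdot> p', b, h)"
      by blast
    obtain u where u: "w = (t, e, u)" "u \<in> hom C S E" "e \<cdot> u = t"
      using w t T unfolding slice_hom by (auto simp: hom_def)
    obtain k where k: "K = (t \<cdot> p', e \<cdot> p, k)" "k \<in> hom C P' P"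
      using K t p' T unfolding slice_hom by (auto simp: hom_def)
    show ?thesis
    proof (rule ex1I[of _ u])
      show "u \<in> hom C S E \<and> e \<cdot> u = t \<and> (\<exists>k \<in> hom C P' P. p \<cdot> k = u \<cdot> p' \<and> q \<cdot> k = q' \<and> ev \<cdot> k = h)"
        using u k K by (auto intro!: bexI[of _ k])
    next
      fix v
      assume "v \<in> hom C S E \<and> e \<cdot> v = t \<and> (\<exists>k \<in> hom C P' P. p \<cdot> k = v \<cdot> p' \<and> q \<cdot> k = q' \<and> ev \<cdot> k = h)"
      then have "(t, e, v) = (t, e, u)"
        using lift ex1 u w K by metis
      then show "v = u" by simp
    qed
  qed
  then show ?thesis
    using that[OF 1 ev(1) pb ev(2)] by blast
qed

section \<open>Final pullback complements\<close>


lemma fpcE: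
  assumes "is_fpc C f m n g"
  obtains A B D F where "f \<in> hom C A B" "m \<in> hom C B D" "n \<in> hom C A F" "g \<in> hom C F D"
    "m \<cdot> f = g \<cdot> n" "is_pullback C m g f n"
proof -
  have pb: "is_pullback C m g f n"
    using assms by (simp add: is_fpc_def)
  then show ?thesis
    using that pullbackE[OF pb] by metis
qed

lemma fpc_ex:
  assumes "is_fpc C f m n g" "f \<in> hom C A B" "g \<in> hom C F D"
    "x \<in> hom C X A" "d \<in> hom C E D" "is_pullback C m d (f \<cdot> x) y"
  obtains w where "w \<in> hom C E F" "g \<cdot> w = d" "w \<cdot> y = n \<cdot> x"
proof -
  have "\<exists>!w. w \<in> hom C (Dom C d) (Dom C g) \<and> g \<cdot> w = d \<and> w \<cdot> y = n \<cdot> x"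
    using assms(1)[unfolded is_fpc_def, THEN conjunct2, rule_format, of x d y] assms
    by (simp add: hom_def)
  then show ?thesis
    using that assms by (auto simp: hom_def)
qed

lemma fpc_unique:
  assumes "is_fpc C f m n g" "f \<in> hom C A B" "g \<in> hom C F D"
    "x \<in> hom C X A" "is_pullback C m d (f \<cdot> x) y"
    "u \<in> hom C E F" "g \<cdot> u = d" "u \<cdot> y = n \<cdot> x"
    "v \<in> hom C E F" "g \<cdot> v = d" "v \<cdot> y = n \<cdot> x"
  shows "u = v"
proof -
  have "\<exists>!w. w \<in> hom C (Dom C d) (Dom C g) \<and> g \<cdot> w = d \<and> w \<cdot> y = n \<cdot> x"
    using assms(1)[unfolded is_fpc_def, THEN conjunct2, rule_format, of x d y] assms(2,4,5)
    by (simp add: hom_def)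
  moreover have "Dom C d = E" "Dom C g = F"
    using assms(3,6,7) by (auto simp: hom_def)
  ultimately show ?thesis
    using assms(6-) by metis
qed

lemma fpcI:
  assumes "f \<in> hom C A B" "m \<in> hom C B D" "g \<in> hom C F D" "is_pullback C m g f n"
    "\<And>X E x y d. x \<in> hom C X A \<Longrightarrow> y \<in> hom C X E \<Longrightarrow> d \<in> hom C E D \<Longrightarrow>
       is_pullback C m d (f \<cdot> x) y \<Longrightarrow> \<exists>w \<in> hom C E F. g \<cdot> w = d \<and> w \<cdot> y = n \<cdot> x"
    "\<And>X E x y d u v. x \<in> hom C X A \<Longrightarrow> y \<in> hom C X E \<Longrightarrow> d \<in> hom C E D \<Longrightarrow>
       is_pullback C m d (f \<cdot> x) y \<Longrightarrow> u \<in> hom C E F \<Longrightarrow> g \<cdot> u = d \<Longrightarrow> u \<cdot> y = n \<cdot> x \<Longrightarrow>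
       v \<in> hom C E F \<Longrightarrow> g \<cdot> v = d \<Longrightarrow> v \<cdot> y = n \<cdot> x \<Longrightarrow> u = v"
  shows "is_fpc C f m n g"
proof -
  have "\<exists>!w. w \<in> hom C (Dom C d) (Dom C g) \<and> g \<cdot> w = d \<and> w \<cdot> y = n \<cdot> x"
    if x: "x \<in> Arr C" "Cod C x = Dom C f" and pb: "is_pullback C m d (f \<cdot> x) y" for x y d
  proof -
    have 1: "x \<in> hom C (Dom C x) A" "f \<cdot> x \<in> hom C (Dom C x) B"
      using x assms(1) by (auto simp: hom_def)
    have 2: "d \<in> hom C (Dom C d) D" "y \<in> hom C (Dom C x) (Dom C d)"
      using pb 1(2) assms(2) by (auto simp: is_pullback_def hom_def)
    obtain w where w: "w \<in> hom C (Dom C d) F" "g \<cdot> w = d" "w \<cdot> y = n \<cdot> x"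
      using assms(5)[OF 1(1) 2(2,1) pb] by blast
    show ?thesis
      using w assms(6)[OF 1(1) 2(2,1) pb _ _ _ w] homD(2)[OF assms(3)] by metis
  qed
  then show ?thesis
    using assms(4) by (simp add: is_fpc_def)
qed

text \<open>Since \<open>m\<close> is subterminal in the slice over \<open>D\<close>, the dependent product of \<open>f\<close> along \<open>m\<close>
  is the exponential with exponent \<open>m\<close> and base \<open>m \<cdot> f\<close> in that slice.\<close>

lemma fpc_exists:
  assumes lcc: "locally_cartesian_closed C"
    and m: "monic C m" "m \<in> hom C B D" and f: "f \<in> hom C A B"
  obtains F n g where "n \<in> hom C A F" "g \<in> hom C F D" "is_fpc C f m n g"
proof -
  have mf: "m \<cdot> f \<in> hom C A D"
    using Comp_hom f m by blast
  obtain E P e p q ev where e: "e \<in> hom C E D" "p \<in> hom C P E" "q \<in> hom C P B" "ev \<in> hom C P A"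
    and pb: "is_pullback C e m p q" and ev: "m \<cdot> f \<cdot> ev = e \<cdot> p"
    and exp0: "\<forall>T t P' p' q' h. t \<in> hom C T D \<longrightarrow> is_pullback C t m p' q' \<longrightarrow> p' \<in> hom C P' T \<longrightarrow>
      h \<in> hom C P' A \<longrightarrow> m \<cdot> f \<cdot> h = t \<cdot> p' \<longrightarrow>
      (\<exists>!u. u \<in> hom C T E \<and> e \<cdot> u = t \<and> (\<exists>k \<in> hom C P' P. p \<cdot> k = u \<cdot> p' \<and> q \<cdot> k = q' \<and> ev \<cdot> k = h))"
    using slice_exponential[OF lcc m(2) mf] by blast
  note exp = exp0[rule_format]
  note T = e[THEN hom_conj] m(2)[THEN hom_conj]
    f[THEN hom_conj]
  have Ob: "A \<in> Ob C" "P \<in> Ob C"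
    using e hom_Ob by blast+
  have ep: "e \<cdot> p = m \<cdot> q"
    using pb by (simp add: is_pullback_def)
  then have fev: "f \<cdot> ev = q"
    using ev T apply - by (rule monicD[OF m, of _ P]) (auto simp: hom_def)
  \<comment> \<open>The identity of \<open>A\<close> is transposed here; its transpose
    \<open>u\<close> will be the leg of the complement that starts at \<open>A\<close>.\<close>
  have "is_pullback C (m \<cdot> f) m (Id C A) f"
    using pullback_sym[OF pullback_mono_self[OF m f]] .
  from exp[OF mf this Id_hom[OF Ob(1)] Id_hom[OF Ob(1)] refl]
  obtain u k where u: "u \<in> hom C A E" "e \<cdot> u = m \<cdot> f"
    and k: "k \<in> hom C A P" "p \<cdot> k = u" "q \<cdot> k = f" "ev \<cdot> k = Id C A"
    by (metis Comp_Id)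
  note T' = u(1)[THEN hom_conj] k(1)[THEN hom_conj]
  \<comment> \<open>Both \<open>p\<close> and \<open>u \<cdot> ev\<close> transpose
    \<open>ev\<close>, so they coincide. Hence \<open>k\<close> and \<open>ev\<close> are mutually
    inverse, and \<open>A\<close> itself is a pullback of \<open>e\<close> along
    \<open>m\<close>.\<close>
  have "is_pullback C (e \<cdot> p) m (Id C P) q"
    unfolding ep using pullback_sym[OF pullback_mono_self[OF m e(3)]] .
  then have "\<exists>!w. w \<in> hom C P E \<and> e \<cdot> w = e \<cdot> p \<and>
      (\<exists>k \<in> hom C P P. p \<cdot> k = w \<cdot> Id C P \<and> q \<cdot> k = q \<and> ev \<cdot> k = ev)"
    using Ob T ev by (intro exp) (auto simp: hom_def)
  then have uev: "p = u \<cdot> ev"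
  proof (rule ex1_unique)
    show "p \<in> hom C P E \<and> e \<cdot> p = e \<cdot> p \<and>
      (\<exists>k \<in> hom C P P. p \<cdot> k = p \<cdot> Id C P \<and> q \<cdot> k = q \<and> ev \<cdot> k = ev)"
      using Ob T by (intro conjI bexI[of _ "Id C P"]) (auto simp: hom_def)
    show "u \<cdot> ev \<in> hom C P E \<and> e \<cdot> (u \<cdot> ev) = e \<cdot> p \<and>
      (\<exists>k \<in> hom C P P. p \<cdot> k = u \<cdot> ev \<cdot> Id C P \<and> q \<cdot> k = q \<and> ev \<cdot> k = ev)"
      using Ob T T' ep u(2)[THEN comp_cancel] k(2-4)[THEN comp_cancel] fev
      by (intro conjI bexI[of _ "k \<cdot> ev"]) (auto simp: hom_def)
  qed
  have "p \<cdot> (k \<cdot> ev) = p \<cdot> Id C P"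
    using Ob T T' uev k(2)[THEN comp_cancel] by simp
  then have kev: "k \<cdot> ev = Id C P"
    using Ob T T' apply - by (rule monicD[OF pullback_monic[OF pb m(1)], of P E _ P]) (auto simp: hom_def)
  then have "iso_between C A P k"
    using k e unfolding iso_between_def by auto
  then have pb': "is_pullback C m e f u"
    using pullback_iso_apex[OF pb, of A k] pullback_sym k T by auto
  have "is_fpc C f m u e"
  proof (rule fpcI[OF f m(2) e(1) pb'])
    fix X E' x y d
    assume x: "x \<in> hom C X A" and y: "y \<in> hom C X E'" and d: "d \<in> hom C E' D"
      and pbd: "is_pullback C m d (f \<cdot> x) y"
    note S = x[THEN hom_conj] y[THEN hom_conj]
      d[THEN hom_conj]
    have "m \<cdot> f \<cdot> x = d \<cdot> y"
      using pbd T S by (simp add: is_pullback_def)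
    \<comment> \<open>In a test square \<open>x\<close> is an arrow into \<open>A\<close> over
      \<open>D\<close> whose source is the pullback of \<open>d\<close> along \<open>m\<close>. The
      required arrow is its transpose.\<close>
    note ex = exp[OF d pullback_sym[OF pbd] y x this]
    from ex obtain w k' where w: "w \<in> hom C E' E" "e \<cdot> w = d"
      and k': "k' \<in> hom C X P" "p \<cdot> k' = w \<cdot> y" "ev \<cdot> k' = x"
      by blast
    have "p \<cdot> k' = u \<cdot> x"
      using k' uev T T' by (auto simp: hom_def)
    then show "\<exists>w \<in> hom C E' E. e \<cdot> w = d \<and> w \<cdot> y = u \<cdot> x"
      using w k' by metis
    fix v v'
    assume v: "v \<in> hom C E' E" "e \<cdot> v = d" "v \<cdot> y = u \<cdot> x"
      and v': "v' \<in> hom C E' E" "e \<cdot> v' = d" "v' \<cdot> y = u \<cdot> x"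
    have "\<exists>k \<in> hom C X P. p \<cdot> k = u \<cdot> x \<and> q \<cdot> k = f \<cdot> x \<and> ev \<cdot> k = x"
      using T T' S k(2-4)[THEN comp_cancel] by (intro bexI[of _ "k \<cdot> x"]) (auto simp: hom_def)
    then show "v = v'"
      using v v' ex by metis
  qed
  then show ?thesis
    using that u e by blast
qed

text \<open>Arrows from the pulled-back cospan to \<open>Z\<close> correspond to arrows from the original cospan, over
  \<open>D\<close>, into the exponential of \<open>Z \<times> D\<close> with exponent \<open>c\<close>.\<close>

lemma pushout_stable:
  assumes lim: "has_finite_limits C" and lcc: "locally_cartesian_closed C"
    and po: "is_pushout C f g p q" and c: "c \<in> hom C D' D"
    and pbB: "is_pullback C p c b b'" and pbC: "is_pullback C q c r r'"
    and pbA: "is_pullback C (p \<cdot> f) c a a'"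
    and f': "f' \<in> hom C (Dom C a) (Dom C b)" "b \<cdot> f' = f \<cdot> a" "b' \<cdot> f' = a'"
    and g': "g' \<in> hom C (Dom C a) (Dom C r)" "r \<cdot> g' = g \<cdot> a" "r' \<cdot> g' = a'"
  shows "is_pushout C f' g' b' r'"
proof -
  obtain A B C0 where 1: "f \<in> hom C A B" "g \<in> hom C A C0" "p \<in> hom C B D" "q \<in> hom C C0 D"
    "p \<cdot> f = q \<cdot> g"
    using pushoutE[OF po] pullbackE[OF pbB] c by (metis homD(3))
  obtain B' where B': "b \<in> hom C B' B" "b' \<in> hom C B' D'" "p \<cdot> b = c \<cdot> b'"
    using pullbackE[OF pbB] 1 c by (metis homD(2))
  obtain C' where C': "r \<in> hom C C' C0" "r' \<in> hom C C' D'" "q \<cdot> r = c \<cdot> r'"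
    using pullbackE[OF pbC] 1 c by (metis homD(2))
  have pf: "p \<cdot> f \<in> hom C A D" using 1 Comp_hom by blast
  obtain A' where A': "a \<in> hom C A' A" "a' \<in> hom C A' D'" "p \<cdot> f \<cdot> a = c \<cdot> a'"
    using pullbackE[OF pbA] pf c by (metis homD(2))
  have fg: "f' \<in> hom C A' B'" "g' \<in> hom C A' C'"
    using f' g' A' B' C' by (auto simp: hom_def)
  note T = 1(1-4)[THEN hom_conj] c[THEN hom_conj]
    B'(1,2)[THEN hom_conj] C'(1,2)[THEN hom_conj]
    A'(1,2)[THEN hom_conj] fg[THEN hom_conj]
  have Ob: "D \<in> Ob C" "D' \<in> Ob C"
    using c hom_Ob by blast+
  have pbI: "is_pullback C (Id C D) c c (Id C D')"
    using pullback_mono_self[OF iso_monic[OF iso_between_id[OF Ob(1)]] _ c] Ob T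
    by (simp add: hom_def)
  show ?thesis
  proof (rule pushoutI[OF fg B'(2) C'(2)])
    show "b' \<cdot> f' = r' \<cdot> g'"
      using f' g' by simp
  next
    fix Z x y
    assume x: "x \<in> hom C B' Z" and y: "y \<in> hom C C' Z" and xy: "x \<cdot> f' = y \<cdot> g'"
    obtain W z d where W: "z \<in> hom C W Z" "d \<in> hom C W D"
      and pair: "\<And>T x y. x \<in> hom C T Z \<Longrightarrow> y \<in> hom C T D \<Longrightarrow> \<exists>u \<in> hom C T W. z \<cdot> u = x \<and> d \<cdot> u = y"
      and pair_eq: "\<And>T u v. u \<in> hom C T W \<Longrightarrow> v \<in> hom C T W \<Longrightarrow> z \<cdot> u = z \<cdot> v \<Longrightarrow> d \<cdot> u = d \<cdot> v \<Longrightarrow> u = v"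
      using product_exists[OF lim, of Z D] hom_Ob[OF x] Ob by metis
    obtain E P e \<pi> \<kappa> ev where e: "e \<in> hom C E D" "\<pi> \<in> hom C P E" "\<kappa> \<in> hom C P D'" "ev \<in> hom C P W"
      and pb: "is_pullback C e c \<pi> \<kappa>" and "d \<cdot> ev = e \<cdot> \<pi>"
      and exp0: "\<forall>T t P' p' q' h. t \<in> hom C T D \<longrightarrow> is_pullback C t c p' q' \<longrightarrow> p' \<in> hom C P' T \<longrightarrow>
        h \<in> hom C P' W \<longrightarrow> d \<cdot> h = t \<cdot> p' \<longrightarrow>
        (\<exists>!u. u \<in> hom C T E \<and> e \<cdot> u = t \<and> (\<exists>k \<in> hom C P' P. \<pi> \<cdot> k = u \<cdot> p' \<and> \<kappa> \<cdot> k = q' \<and> ev \<cdot> k = h))"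
      using slice_exponential[OF lcc c W(2)] by blast
    note exp = exp0[rule_format]
    note S = x[THEN hom_conj] y[THEN hom_conj]
      W[THEN hom_conj] e[THEN hom_conj]
    \<comment> \<open>Pairing with the arrow to \<open>D\<close> makes \<open>x\<close> and
      \<open>y\<close> into arrows over \<open>D\<close>, which the exponential can
      transpose.\<close>
    obtain hB where hB: "hB \<in> hom C B' W" "z \<cdot> hB = x" "d \<cdot> hB = p \<cdot> b"
      using pair[of x B' "p \<cdot> b"] x T by (auto simp: hom_def)
    obtain hC where hC: "hC \<in> hom C C' W" "z \<cdot> hC = y" "d \<cdot> hC = q \<cdot> r"
      using pair[of y C' "q \<cdot> r"] y T by (auto simp: hom_def)
    obtain uB kB where uB: "uB \<in> hom C B E" "e \<cdot> uB = p" "kB \<in> hom C B' P" "\<pi> \<cdot> kB = uB \<cdot> b"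
      "\<kappa> \<cdot> kB = b'" "ev \<cdot> kB = hB"
      using exp[OF 1(3) pbB B'(1) hB(1,3)] by blast
    obtain uC kC where uC: "uC \<in> hom C C0 E" "e \<cdot> uC = q" "kC \<in> hom C C' P" "\<pi> \<cdot> kC = uC \<cdot> r"
      "\<kappa> \<cdot> kC = r'" "ev \<cdot> kC = hC"
      using exp[OF 1(4) pbC C'(1) hC(1,3)] by blast
    note U = uB(1,3)[THEN hom_conj] uC(1,3)[THEN hom_conj]
      hB(1)[THEN hom_conj] hC(1)[THEN hom_conj]
    have hBC: "hB \<cdot> f' = hC \<cdot> g'"
    proof (rule pair_eq[of _ A'])
      show "z \<cdot> (hB \<cdot> f') = z \<cdot> (hC \<cdot> g')"
        using T S U hB(2)[THEN comp_cancel] hC(2)[THEN comp_cancel] xy by simp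
      have "d \<cdot> (hB \<cdot> f') = p \<cdot> (f \<cdot> a)"
        using T S U hB(3)[THEN comp_cancel] f' by simp
      moreover have "d \<cdot> (hC \<cdot> g') = q \<cdot> (g \<cdot> a)"
        using T S U hC(3)[THEN comp_cancel] g' by simp
      ultimately show "d \<cdot> (hB \<cdot> f') = d \<cdot> (hC \<cdot> g')"
        using T 1(5)[THEN comp_cancel] by simp
    qed (use T U in \<open>auto simp: hom_def\<close>)
    have ex1: "\<exists>!u. u \<in> hom C A E \<and> e \<cdot> u = p \<cdot> f \<and>
        (\<exists>k \<in> hom C A' P. \<pi> \<cdot> k = u \<cdot> a \<and> \<kappa> \<cdot> k = a' \<and> ev \<cdot> k = hB \<cdot> f')"
      using T S U hB(3)[THEN comp_cancel] f'
      by (intro exp[OF pf pbA A'(1)]) (auto simp: hom_def)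
    \<comment> \<open>Both composites transpose \<open>hB \<cdot> f'\<close>, which
      \<open>hBC\<close> identifies with \<open>hC \<cdot> g'\<close>.\<close>
    have "uB \<cdot> f = uC \<cdot> g"
    proof (rule ex1_unique[OF ex1]; intro conjI)
      show "\<exists>k \<in> hom C A' P. \<pi> \<cdot> k = uB \<cdot> f \<cdot> a \<and> \<kappa> \<cdot> k = a' \<and> ev \<cdot> k = hB \<cdot> f'"
        using T S U uB(4-6)[THEN comp_cancel] f' by (intro bexI[of _ "kB \<cdot> f'"]) (auto simp: hom_def)
      show "\<exists>k \<in> hom C A' P. \<pi> \<cdot> k = uC \<cdot> g \<cdot> a \<and> \<kappa> \<cdot> k = a' \<and> ev \<cdot> k = hB \<cdot> f'"
        unfolding hBC
        using T S U uC(4-6)[THEN comp_cancel] g' by (intro bexI[of _ "kC \<cdot> g'"]) (auto simp: hom_def)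
    qed (use T S U uB(2)[THEN comp_cancel] uC(2)[THEN comp_cancel] 1(5) in \<open>auto simp: hom_def\<close>)
    then obtain v where v: "v \<in> hom C D E" "v \<cdot> p = uB" "v \<cdot> q = uC"
      using pushout_ex[OF po 1(3,4) uB(1) uC(1)] by blast
    \<comment> \<open>\<open>v\<close> is a section of \<open>e\<close>, so
      \<open>v \<cdot> c\<close> and the identity of \<open>D'\<close> induce an arrow
      \<open>k\<close> into the source of the evaluation; evaluating there and projecting to
      \<open>Z\<close> gives the mediating arrow \<open>z \<cdot> (ev \<cdot> k)\<close>.\<close>
    have "e \<cdot> v = Id C D"
      using v S T uB(2) uC(2) Ob
      apply - by (rule pushout_unique[OF po 1(3), of _ D]) (auto simp: hom_def)
    then have "e \<cdot> (v \<cdot> c) = c \<cdot> Id C D'"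
      using v S T Ob comp_cancel by (auto simp: hom_def)
    then obtain k where k: "k \<in> hom C D' P" "\<pi> \<cdot> k = v \<cdot> c" "\<kappa> \<cdot> k = Id C D'"
      using pullback_ex[OF pb e(2,3), of "v \<cdot> c" D' "Id C D'"] v T Ob by (auto simp: hom_def)
    note V = v(1)[THEN hom_conj] k(1)[THEN hom_conj]
    have "k \<cdot> b' = kB"
      using T S U V k(2,3)[THEN comp_cancel] B'(3)[symmetric] v(2)[THEN comp_cancel] uB(4,5)
      apply - by (rule pullback_unique[OF pb e(2), of _ B']) (auto simp: hom_def)
    moreover have "k \<cdot> r' = kC"
      using T S U V k(2,3)[THEN comp_cancel] C'(3)[symmetric] v(3)[THEN comp_cancel] uC(4,5)
      apply - by (rule pullback_unique[OF pb e(2), of _ C']) (auto simp: hom_def)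
    ultimately show "\<exists>w \<in> hom C D' Z. w \<cdot> b' = x \<and> w \<cdot> r' = y"
      using T S U V uB(6) uC(6) hB(2) hC(2)
      by (intro bexI[of _ "z \<cdot> (ev \<cdot> k)"]) (auto simp: hom_def)
  next
    fix Z w1 w2
    assume w: "w1 \<in> hom C D' Z" "w2 \<in> hom C D' Z" "w1 \<cdot> b' = w2 \<cdot> b'" "w1 \<cdot> r' = w2 \<cdot> r'"
    obtain W z d where W: "z \<in> hom C W Z" "d \<in> hom C W D"
      and pair: "\<And>T x y. x \<in> hom C T Z \<Longrightarrow> y \<in> hom C T D \<Longrightarrow> \<exists>u \<in> hom C T W. z \<cdot> u = x \<and> d \<cdot> u = y"
      and pair_eq: "\<And>T u v. u \<in> hom C T W \<Longrightarrow> v \<in> hom C T W \<Longrightarrow> z \<cdot> u = z \<cdot> v \<Longrightarrow> d \<cdot> u = d \<cdot> v \<Longrightarrow> u = v"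
      using product_exists[OF lim, of Z D] hom_Ob[OF w(1)] Ob by metis
    obtain E P e \<pi> \<kappa> ev where e: "e \<in> hom C E D" "\<pi> \<in> hom C P E" "\<kappa> \<in> hom C P D'" "ev \<in> hom C P W"
      and pb: "is_pullback C e c \<pi> \<kappa>" and "d \<cdot> ev = e \<cdot> \<pi>"
      and exp0: "\<forall>T t P' p' q' h. t \<in> hom C T D \<longrightarrow> is_pullback C t c p' q' \<longrightarrow> p' \<in> hom C P' T \<longrightarrow>
        h \<in> hom C P' W \<longrightarrow> d \<cdot> h = t \<cdot> p' \<longrightarrow>
        (\<exists>!u. u \<in> hom C T E \<and> e \<cdot> u = t \<and> (\<exists>k \<in> hom C P' P. \<pi> \<cdot> k = u \<cdot> p' \<and> \<kappa> \<cdot> k = q' \<and> ev \<cdot> k = h))"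
      using slice_exponential[OF lcc c W(2)] by blast
    note exp = exp0[rule_format]
    note S = w(1,2)[THEN hom_conj] W[THEN hom_conj]
      e[THEN hom_conj]
    \<comment> \<open>Transposition turns an arrow from \<open>D'\<close> to \<open>Z\<close> into a
      section of \<open>e\<close>. If \<open>w1\<close> and \<open>w2\<close> agree on
      \<open>B'\<close> and \<open>C'\<close>, the sections \<open>v1\<close> and \<open>v2\<close>
      agree on \<open>B\<close> and \<open>C0\<close>, hence are equal by the pushout
      \<open>po\<close>, and \<open>w1\<close> and \<open>w2\<close> are recovered from
      them.\<close>
    have lift: "\<exists>h v k. h \<in> hom C D' W \<and> z \<cdot> h = w \<and> d \<cdot> h = c \<and> v \<in> hom C D E \<and> e \<cdot> v = Id C D \<and>
        k \<in> hom C D' P \<and> \<pi> \<cdot> k = v \<cdot> c \<and> \<kappa> \<cdot> k = Id C D' \<and> ev \<cdot> k = h" if w': "w \<in> hom C D' Z" for w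
    proof -
      obtain h where h: "h \<in> hom C D' W" "z \<cdot> h = w" "d \<cdot> h = c"
        using pair[OF w' c] by blast
      then have "d \<cdot> h = Id C D \<cdot> c" using T Ob by simp
      then show ?thesis
        using exp[OF Id_hom[OF Ob(1)] pbI c h(1)] h by blast
    qed
    obtain h1 v1 k1 where v1: "h1 \<in> hom C D' W" "z \<cdot> h1 = w1" "d \<cdot> h1 = c" "v1 \<in> hom C D E"
      "e \<cdot> v1 = Id C D" "k1 \<in> hom C D' P" "\<pi> \<cdot> k1 = v1 \<cdot> c" "\<kappa> \<cdot> k1 = Id C D'" "ev \<cdot> k1 = h1"
      using lift[OF w(1)] by blast
    obtain h2 v2 k2 where v2: "h2 \<in> hom C D' W" "z \<cdot> h2 = w2" "d \<cdot> h2 = c" "v2 \<in> hom C D E"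
      "e \<cdot> v2 = Id C D" "k2 \<in> hom C D' P" "\<pi> \<cdot> k2 = v2 \<cdot> c" "\<kappa> \<cdot> k2 = Id C D'" "ev \<cdot> k2 = h2"
      using lift[OF w(2)] by blast
    note U = v1(1,4,6)[THEN hom_conj] v2(1,4,6)[THEN hom_conj]
    have eq: "v1 \<cdot> p = v2 \<cdot> p" if p: "p \<in> hom C B D" and pbB: "is_pullback C p c b b'"
      and b: "b \<in> hom C B' B" "b' \<in> hom C B' D'" "c \<cdot> b' = p \<cdot> b" "w1 \<cdot> b' = w2 \<cdot> b'" for p b b' B B'
    proof -
      note R = p[THEN hom_conj] b(1,2)[THEN hom_conj]
      have h: "h1 \<cdot> b' = h2 \<cdot> b'"
        using T S U R v1(2,3)[THEN comp_cancel] v2(2,3)[THEN comp_cancel] b(3,4)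
        apply - by (rule pair_eq[of _ B']) (auto simp: hom_def)
      have "d \<cdot> (h1 \<cdot> b') = p \<cdot> b"
        using T S U R v1(3)[THEN comp_cancel] b(3) by (auto simp: hom_def)
      then have "\<exists>!u. u \<in> hom C B E \<and> e \<cdot> u = p \<and>
          (\<exists>k \<in> hom C B' P. \<pi> \<cdot> k = u \<cdot> b \<and> \<kappa> \<cdot> k = b' \<and> ev \<cdot> k = h1 \<cdot> b')"
        using T S U R by (intro exp[OF p pbB b(1)]) (auto simp: hom_def)
      then show ?thesis
      proof (rule ex1_unique; intro conjI)
        show "\<exists>k \<in> hom C B' P. \<pi> \<cdot> k = v1 \<cdot> p \<cdot> b \<and> \<kappa> \<cdot> k = b' \<and> ev \<cdot> k = h1 \<cdot> b'"
          using T S U R v1(7-9)[THEN comp_cancel] b(3)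
          by (intro bexI[of _ "k1 \<cdot> b'"]) (auto simp: hom_def)
        show "\<exists>k \<in> hom C B' P. \<pi> \<cdot> k = v2 \<cdot> p \<cdot> b \<and> \<kappa> \<cdot> k = b' \<and> ev \<cdot> k = h1 \<cdot> b'"
          unfolding h using T S U R v2(7-9)[THEN comp_cancel] b(3)
          by (intro bexI[of _ "k2 \<cdot> b'"]) (auto simp: hom_def)
      qed (use T S U R v1(5)[THEN comp_cancel] v2(5)[THEN comp_cancel] in \<open>auto simp: hom_def\<close>)
    qed
    have "v1 = v2"
      using pushout_unique[OF po 1(3) v1(4) v2(4)] eq[OF 1(3) pbB B'(1,2) B'(3)[symmetric] w(3)]
        eq[OF 1(4) pbC C'(1,2) C'(3)[symmetric] w(4)] by blast
    then have "k1 = k2"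
      using pullback_unique[OF pb e(2) v1(6) v2(6)] v1 v2 by metis
    then show "w1 = w2"
      using v1 v2 by metis
  qed
qed


section \<open>Pasting, restricting and pulling back final pullback complements\<close>

text \<open>A test square over \<open>m' \<cdot> m\<close> is cut along \<open>m'\<close>: the
  pullback \<open>t\<close> of \<open>d\<close> along \<open>m'\<close> is tested against the inner
  complement, and the arrow \<open>w1\<close> this induces makes the remaining square a test for the
  outer one.\<close>

lemma fpc_vertical:
  assumes lim: "has_finite_limits C" and l: "is_fpc C f m n g" and r: "is_fpc C g m' n' g'"
  shows "is_fpc C f (m' \<cdot> m) (n' \<cdot> n) g'"
proof -
  obtain A B D F where 1: "f \<in> hom C A B" "m \<in> hom C B D" "n \<in> hom C A F" "g \<in> hom C F D"
    "m \<cdot> f = g \<cdot> n" and pbl: "is_pullback C m g f n"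
    using fpcE[OF l] by metis
  obtain F' D' where 2: "m' \<in> hom C D D'" "n' \<in> hom C F F'" "g' \<in> hom C F' D'"
    "m' \<cdot> g = g' \<cdot> n'" and pbr: "is_pullback C m' g' g n'"
    using fpcE[OF r] 1 by (metis homD(2,3))
  note T = 1(1-4)[THEN hom_conj] 2(1-3)[THEN hom_conj]
  have mm: "m' \<cdot> m \<in> hom C B D'" using T by (simp add: hom_def)
  show ?thesis
  proof (rule fpcI[OF 1(1) mm 2(3) pullback_paste[OF pbr pbl]])
    fix X E x y d
    assume x: "x \<in> hom C X A" and y: "y \<in> hom C X E" and d: "d \<in> hom C E D'"
      and pbd: "is_pullback C (m' \<cdot> m) d (f \<cdot> x) y"
    obtain S t s where ts: "t \<in> hom C S D" "s \<in> hom C S E" and pb: "is_pullback C m' d t s"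
      using pullback_exists[OF lim 2(1) d] .
    note U = x[THEN hom_conj] y[THEN hom_conj]
      d[THEN hom_conj] ts[THEN hom_conj]
    have "m' \<cdot> m \<cdot> (f \<cdot> x) = d \<cdot> y"
      using pbd by (simp add: is_pullback_def)
    then have "m' \<cdot> (m \<cdot> (f \<cdot> x)) = d \<cdot> y"
      using T U by simp
    then obtain y' where y': "y' \<in> hom C X S" "t \<cdot> y' = m \<cdot> (f \<cdot> x)" "s \<cdot> y' = y"
      using pullback_ex[OF pb ts, of "m \<cdot> (f \<cdot> x)" X y] T U by (auto simp: hom_def)
    have pbt: "is_pullback C m t (f \<cdot> x) y'"
      using T U y' by (intro pullback_unpaste[OF pb pbd 1(2) 2(1)]) (auto simp: hom_def)
    obtain w1 where w1: "w1 \<in> hom C S F" "g \<cdot> w1 = t" "w1 \<cdot> y' = n \<cdot> x"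
      using fpc_ex[OF l 1(1,4) x ts(1) pbt] .
    note V = y'(1)[THEN hom_conj] w1(1)[THEN hom_conj]
    have pbw: "is_pullback C m' d (g \<cdot> w1) s"
      using pb w1(2) by simp
    obtain w where w: "w \<in> hom C E F'" "g' \<cdot> w = d" "w \<cdot> s = n' \<cdot> w1"
      using fpc_ex[OF r 1(4) 2(3) w1(1) d pbw] .
    have "w \<cdot> y = n' \<cdot> n \<cdot> x"
      using w T U V y'(3) w1(3) w(3)[THEN comp_cancel, of y'] by (auto simp: hom_def)
    then show "\<exists>w \<in> hom C E F'. g' \<cdot> w = d \<and> w \<cdot> y = n' \<cdot> n \<cdot> x"
      using w by blast
    \<comment> \<open>Any solution, restricted along \<open>s\<close>, factors through the inner
      complement and solves its finality problem, so the restriction must come from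
      \<open>w1\<close>.\<close>
    have uniq: "v \<cdot> s = n' \<cdot> w1"
      if v: "v \<in> hom C E F'" "g' \<cdot> v = d" "v \<cdot> y = n' \<cdot> n \<cdot> x" for v
    proof -
      note W = v(1)[THEN hom_conj]
      have "m' \<cdot> t = g' \<cdot> (v \<cdot> s)"
        using T U W v(2)[THEN comp_cancel] pb by (simp add: is_pullback_def)
      then obtain w2 where w2: "w2 \<in> hom C S F" "g \<cdot> w2 = t" "n' \<cdot> w2 = v \<cdot> s"
        using pullback_ex[OF pbr 1(4) 2(2), of t S "v \<cdot> s"] T U W by (auto simp: hom_def)
      note Z = w2(1)[THEN hom_conj]
      have "g \<cdot> (w2 \<cdot> y') = g \<cdot> (n \<cdot> x)"
        using T U V Z w2(2)[THEN comp_cancel] y'(2) 1(5)[THEN comp_cancel] by simp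
      moreover have "n' \<cdot> (w2 \<cdot> y') = n' \<cdot> (n \<cdot> x)"
        using T U V W Z w2(3)[THEN comp_cancel] y'(3) v(3) by simp
      ultimately have "w2 \<cdot> y' = n \<cdot> x"
        using T U V Z apply - by (rule pullback_unique[OF pbr 1(4), of _ X]) (auto simp: hom_def)
      then have "w2 = w1"
        using fpc_unique[OF l 1(1,4) x pbt] w1 w2 by blast
      then show ?thesis using w2 by simp
    qed
    fix u v
    assume u: "u \<in> hom C E F'" "g' \<cdot> u = d" "u \<cdot> y = n' \<cdot> n \<cdot> x"
      and v: "v \<in> hom C E F'" "g' \<cdot> v = d" "v \<cdot> y = n' \<cdot> n \<cdot> x"
    show "u = v"
      using fpc_unique[OF r 1(4) 2(3) w1(1) pbw u(1,2) uniq[OF u] v(1,2) uniq[OF v]] .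
  qed
qed

text \<open>Composing with the monic \<open>m'\<close> turns a test square over \<open>m\<close>
  into one over \<open>m' \<cdot> m\<close>, and the arrow induced there lifts to the pullback of
  \<open>g\<close>. In \<open>synthesis\<close> this restricts the complement in \<open>X0\<close>
  to the image of \<open>I\<^sub>2\<^sub>1\<close>.\<close>

lemma fpc_restrict:
  assumes o: "is_fpc C f (m' \<cdot> m) n g" and m': "monic C m'" "m' \<in> hom C D D'" and m: "m \<in> hom C B D"
    and pb: "is_pullback C m' g a b"
    and n0: "n0 \<in> hom C (Dom C f) (Dom C a)" "a \<cdot> n0 = m \<cdot> f" "b \<cdot> n0 = n"
  shows "is_fpc C f m n0 a"
proof -
  have mm: "m' \<cdot> m \<in> hom C B D'" using m m' by (auto simp: hom_def)
  obtain A F where 1: "f \<in> hom C A B" "n \<in> hom C A F" "g \<in> hom C F D'"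
    "(m' \<cdot> m) \<cdot> f = g \<cdot> n" and pbo: "is_pullback C (m' \<cdot> m) g f n"
    using fpcE[OF o] mm by (metis homD(2,3))
  obtain P where 2: "a \<in> hom C P D" "b \<in> hom C P F" "m' \<cdot> a = g \<cdot> b"
    using pullback_hom[OF pb m'(2) 1(3)] by metis
  have n0': "n0 \<in> hom C A P" using n0 1 2 by (simp add: hom_def)
  note T = 1(1-3)[THEN hom_conj] 2(1,2)[THEN hom_conj]
    m[THEN hom_conj] m'(2)[THEN hom_conj]
    n0'[THEN hom_conj]
  have pb0: "is_pullback C m a f n0"
    using n0 1 T by (intro pullback_unpaste[OF pb pbo m m'(2)]) auto
  show ?thesis
  proof (rule fpcI[OF 1(1) m 2(1) pb0])
    fix X E x y d
    assume x: "x \<in> hom C X A" and y: "y \<in> hom C X E" and d: "d \<in> hom C E D"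
      and pbd: "is_pullback C m d (f \<cdot> x) y"
    note U = x[THEN hom_conj] y[THEN hom_conj]
      d[THEN hom_conj]
    have pbd': "is_pullback C (m' \<cdot> m) (m' \<cdot> d) (f \<cdot> x) y"
      using pbd pullback_mono_comp[OF m' m d] by simp
    have md: "m' \<cdot> d \<in> hom C E D'" using T U by (simp add: hom_def)
    have dy: "d \<cdot> y = m \<cdot> (f \<cdot> x)"
      using pbd by (simp add: is_pullback_def)
    obtain w where w: "w \<in> hom C E F" "g \<cdot> w = m' \<cdot> d" "w \<cdot> y = n \<cdot> x"
      using fpc_ex[OF o 1(1,3) x md pbd'] .
    obtain u where u: "u \<in> hom C E P" "a \<cdot> u = d" "b \<cdot> u = w"
      using pullback_ex[OF pb 2(1,2) d w(1) w(2)[symmetric]] .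
    note V = w(1)[THEN hom_conj] u(1)[THEN hom_conj]
    have "u \<cdot> y = n0 \<cdot> x"
      using T U V u(2,3)[THEN comp_cancel] dy w(3) n0(2,3)[THEN comp_cancel]
      apply - by (rule pullback_unique[OF pb 2(1), of _ X]) (auto simp: hom_def)
    then show "\<exists>w \<in> hom C E P. a \<cdot> w = d \<and> w \<cdot> y = n0 \<cdot> x"
      using u by blast
    fix u v
    assume u: "u \<in> hom C E P" "a \<cdot> u = d" "u \<cdot> y = n0 \<cdot> x"
      and v: "v \<in> hom C E P" "a \<cdot> v = d" "v \<cdot> y = n0 \<cdot> x"
    have "b \<cdot> v \<in> hom C E F \<and> g \<cdot> (b \<cdot> v) = m' \<cdot> d \<and> b \<cdot> v \<cdot> y = n \<cdot> x"
      if v: "v \<in> hom C E P" "a \<cdot> v = d" "v \<cdot> y = n0 \<cdot> x" for v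
      using T U v 2(3)[symmetric, THEN comp_cancel] n0(3)[THEN comp_cancel] by (auto simp: hom_def)
    then have "b \<cdot> u = b \<cdot> v"
      using fpc_unique[OF o 1(1,3) x pbd'] u v by blast
    then show "u = v"
      using pullback_unique[OF pb 2(1) u(1) v(1)] u v by simp
  qed
qed

lemma fpc_iso:
  assumes a: "is_fpc C f m n g" and b: "is_fpc C f m n' g'"
  obtains \<phi> where "iso_between C (Dom C g) (Dom C g') \<phi>" "\<phi> \<cdot> n = n'" "g' \<cdot> \<phi> = g"
proof -
  obtain A B D F where 1: "f \<in> hom C A B" "m \<in> hom C B D" "n \<in> hom C A F" "g \<in> hom C F D"
    and pba: "is_pullback C m g f n"
    using fpcE[OF a] by metis
  obtain F' where 2: "n' \<in> hom C A F'" "g' \<in> hom C F' D" and pbb: "is_pullback C m g' f n'"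
    using fpcE[OF b] 1 by (metis homD(2,3))
  note T = 1(1-4)[THEN hom_conj] 2(1,2)[THEN hom_conj]
  have Ob: "A \<in> Ob C" "F \<in> Ob C" "F' \<in> Ob C" using T Dom_Ob Cod_Ob by metis+
  note I = Id_hom[OF Ob(1)]
  have pba': "is_pullback C m g (f \<cdot> Id C A) n" and pbb': "is_pullback C m g' (f \<cdot> Id C A) n'"
    using pba pbb T by simp_all
  obtain u where u: "u \<in> hom C F F'" "g' \<cdot> u = g" "u \<cdot> n = n'"
    using fpc_ex[OF b 1(1) 2(2) I 1(4) pba'] T by auto
  obtain v where v: "v \<in> hom C F' F" "g \<cdot> v = g'" "v \<cdot> n' = n"
    using fpc_ex[OF a 1(1,4) I 2(2) pbb'] T by auto
  have "v \<cdot> u = Id C F"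
    using T Ob u v u(2,3)[THEN comp_cancel] v(2,3)[THEN comp_cancel]
    apply - by (rule fpc_unique[OF a 1(1,4) I pba']) (auto simp: hom_def)
  moreover have "u \<cdot> v = Id C F'"
    using T Ob u v u(2,3)[THEN comp_cancel] v(2,3)[THEN comp_cancel]
    apply - by (rule fpc_unique[OF b 1(1) 2(2) I pbb']) (auto simp: hom_def)
  ultimately have "iso_between C F F' u"
    using u v by (auto simp: iso_between_def)
  then show ?thesis using that u T by metis
qed

lemma fpc_iso_apex:
  assumes a: "is_fpc C f m n g" and \<phi>: "iso_between C (Dom C g) F' \<phi>" "g' \<in> hom C F' (Cod C g)" "g' \<cdot> \<phi> = g"
  shows "is_fpc C f m (\<phi> \<cdot> n) g'"
proof -
  obtain A B D F where 1: "f \<in> hom C A B" "m \<in> hom C B D" "n \<in> hom C A F" "g \<in> hom C F D"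
    and pba: "is_pullback C m g f n"
    using fpcE[OF a] by metis
  obtain \<psi> where 2: "\<phi> \<in> hom C F F'" "\<psi> \<in> hom C F' F" "\<psi> \<cdot> \<phi> = Id C F" "\<phi> \<cdot> \<psi> = Id C F'"
    "iso_between C F' F \<psi>"
    using iso_betweenE[OF \<phi>(1)] 1(4) by (metis homD(2))
  have g': "g' \<in> hom C F' D" using \<phi> 1 by (simp add: hom_def)
  note T = 1(1-4)[THEN hom_conj] 2(1,2)[THEN hom_conj]
    g'[THEN hom_conj]
  have Ob: "F \<in> Ob C" "F' \<in> Ob C" "A \<in> Ob C" using T Dom_Ob Cod_Ob by metis+
  have g\<psi>: "g \<cdot> \<psi> = g'"
    using T Ob \<phi>(3)[symmetric] 2(4) by simp
  have "is_pullback C \<psi> n (\<phi> \<cdot> n) (Id C A)"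
    using pullback_mono_self[OF iso_monic[OF 2(5)] 2(2), of "\<phi> \<cdot> n" A] T Ob 2(3)[THEN comp_cancel]
    by (simp add: hom_def)
  from pullback_paste[OF pullback_sym[OF pba] this]
  have pb: "is_pullback C m g' f (\<phi> \<cdot> n)"
    using pullback_sym g\<psi> T Ob by simp
  show ?thesis
  proof (rule fpcI[OF 1(1,2) g' pb])
    fix X E x y d
    assume x: "x \<in> hom C X A" and y: "y \<in> hom C X E" and d: "d \<in> hom C E D"
      and pbd: "is_pullback C m d (f \<cdot> x) y"
    note U = x[THEN hom_conj] y[THEN hom_conj]
      d[THEN hom_conj]
    obtain w where w: "w \<in> hom C E F" "g \<cdot> w = d" "w \<cdot> y = n \<cdot> x"
      using fpc_ex[OF a 1(1,4) x d pbd] .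
    then show "\<exists>w \<in> hom C E F'. g' \<cdot> w = d \<and> w \<cdot> y = \<phi> \<cdot> n \<cdot> x"
      using T U \<phi>(3)[THEN comp_cancel] by (intro bexI[of _ "\<phi> \<cdot> w"]) (auto simp: hom_def)
    fix u v
    assume u: "u \<in> hom C E F'" "g' \<cdot> u = d" "u \<cdot> y = \<phi> \<cdot> n \<cdot> x"
      and v: "v \<in> hom C E F'" "g' \<cdot> v = d" "v \<cdot> y = \<phi> \<cdot> n \<cdot> x"
    have "\<psi> \<cdot> v \<in> hom C E F \<and> g \<cdot> (\<psi> \<cdot> v) = d \<and> \<psi> \<cdot> v \<cdot> y = n \<cdot> x"
      if v: "v \<in> hom C E F'" "g' \<cdot> v = d" "v \<cdot> y = \<phi> \<cdot> n \<cdot> x" for v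
      using T U Ob v g\<psi>[THEN comp_cancel] 2(3)[THEN comp_cancel] by (auto simp: hom_def)
    then have "\<psi> \<cdot> u = \<psi> \<cdot> v"
      using fpc_unique[OF a 1(1,4) x pbd] u v by blast
    then show "u = v"
      using monicD[OF iso_monic[OF 2(5)] 2(2) u(1) v(1)] by simp
  qed
qed

lemma fpc_iso_cod:
  assumes a: "is_fpc C f m n g" and x: "iso_between C (Cod C m) D' x"
  shows "is_fpc C f (x \<cdot> m) n (x \<cdot> g)"
proof -
  obtain A B D F where 1: "f \<in> hom C A B" "m \<in> hom C B D" "n \<in> hom C A F" "g \<in> hom C F D"
    and pba: "is_pullback C m g f n"
    using fpcE[OF a] by metis
  obtain \<psi> where 2: "x \<in> hom C D D'" "\<psi> \<in> hom C D' D" "\<psi> \<cdot> x = Id C D" "x \<cdot> \<psi> = Id C D'"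
    using iso_betweenE[OF x] 1(2) by (metis homD(3))
  note T = 1(1-4)[THEN hom_conj] 2(1,2)[THEN hom_conj]
  have Ob: "D \<in> Ob C" "D' \<in> Ob C" using T Dom_Ob Cod_Ob by metis+
  have pb: "is_pullback C (x \<cdot> m) (x \<cdot> g) f n"
    using pba pullback_mono_comp[OF iso_monic[OF x] 2(1) 1(2,4)] by simp
  have h: "x \<cdot> m \<in> hom C B D'" "x \<cdot> g \<in> hom C F D'" using T by (auto simp: hom_def)
  show ?thesis
  proof (rule fpcI[OF 1(1) h pb])
    fix X E s y d
    assume s: "s \<in> hom C X A" and y: "y \<in> hom C X E" and d: "d \<in> hom C E D'"
      and pbd: "is_pullback C (x \<cdot> m) d (f \<cdot> s) y"
    note U = s[THEN hom_conj] y[THEN hom_conj]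
      d[THEN hom_conj]
    have d': "\<psi> \<cdot> d \<in> hom C E D" "x \<cdot> (\<psi> \<cdot> d) = d"
      using T U Ob 2(4)[THEN comp_cancel] by (auto simp: hom_def)
    have pbd': "is_pullback C m (\<psi> \<cdot> d) (f \<cdot> s) y"
      using pbd pullback_mono_comp[OF iso_monic[OF x] 2(1) 1(2) d'(1)] d' by simp
    obtain w where w: "w \<in> hom C E F" "g \<cdot> w = \<psi> \<cdot> d" "w \<cdot> y = n \<cdot> s"
      using fpc_ex[OF a 1(1,4) s d'(1) pbd'] .
    then show "\<exists>w \<in> hom C E F. x \<cdot> g \<cdot> w = d \<and> w \<cdot> y = n \<cdot> s"
      using T U d' by (intro bexI[of _ w]) (auto simp: hom_def)
    fix u v
    assume u: "u \<in> hom C E F" "x \<cdot> g \<cdot> u = d" "u \<cdot> y = n \<cdot> s"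
      and v: "v \<in> hom C E F" "x \<cdot> g \<cdot> v = d" "v \<cdot> y = n \<cdot> s"
    have "g \<cdot> v = \<psi> \<cdot> d" if v: "v \<in> hom C E F" "x \<cdot> g \<cdot> v = d" for v
      using T Ob v 2(3)[THEN comp_cancel] by (auto simp: hom_def)
    then show "u = v"
      using fpc_unique[OF a 1(1,4) s pbd'] u v by blast
  qed
qed

text \<open>A complement of \<open>g\<close> along \<open>m'\<close> exists anyway. Pasted with the
  inner one it is a second complement of \<open>f\<close> along \<open>m' \<cdot> m\<close>, hence
  isomorphic to the given one, and finality shows that the isomorphism takes its leg
  \<open>n'\<close> to \<open>h\<close>.\<close>

lemma fpc_decompose:
  assumes lim: "has_finite_limits C" and lcc: "locally_cartesian_closed C"
    and l: "is_fpc C f m n g" and o: "is_fpc C f (m' \<cdot> m) n2 g2" and m': "monic C m'" "m' \<in> hom C (Cod C m) D'"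
    and h: "h \<in> hom C (Dom C g) (Dom C g2)" "g2 \<cdot> h = m' \<cdot> g" "h \<cdot> n = n2"
  shows "is_fpc C g m' h g2"
proof -
  obtain A B D F where 1: "f \<in> hom C A B" "m \<in> hom C B D" "n \<in> hom C A F" "g \<in> hom C F D"
    and pbl: "is_pullback C m g f n"
    using fpcE[OF l] by metis
  have m'h: "m' \<in> hom C D D'" using m' 1 by (simp add: hom_def)
  obtain F' n' g' where 2: "n' \<in> hom C F F'" "g' \<in> hom C F' D'" and r: "is_fpc C g m' n' g'"
    using fpc_exists[OF lcc m'(1) m'h 1(4)] .
  have mm: "m' \<cdot> m \<in> hom C B D'" using 1 m'h by (auto simp: hom_def)
  obtain F2 where 3: "n2 \<in> hom C A F2" "g2 \<in> hom C F2 D'"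
    using fpcE[OF o] mm 1(1) by (metis homD(2,3))
  have h': "h \<in> hom C F F2" using h 1 3 by (simp add: hom_def)
  obtain \<phi> where \<phi>: "iso_between C F' F2 \<phi>" "\<phi> \<cdot> (n' \<cdot> n) = n2" "g2 \<cdot> \<phi> = g'"
    using fpc_iso[OF fpc_vertical[OF lim l r] o] 2(2) 3(2) by (metis homD(2))
  note T = 1(1-4)[THEN hom_conj] 2(1,2)[THEN hom_conj]
    3(1,2)[THEN hom_conj] m'h[THEN hom_conj]
    h'[THEN hom_conj] iso_between_hom[OF \<phi>(1), THEN hom_conj]
  have Ob: "A \<in> Ob C" using T Dom_Ob by metis
  have pb: "is_pullback C (m' \<cdot> m) (m' \<cdot> g) (f \<cdot> Id C A) n"
    using pbl pullback_mono_comp[OF m'(1) m'h 1(2,4)] T by simp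
  have "g' \<cdot> n' = m' \<cdot> g"
    using r by (simp add: is_fpc_def is_pullback_def)
  then have "\<phi> \<cdot> n' = h"
    using T Ob \<phi> h \<phi>(3)[THEN comp_cancel]
    apply - by (rule fpc_unique[OF o 1(1) 3(2) Id_hom[OF Ob] pb]) (auto simp: hom_def)
  then show ?thesis
    using fpc_iso_apex[OF r, of F2 \<phi> g2] \<phi> T 3 by (simp add: hom_def)
qed

text \<open>A test square for \<open>f \<cdot> f2\<close> is one for \<open>f\<close> with
  \<open>f2 \<cdot> x\<close> in place of \<open>x\<close>. The arrow \<open>w\<close> it induces
  yields, after cancelling the pullback of \<open>l\<close>, a test square for \<open>f2\<close>
  over \<open>n\<close>.\<close>

lemma fpc_horizontal:
  assumes l: "is_fpc C f m n g" and r: "is_fpc C f2 n n2 g2"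
  shows "is_fpc C (f \<cdot> f2) m n2 (g \<cdot> g2)"
proof -
  obtain A B D F where 1: "f \<in> hom C A B" "m \<in> hom C B D" "n \<in> hom C A F" "g \<in> hom C F D"
    "m \<cdot> f = g \<cdot> n" and pbl: "is_pullback C m g f n"
    using fpcE[OF l] by metis
  obtain A2 F2 where 2: "f2 \<in> hom C A2 A" "n2 \<in> hom C A2 F2" "g2 \<in> hom C F2 F"
    "n \<cdot> f2 = g2 \<cdot> n2" and pbr: "is_pullback C n g2 f2 n2"
    using fpcE[OF r] 1 by (metis homD(2,3))
  note T = 1(1-4)[THEN hom_conj] 2(1-3)[THEN hom_conj]
  have h: "f \<cdot> f2 \<in> hom C A2 B" "g \<cdot> g2 \<in> hom C F2 D" using T by (auto simp: hom_def)
  have pb: "is_pullback C m (g \<cdot> g2) (f \<cdot> f2) n2"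
    using pullback_sym[OF pullback_paste[OF pullback_sym[OF pbl] pullback_sym[OF pbr]]] .
  show ?thesis
  proof (rule fpcI[OF h(1) 1(2) h(2) pb])
    fix X E x y d
    assume x: "x \<in> hom C X A2" and y: "y \<in> hom C X E" and d: "d \<in> hom C E D"
      and pbd: "is_pullback C m d (f \<cdot> f2 \<cdot> x) y"
    note U = x[THEN hom_conj] y[THEN hom_conj]
      d[THEN hom_conj]
    have x': "f2 \<cdot> x \<in> hom C X A" and pbd': "is_pullback C m d (f \<cdot> (f2 \<cdot> x)) y"
      using T U pbd by (auto simp: hom_def)
    obtain w where w: "w \<in> hom C E F" "g \<cdot> w = d" "w \<cdot> y = n \<cdot> (f2 \<cdot> x)"
      using fpc_ex[OF l 1(1,4) x' d pbd'] .
    have pbw: "is_pullback C n w (f2 \<cdot> x) y"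
      using T U w pbd'
      by (intro pullback_sym[OF pullback_unpaste[OF pullback_sym[OF pbl] pullback_sym, of _ "f \<cdot> (f2 \<cdot> x)"]])
        (auto simp: hom_def)
    obtain w2 where w2: "w2 \<in> hom C E F2" "g2 \<cdot> w2 = w" "w2 \<cdot> y = n2 \<cdot> x"
      using fpc_ex[OF r 2(1,3) x w(1) pbw] .
    then show "\<exists>w \<in> hom C E F2. g \<cdot> g2 \<cdot> w = d \<and> w \<cdot> y = n2 \<cdot> x"
      using T w by (intro bexI[of _ w2]) (auto simp: hom_def)
    fix u v
    assume u: "u \<in> hom C E F2" "g \<cdot> g2 \<cdot> u = d" "u \<cdot> y = n2 \<cdot> x"
      and v: "v \<in> hom C E F2" "g \<cdot> g2 \<cdot> v = d" "v \<cdot> y = n2 \<cdot> x"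
    have *: "g2 \<cdot> v = w" if v: "v \<in> hom C E F2" "g \<cdot> g2 \<cdot> v = d" "v \<cdot> y = n2 \<cdot> x" for v
      using T U v w 2(4)[symmetric, THEN comp_cancel]
      apply - by (rule fpc_unique[OF l 1(1,4) x' pbd']) (auto simp: hom_def)
    show "u = v"
      using fpc_unique[OF r 2(1,3) x pbw u(1) *[OF u] u(3) v(1) *[OF v] v(3)] .
  qed
qed

text \<open>A test square over \<open>D'\<close> becomes one over \<open>D\<close> by pasting with
  the pullback of \<open>m\<close> along \<open>c\<close>, and the pullback of \<open>g\<close>
  brings the induced arrow back. \<open>span_composition\<close> uses this to pull the second
  derivation back to the context of the first.\<close>

lemma fpc_pullback:
  assumes fpc: "is_fpc C f m n g" and c: "c \<in> hom C D' D"
    and pbm: "is_pullback C m c b m'" and pbg: "is_pullback C g c s g'" and pbf: "is_pullback C f b a f'"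
    and n': "n' \<in> hom C (Dom C a) (Dom C s)" "s \<cdot> n' = n \<cdot> a" "g' \<cdot> n' = m' \<cdot> f'"
  shows "is_fpc C f' m' n' g'"
proof -
  obtain A B F where 1: "f \<in> hom C A B" "m \<in> hom C B D" "n \<in> hom C A F" "g \<in> hom C F D"
    "m \<cdot> f = g \<cdot> n" and pb: "is_pullback C m g f n"
    using fpcE[OF fpc] pullbackE[OF pbm] c by (metis homD(2,3))
  obtain B' where B': "b \<in> hom C B' B" "m' \<in> hom C B' D'" "m \<cdot> b = c \<cdot> m'"
    using pullback_hom[OF pbm 1(2) c] by metis
  obtain F' where F': "s \<in> hom C F' F" "g' \<in> hom C F' D'" "g \<cdot> s = c \<cdot> g'"
    using pullback_hom[OF pbg 1(4) c] by metis
  obtain A' where A': "a \<in> hom C A' A" "f' \<in> hom C A' B'" "f \<cdot> a = b \<cdot> f'"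
    using pullback_hom[OF pbf 1(1) B'(1)] by metis
  have n'h: "n' \<in> hom C A' F'" using n' A' F' by (simp add: hom_def)
  note T = 1(1-4)[THEN hom_conj] c[THEN hom_conj]
    B'(1,2)[THEN hom_conj] F'(1,2)[THEN hom_conj]
    A'(1,2)[THEN hom_conj] n'h[THEN hom_conj]
  have "is_pullback C (c \<cdot> m') g f' (n \<cdot> a)"
    using pullback_paste[OF pb pullback_sym[OF pbf]] B' by simp
  then have pb': "is_pullback C m' g' f' n'"
    using n' n'h T by (intro pullback_unpaste[OF pullback_sym[OF pbg] _ B'(2) c]) auto
  show ?thesis
  proof (rule fpcI[OF A'(2) B'(2) F'(2) pb'])
    fix X E x y d
    assume x: "x \<in> hom C X A'" and y: "y \<in> hom C X E" and d: "d \<in> hom C E D'"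
      and pbd: "is_pullback C m' d (f' \<cdot> x) y"
    note U = x[THEN hom_conj] y[THEN hom_conj]
      d[THEN hom_conj]
    have x': "a \<cdot> x \<in> hom C X A" "c \<cdot> d \<in> hom C E D" using T U by (auto simp: hom_def)
    have dy: "d \<cdot> y = m' \<cdot> (f' \<cdot> x)"
      using pbd by (simp add: is_pullback_def)
    have pbd': "is_pullback C m (c \<cdot> d) (f \<cdot> (a \<cdot> x)) y"
      using pullback_sym[OF pullback_paste[OF pullback_sym[OF pbm] pullback_sym[OF pbd]]]
        T U A'(3)[THEN comp_cancel] by simp
    obtain w where w: "w \<in> hom C E F" "g \<cdot> w = c \<cdot> d" "w \<cdot> y = n \<cdot> (a \<cdot> x)"
      using fpc_ex[OF fpc 1(1,4) x' pbd'] .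
    obtain u where u: "u \<in> hom C E F'" "s \<cdot> u = w" "g' \<cdot> u = d"
      using pullback_ex[OF pbg F'(1,2) w(1) d w(2)] .
    have "u \<cdot> y = n' \<cdot> x"
      using T U w u dy u(2,3)[THEN comp_cancel] n'(2,3)[THEN comp_cancel]
      apply - by (rule pullback_unique[OF pbg F'(1), of _ X]) (auto simp: hom_def)
    then show "\<exists>w \<in> hom C E F'. g' \<cdot> w = d \<and> w \<cdot> y = n' \<cdot> x"
      using u by blast
    fix u v
    assume u: "u \<in> hom C E F'" "g' \<cdot> u = d" "u \<cdot> y = n' \<cdot> x"
      and v: "v \<in> hom C E F'" "g' \<cdot> v = d" "v \<cdot> y = n' \<cdot> x"
    have "s \<cdot> v \<in> hom C E F \<and> g \<cdot> (s \<cdot> v) = c \<cdot> d \<and> s \<cdot> v \<cdot> y = n \<cdot> (a \<cdot> x)"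
      if v: "v \<in> hom C E F'" "g' \<cdot> v = d" "v \<cdot> y = n' \<cdot> x" for v
      using T U v F'(3)[THEN comp_cancel] n'(2)[THEN comp_cancel] by (auto simp: hom_def)
    then have "s \<cdot> u = s \<cdot> v"
      using fpc_unique[OF fpc 1(1,4) x'(1) pbd'] u v by blast
    then show "u = v"
      using pullback_unique[OF pbg F'(1) u(1) v(1)] u v by simp
  qed
qed

end


section \<open>Regular monomorphisms in a quasi-topos\<close>

text \<open>The intrinsic description of multi-sums: by \<open>Msum_iff\<close> their members are
  the jointly epic cospans of regular monos.\<close>

definition jointly_epi :: "('o, 'a) cat \<Rightarrow> 'a \<Rightarrow> 'a \<Rightarrow> bool" where
  "jointly_epi C f g \<longleftrightarrow> f \<in> Arr C \<and> g \<in> Arr C \<and> Cod C f = Cod C g \<and>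
     (\<forall>T u v. u \<in> hom C (Cod C f) T \<and> v \<in> hom C (Cod C f) T \<and>
        u \<cdot>\<^bsub>C\<^esub> f = v \<cdot>\<^bsub>C\<^esub> f \<and> u \<cdot>\<^bsub>C\<^esub> g = v \<cdot>\<^bsub>C\<^esub> g \<longrightarrow> u = v)"

context category
begin

lemma equalizer_ex:
  assumes "is_equalizer C a b m" "m \<in> hom C E X" "h \<in> hom C T X" "a \<cdot> h = b \<cdot> h"
  obtains u where "u \<in> hom C T E" "m \<cdot> u = h"
  using assms that unfolding is_equalizer_def by (metis homD)

lemma equalizerE:
  assumes "is_equalizer C a b m"
  obtains E X Y where "a \<in> hom C X Y" "b \<in> hom C X Y" "m \<in> hom C E X" "a \<cdot> m = b \<cdot> m"
  using assms unfolding is_equalizer_def hom_def by auto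

lemma equalizer_monic:
  assumes "is_equalizer C a b m"
  shows "monic C m"
proof -
  obtain E X Y where h: "a \<in> hom C X Y" "b \<in> hom C X Y" "m \<in> hom C E X" "a \<cdot> m = b \<cdot> m"
    using equalizerE[OF assms] .
  note H = h(1-3)[THEN hom_conj]
  show ?thesis
  proof (rule monicI[OF h(3)])
    fix T u v
    assume uv: "u \<in> hom C T E" "v \<in> hom C T E" "m \<cdot> u = m \<cdot> v"
    have "a \<cdot> (m \<cdot> u) = b \<cdot> (m \<cdot> u)"
      using uv(1) H h(4)[THEN comp_cancel] by (simp add: hom_def)
    then have "\<exists>!w. w \<in> hom C (Dom C (m \<cdot> u)) (Dom C m) \<and> m \<cdot> w = m \<cdot> u"
      using assms[unfolded is_equalizer_def, THEN conjunct2, THEN conjunct2, THEN conjunct2,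
        THEN conjunct2, THEN conjunct2, THEN conjunct2, THEN conjunct2, rule_format, of "m \<cdot> u"] uv(1) H
      by (simp add: hom_def)
    moreover have "Dom C (m \<cdot> u) = T" "Dom C m = E"
      using uv H by (auto simp: hom_def)
    ultimately show "u = v"
      using uv by metis
  qed
qed

lemma equalizerI:
  assumes "a \<in> hom C X Y" "b \<in> hom C X Y" "m \<in> hom C E X" "a \<cdot> m = b \<cdot> m" "monic C m"
    "\<And>T h. h \<in> hom C T X \<Longrightarrow> a \<cdot> h = b \<cdot> h \<Longrightarrow> \<exists>u \<in> hom C T E. m \<cdot> u = h"
  shows "is_equalizer C a b m"
proof -
  have "\<exists>!u. u \<in> hom C (Dom C h) E \<and> m \<cdot> u = h"
    if "h \<in> Arr C" "Cod C h = X" "a \<cdot> h = b \<cdot> h" for h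
    using assms(6)[of h "Dom C h"] that monicD[OF assms(5,3)] by (metis homI)
  then show ?thesis
    using assms(1-4) unfolding is_equalizer_def by (auto simp: hom_def)
qed

lemma regular_monic: "regular_mono C m \<Longrightarrow> monic C m"
  using equalizer_monic by (auto simp: regular_mono_def)

lemma regular_mono_Arr: "regular_mono C m \<Longrightarrow> m \<in> Arr C"
  by (auto simp: regular_mono_def is_equalizer_def)

text \<open>If \<open>g\<close> equalizes \<open>a\<close> and \<open>b\<close>, then
  \<open>p\<close> equalizes \<open>a \<cdot> f\<close> and \<open>b \<cdot> f\<close>.\<close>

lemma regular_mono_pullback:
  assumes pb: "is_pullback C f g p q" and g: "regular_mono C g"
  shows "regular_mono C p"
proof -
  obtain X Y Z P where 1: "f \<in> hom C X Z" "g \<in> hom C Y Z" "p \<in> hom C P X" "q \<in> hom C P Y"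
    "f \<cdot> p = g \<cdot> q"
    using pullbackE[OF pb] .
  obtain a b where eq: "is_equalizer C a b g"
    using g by (auto simp: regular_mono_def)
  obtain W where 2: "a \<in> hom C Z W" "b \<in> hom C Z W" "a \<cdot> g = b \<cdot> g"
    using equalizerE[OF eq] 1(2) by (metis homD(3))
  note T = 1(1-4)[THEN hom_conj] 2(1,2)[THEN hom_conj]
  have "is_equalizer C (a \<cdot> f) (b \<cdot> f) p"
  proof (rule equalizerI[of _ X W _ _ P])
    fix T h
    assume h: "h \<in> hom C T X" "a \<cdot> f \<cdot> h = b \<cdot> f \<cdot> h"
    then have "a \<cdot> (f \<cdot> h) = b \<cdot> (f \<cdot> h)" "f \<cdot> h \<in> hom C T Z"
      using T by (auto simp: hom_def)
    then obtain y where "y \<in> hom C T Y" "g \<cdot> y = f \<cdot> h"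
      using equalizer_ex[OF eq 1(2)] by metis
    then show "\<exists>u \<in> hom C T P. p \<cdot> u = h"
      using pullback_ex[OF pb 1(3,4) h(1)] by metis
  qed (use T 1(5) 2(3)[THEN comp_cancel] pullback_monic[OF pb regular_monic[OF g]] in \<open>auto simp: hom_def\<close>)
  then show ?thesis
    by (auto simp: regular_mono_def)
qed

text \<open>A section \<open>m\<close> of \<open>r\<close> is the equalizer of
  \<open>m \<cdot> r\<close> and the identity.\<close>

lemma regular_mono_split:
  assumes "m \<in> hom C A B" "r \<in> hom C B A" "r \<cdot> m = Id C A"
  shows "regular_mono C m"
proof -
  have Ob: "A \<in> Ob C" "B \<in> Ob C" using assms hom_Ob by blast+
  note T = assms(1,2)[THEN hom_conj]
  have "monic C (r \<cdot> m)"
    using iso_monic[OF iso_between_id[OF Ob(1)]] assms(3) by simp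
  then have m: "monic C m"
    using monic_cancel assms by blast
  have "is_equalizer C (m \<cdot> r) (Id C B) m"
  proof (rule equalizerI[of _ B B _ _ A])
    fix T h
    assume "h \<in> hom C T B" "m \<cdot> r \<cdot> h = Id C B \<cdot> h"
    then show "\<exists>u \<in> hom C T A. m \<cdot> u = h"
      using T by (intro bexI[of _ "r \<cdot> h"]) (auto simp: hom_def)
  qed (use T Ob assms(3) m in \<open>auto simp: hom_def\<close>)
  then show ?thesis
    by (auto simp: regular_mono_def)
qed

lemma regular_mono_iso: "iso_between C A B f \<Longrightarrow> regular_mono C f"
  by (metis iso_betweenE regular_mono_split)

text \<open>Pulling \<open>g \<cdot> f\<close> back along the monic \<open>g\<close> returns
  \<open>f\<close>.\<close>

lemma regular_mono_cancel_monic: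
  assumes "regular_mono C (g \<cdot> f)" "monic C g" "f \<in> hom C A B" "g \<in> hom C B D"
  shows "regular_mono C f"
proof -
  have "is_pullback C g (g \<cdot> f) f (Id C A)"
    using pullback_mono_self assms by blast
  then show ?thesis
    using regular_mono_pullback assms(1) by blast
qed

section \<open>Orthogonality and uniqueness of factorizations\<close>

text \<open>The two arrows whose equalizer is \<open>m\<close> agree after \<open>w\<close>, because
  they agree on \<open>f\<close> and on \<open>g\<close> and these are jointly epic; so
  \<open>w\<close> factors through \<open>m\<close>.\<close>

lemma jointly_epi_regular_orthogonal:
  assumes je: "jointly_epi C f g" and fg: "f \<in> hom C A Z" "g \<in> hom C B Z" and m: "regular_mono C m" "m \<in> hom C X Y"
    and w: "w \<in> hom C Z Y" and u: "u \<in> hom C A X" "w \<cdot> f = m \<cdot> u" and v: "v \<in> hom C B X" "w \<cdot> g = m \<cdot> v"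
  obtains t where "t \<in> hom C Z X" "m \<cdot> t = w" "t \<cdot> f = u" "t \<cdot> g = v"
proof -
  obtain a b where eq: "is_equalizer C a b m"
    using m by (auto simp: regular_mono_def)
  obtain W where 2: "a \<in> hom C Y W" "b \<in> hom C Y W" "a \<cdot> m = b \<cdot> m"
    using equalizerE[OF eq] m(2) by (metis homD(3))
  note T = fg[THEN hom_conj] m(2)[THEN hom_conj] w[THEN hom_conj]
    u(1)[THEN hom_conj] v(1)[THEN hom_conj] 2(1,2)[THEN hom_conj]
  have "a \<cdot> w \<in> hom C (Cod C f) W \<and> b \<cdot> w \<in> hom C (Cod C f) W \<and>
      a \<cdot> w \<cdot> f = b \<cdot> w \<cdot> f \<and> a \<cdot> w \<cdot> g = b \<cdot> w \<cdot> g"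
    using T u(2) v(2) 2(3)[THEN comp_cancel] by (simp add: hom_def)
  then have "a \<cdot> w = b \<cdot> w"
    using je unfolding jointly_epi_def by blast
  then obtain t where t: "t \<in> hom C Z X" "m \<cdot> t = w"
    using equalizer_ex[OF eq m(2) w] by metis
  have "t \<cdot> f = u" "t \<cdot> g = v"
    using monicD[OF regular_monic[OF m(1)] m(2), of "t \<cdot> f" A u]
      monicD[OF regular_monic[OF m(1)] m(2), of "t \<cdot> g" B v]
      t T t(2)[THEN comp_cancel] u(2) v(2) by (auto simp: hom_def)
  then show ?thesis using that t by blast
qed

text \<open>Orthogonality in both directions gives comparisons \<open>s\<close> and
  \<open>t\<close>; they are mutually inverse because \<open>y\<close> and \<open>y'\<close> are
  monic.\<close>

lemma jointly_epi_factorization_iso: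
  assumes je: "jointly_epi C f g" and fg: "f \<in> hom C A Y" "g \<in> hom C B Y"
    and je': "jointly_epi C f' g'" and fg': "f' \<in> hom C A Y'" "g' \<in> hom C B Y'"
    and y: "regular_mono C y" "y \<in> hom C Y Z" and y': "regular_mono C y'" "y' \<in> hom C Y' Z"
    and e: "y \<cdot> f = y' \<cdot> f'" "y \<cdot> g = y' \<cdot> g'"
  obtains \<phi> where "iso_between C Y Y' \<phi>" "\<phi> \<cdot> f = f'" "\<phi> \<cdot> g = g'" "y' \<cdot> \<phi> = y"
proof -
  obtain s where s: "s \<in> hom C Y Y'" "y' \<cdot> s = y" "s \<cdot> f = f'" "s \<cdot> g = g'"
    using jointly_epi_regular_orthogonal[OF je fg y' y(2) fg'(1) e(1) fg'(2) e(2)] .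
  obtain t where t: "t \<in> hom C Y' Y" "y \<cdot> t = y'"
    using jointly_epi_regular_orthogonal[OF je' fg' y y'(2) fg(1) e(1)[symmetric] fg(2) e(2)[symmetric]] .
  note T = y(2)[THEN hom_conj] y'(2)[THEN hom_conj]
    s(1)[THEN hom_conj] t(1)[THEN hom_conj]
  have Ob: "Y \<in> Ob C" "Y' \<in> Ob C" using hom_Ob y(2) y'(2) by blast+
  have "t \<cdot> s = Id C Y"
    using T Ob s(2) t(2)[THEN comp_cancel, of s]
    apply - by (rule monicD[OF regular_monic[OF y(1)] y(2), of _ Y]) (auto simp: hom_def)
  moreover have "s \<cdot> t = Id C Y'"
    using T Ob t(2) s(2)[THEN comp_cancel, of t]
    apply - by (rule monicD[OF regular_monic[OF y'(1)] y'(2), of _ Y']) (auto simp: hom_def)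
  ultimately have "iso_between C Y Y' s"
    using s t by (auto simp: iso_between_def)
  then show ?thesis using that s by blast
qed

lemma jointly_epi_hom:
  assumes "jointly_epi C f g"
  shows "f \<in> hom C (Dom C f) (Cod C f)" "g \<in> hom C (Dom C g) (Cod C f)"
proof -
  have "f \<in> Arr C" "g \<in> Arr C" "Cod C f = Cod C g"
    using assms unfolding jointly_epi_def by blast+
  then show "f \<in> hom C (Dom C f) (Cod C f)" "g \<in> hom C (Dom C g) (Cod C f)"
    by (simp_all add: hom_def)
qed

text \<open>An epi taken twice is a jointly epic pair, so the orthogonality and uniqueness results
  also cover image factorizations.\<close>

lemma epi_jointly_epi: "epi C e \<Longrightarrow> jointly_epi C e e"
  unfolding epi_def jointly_epi_def hom_def by auto

lemma epi_regular_orthogonal: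
  assumes "epi C e" "e \<in> hom C A Z" "regular_mono C m" "m \<in> hom C X Y"
    "w \<in> hom C Z Y" "u \<in> hom C A X" "w \<cdot> e = m \<cdot> u"
  obtains t where "t \<in> hom C Z X" "m \<cdot> t = w" "t \<cdot> e = u"
  using jointly_epi_regular_orthogonal[OF epi_jointly_epi[OF assms(1)] assms(2,2,3,4,5,6,7,6,7)] that
  by blast

end

context quasi_topos
begin

lemma pullback_of:
  assumes "f \<in> hom C X Z" "g \<in> hom C Y Z"
  obtains P p q where "p \<in> hom C P X" "q \<in> hom C P Y" "is_pullback C f g p q"
  using pullback_exists[OF finite_limits assms] .

lemma pushout_of:
  assumes "f \<in> hom C Z X" "g \<in> hom C Z Y"
  obtains P p q where "p \<in> hom C X P" "q \<in> hom C Y P" "is_pushout C f g p q"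
  using category.pullback_exists[OF opposite_category finite_colimits[unfolded has_finite_colimits_def],
      of f X Z g Y] assms that by simp metis

lemma fpc_of:
  assumes "regular_mono C m" "m \<in> hom C B D" "f \<in> hom C A B"
  obtains F n g where "n \<in> hom C A F" "g \<in> hom C F D" "is_fpc C f m n g"
  using fpc_exists[OF lcc regular_monic[OF assms(1)] assms(2,3)] .

lemma regular_mono_fpc: "is_fpc C f m n g \<Longrightarrow> regular_mono C m \<Longrightarrow> regular_mono C n"
  using pullback_sym regular_mono_pullback unfolding is_fpc_def by blast

text \<open>The final pullback complement of \<open>B \<rightarrow> T\<close> along \<open>true\<close> classifies partial maps into \<open>B\<close>
  that are defined on regular subobjects.\<close>

lemma partial_map_classifier:
  assumes B: "B \<in> Ob C"
  obtains \<eta> B' where "regular_mono C \<eta>" "\<eta> \<in> hom C B B'"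
    "\<And>A X m f. regular_mono C m \<Longrightarrow> m \<in> hom C A X \<Longrightarrow> f \<in> hom C A B \<Longrightarrow>
       \<exists>w \<in> hom C X B'. is_pullback C w \<eta> m f"
proof -
  obtain T \<Omega> tr where cl: "is_regular_subobject_classifier C T \<Omega> tr"
    using classifier by blast
  then have tm: "is_terminal C T" and tr: "tr \<in> hom C T \<Omega>"
    and char: "\<And>m. regular_mono C m \<Longrightarrow>
      \<exists>\<chi> \<in> hom C (Cod C m) \<Omega>. \<exists>b \<in> hom C (Dom C m) T. is_pullback C \<chi> tr m b"
    unfolding is_regular_subobject_classifier_def by blast+
  have ex1: "\<exists>!u. u \<in> hom C X T" if "X \<in> Ob C" for X
    using tm that by (simp add: is_terminal_def)
  obtain b where b: "b \<in> hom C B T" using ex1[OF B] by blast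
  obtain s where s: "s \<in> hom C \<Omega> T" using ex1 hom_Ob[OF tr] by blast
  have "s \<cdot> tr = Id C T"
    using ex1[of T] hom_Ob[OF tr] Comp_hom[OF tr s] Id_hom by blast
  then have rtr: "regular_mono C tr" using regular_mono_split tr s by blast
  obtain B' \<eta> g where g: "\<eta> \<in> hom C B B'" "g \<in> hom C B' \<Omega>" and fpc: "is_fpc C b tr \<eta> g"
    using fpc_of[OF rtr tr b] .
  have pb: "is_pullback C g tr \<eta> b"
    using fpc pullback_sym by (simp add: is_fpc_def)
  have "\<exists>w \<in> hom C X B'. is_pullback C w \<eta> m f"
    if m: "regular_mono C m" "m \<in> hom C A X" and f: "f \<in> hom C A B" for A X m f
  proof -
    obtain \<chi> b' where \<chi>: "\<chi> \<in> hom C X \<Omega>" "b' \<in> hom C A T" "is_pullback C \<chi> tr m b'"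
      using char[OF m(1)] m(2) by (auto simp: hom_def)
    have b': "b \<cdot> f = b'"
      using ex1[of A] hom_Ob[OF f] Comp_hom[OF f b] \<chi>(2) by blast
    have "is_pullback C tr \<chi> (b \<cdot> f) m" using pullback_sym \<chi>(3) b' by blast
    then obtain w where w: "w \<in> hom C X B'" "g \<cdot> w = \<chi>" "w \<cdot> m = \<eta> \<cdot> f"
      using fpc_ex[OF fpc b g(2) f \<chi>(1)] by blast
    \<comment> \<open>The characteristic square of \<open>m\<close> is this square followed by the
      one that defines the complement, and the latter can be cancelled.\<close>
    then have "is_pullback C w \<eta> m f"
      using pullback_unpaste[OF pb, of w m b' X B' \<Omega> f] \<chi> b' g m f by (auto simp: hom_def)
    then show ?thesis using w by blast
  qed
  then show ?thesis
    using that[OF _ g(1)] regular_mono_pullback[OF pb rtr] by blast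
qed

text \<open>\<open>m\<close> is pulled back from \<open>tr\<close> along \<open>\<chi>\<close>, and
  the partial map \<open>\<chi>\<close> extends along \<open>n\<close> to an arrow \<open>w\<close>
  on \<open>D\<close>. Pasting exhibits \<open>n \<cdot> m\<close> as a pullback of
  \<open>\<eta> \<cdot> tr\<close>, which is a split mono because its source is terminal.\<close>

lemma regular_mono_comp:
  assumes m: "regular_mono C m" "m \<in> hom C A B" and n: "regular_mono C n" "n \<in> hom C B D"
  shows "regular_mono C (n \<cdot> m)"
proof -
  obtain T \<Omega> tr where cl: "is_regular_subobject_classifier C T \<Omega> tr"
    using classifier by blast
  then have tm: "is_terminal C T" and tr: "tr \<in> hom C T \<Omega>"
    unfolding is_regular_subobject_classifier_def by blast+
  obtain \<chi> b where \<chi>: "\<chi> \<in> hom C B \<Omega>" "is_pullback C \<chi> tr m b"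
    using cl m unfolding is_regular_subobject_classifier_def by (metis homD(3))
  obtain \<eta> \<Omega>' where \<eta>: "\<eta> \<in> hom C \<Omega> \<Omega>'"
    and cl': "\<And>A X m f. regular_mono C m \<Longrightarrow> m \<in> hom C A X \<Longrightarrow> f \<in> hom C A \<Omega> \<Longrightarrow>
       \<exists>w \<in> hom C X \<Omega>'. is_pullback C w \<eta> m f"
    using partial_map_classifier hom_Ob[OF tr] by metis
  obtain w where w: "is_pullback C w \<eta> n \<chi>"
    using cl'[OF n \<chi>(1)] by blast
  have "is_pullback C w (\<eta> \<cdot> tr) (n \<cdot> m) b"
    using pullback_sym[OF pullback_paste[OF pullback_sym[OF w] pullback_sym[OF \<chi>(2)]]] .
  moreover have "regular_mono C (\<eta> \<cdot> tr)"
  proof -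
    have h: "\<eta> \<cdot> tr \<in> hom C T \<Omega>'" using Comp_hom tr \<eta> by blast
    obtain s where s: "s \<in> hom C \<Omega>' T"
      using tm hom_Ob[OF h] unfolding is_terminal_def by blast
    have "s \<cdot> (\<eta> \<cdot> tr) = Id C T"
      using tm hom_Ob[OF h] Comp_hom[OF h s] Id_hom[of T] unfolding is_terminal_def by blast
    then show ?thesis using regular_mono_split h s by blast
  qed
  ultimately show ?thesis
    using regular_mono_pullback by blast
qed

text \<open>The equalizer of the cokernel pair of \<open>f\<close> is the least regular subobject
  through which \<open>f\<close> factors. If two arrows agree on \<open>e\<close>, their equalizer
  \<open>k\<close> gives another such subobject \<open>m \<cdot> k\<close>, regular because regular
  monos compose; so \<open>m\<close> factors through it and \<open>k\<close> is split epi.\<close>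

lemma regular_image:
  assumes f: "f \<in> hom C A B"
  obtains I e m where "e \<in> hom C A I" "m \<in> hom C I B" "epi C e" "regular_mono C m" "m \<cdot> e = f"
proof -
  obtain Q a b where ab: "a \<in> hom C B Q" "b \<in> hom C B Q" and po: "is_pushout C f f a b"
    using pushout_of[OF f f] .
  obtain I m where m: "m \<in> hom C I B" and eq: "is_equalizer C a b m"
    using equalizer_exists[OF finite_limits ab] .
  have rm: "regular_mono C m" using eq by (auto simp: regular_mono_def)
  have "a \<cdot> f = b \<cdot> f" using po by (simp add: is_pushout_def)
  then obtain e where e: "e \<in> hom C A I" "m \<cdot> e = f"
    using equalizer_ex[OF eq m f] by blast
  have "epi C e"
  proof (rule epiI[OF e(1)])
    fix T u v
    assume uv: "u \<in> hom C I T" "v \<in> hom C I T" "u \<cdot> e = v \<cdot> e"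
    obtain K k where k: "k \<in> hom C K I" and eqk: "is_equalizer C u v k"
      using equalizer_exists[OF finite_limits uv(1,2)] .
    obtain e' where e': "e' \<in> hom C A K" "k \<cdot> e' = e"
      using equalizer_ex[OF eqk k e(1) uv(3)] .
    have "regular_mono C (m \<cdot> k)"
      using regular_mono_comp[OF _ k rm m] eqk by (auto simp: regular_mono_def)
    then obtain a' b' where eqmk: "is_equalizer C a' b' (m \<cdot> k)"
      by (auto simp: regular_mono_def)
    have mk: "m \<cdot> k \<in> hom C K B" using Comp_hom m k by blast
    obtain Y where ab': "a' \<in> hom C B Y" "b' \<in> hom C B Y" "a' \<cdot> (m \<cdot> k) = b' \<cdot> (m \<cdot> k)"
      using equalizerE[OF eqmk] mk by (metis homD(3))
    note T = ab[THEN hom_conj] m[THEN hom_conj] f[THEN hom_conj]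
      e(1)[THEN hom_conj] e'(1)[THEN hom_conj] k[THEN hom_conj]
      ab'(1,2)[THEN hom_conj]
    have "a' \<cdot> f = a' \<cdot> (m \<cdot> k) \<cdot> e'" "b' \<cdot> f = b' \<cdot> (m \<cdot> k) \<cdot> e'"
      using T e(2) e'(2) by auto
    then have "a' \<cdot> f = b' \<cdot> f" using ab'(3) by simp
    \<comment> \<open>\<open>a'\<close> and \<open>b'\<close> agree on \<open>f\<close>, which
      factors through \<open>m \<cdot> k\<close>; hence they factor through the cokernel pair and
      also agree on \<open>m\<close>.\<close>
    then obtain t where t: "t \<in> hom C Q Y" "t \<cdot> a = a'" "t \<cdot> b = b'"
      using pushout_ex[OF po ab ab'(1,2)] by blast
    have "a \<cdot> m = b \<cdot> m" using eq by (simp add: is_equalizer_def)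
    then have "a' \<cdot> m = b' \<cdot> m"
      using T t t(2,3)[THEN comp_cancel, of m] by (auto simp: hom_def)
    then obtain j where j: "j \<in> hom C I K" "m \<cdot> k \<cdot> j = m"
      using equalizer_ex[OF eqmk mk m] by blast
    have "k \<cdot> j = Id C I"
      using T j hom_Ob[OF m] apply - by (rule monicD[OF regular_monic[OF rm] m, of _ I]) (auto simp: hom_def)
    moreover have "u \<cdot> k = v \<cdot> k" using eqk by (simp add: is_equalizer_def)
    ultimately show "u = v"
      using Comp_assoc[OF j(1) k uv(1)] Comp_assoc[OF j(1) k uv(2)] Comp_Id[OF uv(1)] Comp_Id[OF uv(2)]
      by metis
  qed
  then show ?thesis using that e m rm by blast
qed

text \<open>In contrast to \<open>regular_mono_cancel_monic\<close>, \<open>g\<close> is arbitrary.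
  Writing \<open>f\<close> as \<open>m \<cdot> e\<close>, orthogonality of the epi \<open>e\<close>
  against \<open>g \<cdot> f\<close> yields a retraction of \<open>e\<close>, so \<open>f\<close> is
  a split mono followed by a regular mono.\<close>

lemma regular_mono_cancel:
  assumes gf: "regular_mono C (g \<cdot> f)" and f: "f \<in> hom C A B" and g: "g \<in> hom C B D"
  shows "regular_mono C f"
proof -
  obtain I e m where e: "e \<in> hom C A I" "m \<in> hom C I B" "epi C e" "regular_mono C m" "m \<cdot> e = f"
    using regular_image[OF f] .
  have Ob: "A \<in> Ob C" "I \<in> Ob C" using hom_Ob e(1) by blast+
  note T = e(1,2)[THEN hom_conj] f[THEN hom_conj] g[THEN hom_conj]
  have h: "g \<cdot> f \<in> hom C A D" "g \<cdot> m \<in> hom C I D" "g \<cdot> m \<cdot> e = g \<cdot> f \<cdot> Id C A"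
    using T e(5) Ob by (auto simp: hom_def)
  obtain t where t: "t \<in> hom C I A" "t \<cdot> e = Id C A"
    using epi_regular_orthogonal[OF e(3,1) gf h(1,2) Id_hom[OF Ob(1)] h(3)] by metis
  have "regular_mono C e"
    using regular_mono_split e t by blast
  then show ?thesis
    using regular_mono_comp e by metis
qed

text \<open>The partial map \<open>f\<close> with domain \<open>m\<close> extends to
  \<open>w\<close> on \<open>X\<close>, and \<open>\<eta>\<close> and \<open>w\<close> induce an
  arrow \<open>v\<close> on the pushout. From \<open>v \<cdot> p = \<eta>\<close> the leg
  \<open>p\<close> is regular by cancellation, and a commuting square over \<open>p\<close> and
  \<open>q\<close> becomes under \<open>v\<close> one over \<open>\<eta>\<close> and
  \<open>w\<close>, whose pullback is \<open>A\<close>.\<close>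

lemma pushout_regular_mono:
  assumes po: "is_pushout C f m p q" and m: "regular_mono C m"
  shows "regular_mono C p" "is_pullback C p q f m"
proof -
  obtain A B X D where 1: "f \<in> hom C A B" "m \<in> hom C A X" "p \<in> hom C B D" "q \<in> hom C X D" "p \<cdot> f = q \<cdot> m"
    using pushoutE[OF po] .
  obtain \<eta> B' where \<eta>: "regular_mono C \<eta>" "\<eta> \<in> hom C B B'"
    and cl: "\<And>A X m f. regular_mono C m \<Longrightarrow> m \<in> hom C A X \<Longrightarrow> f \<in> hom C A B \<Longrightarrow>
       \<exists>w \<in> hom C X B'. is_pullback C w \<eta> m f"
    using partial_map_classifier hom_Ob[OF 1(3)] by metis
  obtain w where w: "w \<in> hom C X B'" "is_pullback C w \<eta> m f"
    using cl[OF m 1(2,1)] by blast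
  obtain v where v: "v \<in> hom C D B'" "v \<cdot> p = \<eta>" "v \<cdot> q = w"
    using pushout_ex[OF po 1(3,4) \<eta>(2) w(1)] w(2) by (metis is_pullback_def)
  show rp: "regular_mono C p"
    using regular_mono_cancel[of v p] \<eta> v 1 by metis
  show "is_pullback C p q f m"
  proof (rule pullbackI[OF 1(3,4,1,2,5)])
    fix T x y
    assume xy: "x \<in> hom C T B" "y \<in> hom C T X" "p \<cdot> x = q \<cdot> y"
    have "\<eta> \<cdot> x = w \<cdot> y"
      using v xy Comp_assoc[OF xy(1) 1(3) v(1)] Comp_assoc[OF xy(2) 1(4) v(1)] by metis
    then show "\<exists>u \<in> hom C T A. f \<cdot> u = x \<and> m \<cdot> u = y"
      using pullback_ex[OF w(2) 1(2,1) xy(2,1)] by metis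
  next
    fix T u v
    assume "u \<in> hom C T A" "v \<in> hom C T A" "f \<cdot> u = f \<cdot> v" "m \<cdot> u = m \<cdot> v"
    then show "u = v" using monicD[OF regular_monic[OF m] 1(2)] by blast
  qed
qed

section \<open>Jointly epic factorizations and multi-sums\<close>

text \<open>This is the image of the copairing of \<open>a\<close> and \<open>b\<close>: an epi out
  of a coproduct is jointly epic on the two injections. The coproduct comes from
  \<open>product_exists\<close> in the opposite category.\<close>

lemma jointly_epi_factorization:
  assumes a: "a \<in> hom C A Z" and b: "b \<in> hom C B Z"
  obtains Y f g y where "f \<in> hom C A Y" "g \<in> hom C B Y" "jointly_epi C f g"
    "y \<in> hom C Y Z" "regular_mono C y" "y \<cdot> f = a" "y \<cdot> g = b"
proof -
  obtain S i j where ij: "i \<in> hom C A S" "j \<in> hom C B S"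
    and ex: "\<And>T x y. x \<in> hom C A T \<Longrightarrow> y \<in> hom C B T \<Longrightarrow> \<exists>u \<in> hom C S T. u \<cdot> i = x \<and> u \<cdot> j = y"
    and un: "\<And>T u v. u \<in> hom C S T \<Longrightarrow> v \<in> hom C S T \<Longrightarrow> u \<cdot> i = v \<cdot> i \<Longrightarrow> u \<cdot> j = v \<cdot> j \<Longrightarrow> u = v"
  proof (rule category.product_exists[OF opposite_category finite_colimits[unfolded has_finite_colimits_def],
        of A B])
    fix S i j
    assume *: "i \<in> hom (opposite C) S A" "j \<in> hom (opposite C) S B"
      "\<And>T x y. x \<in> hom (opposite C) T A \<Longrightarrow> y \<in> hom (opposite C) T B \<Longrightarrow>
        \<exists>u \<in> hom (opposite C) T S. Comp (opposite C) i u = x \<and> Comp (opposite C) j u = y"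
      "\<And>T u v. u \<in> hom (opposite C) T S \<Longrightarrow> v \<in> hom (opposite C) T S \<Longrightarrow>
        Comp (opposite C) i u = Comp (opposite C) i v \<Longrightarrow> Comp (opposite C) j u = Comp (opposite C) j v \<Longrightarrow> u = v"
    show thesis
      by (rule that[of i S j]) (use * in simp_all)
  qed (use hom_Ob[OF a] hom_Ob[OF b] in auto)
  obtain c where c: "c \<in> hom C S Z" "c \<cdot> i = a" "c \<cdot> j = b"
    using ex[OF a b] by blast
  obtain Y e m where e: "e \<in> hom C S Y" "m \<in> hom C Y Z" "epi C e" "regular_mono C m" "m \<cdot> e = c"
    using regular_image[OF c(1)] .
  note T = ij[THEN hom_conj] e(1,2)[THEN hom_conj]
  have "u = v" if "u \<in> hom C Y T" "v \<in> hom C Y T" "u \<cdot> (e \<cdot> i) = v \<cdot> (e \<cdot> i)" "u \<cdot> (e \<cdot> j) = v \<cdot> (e \<cdot> j)"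
    for T u v
  proof -
    have "u \<cdot> e = v \<cdot> e"
      using that T apply - by (rule un[of _ T]) (auto simp: hom_def)
    then show ?thesis using epiD[OF e(3,1)] that by blast
  qed
  then have "jointly_epi C (e \<cdot> i) (e \<cdot> j)"
    unfolding jointly_epi_def using T by auto
  moreover have "m \<cdot> (e \<cdot> i) = a" "m \<cdot> (e \<cdot> j) = b"
    using T c e(5) comp_cancel[OF e(5)] by auto
  ultimately show ?thesis
    using that[OF Comp_hom[OF ij(1) e(1)] Comp_hom[OF ij(2) e(1)] _ e(2,4)] by blast
qed

lemma jointly_epi_multi_sum:
  "is_multi_sum C A B {(f, g). regular_mono C f \<and> regular_mono C g \<and>
     Dom C f = A \<and> Dom C g = B \<and> jointly_epi C f g}" (is "is_multi_sum C A B ?S")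
  unfolding is_multi_sum_def
proof (intro conjI allI impI)
  show "\<forall>(f, g) \<in> ?S. regular_mono C f \<and> regular_mono C g \<and> Dom C f = A \<and> Dom C g = B \<and> Cod C f = Cod C g"
    by (auto simp: jointly_epi_def)
next
  fix a b
  assume ab: "regular_mono C a \<and> regular_mono C b \<and> Dom C a = A \<and> Dom C b = B \<and> Cod C a = Cod C b"
  then have h: "a \<in> hom C A (Cod C a)" "b \<in> hom C B (Cod C a)"
    using regular_mono_Arr by (auto simp: hom_def)
  obtain Y f g y where f: "f \<in> hom C A Y" "g \<in> hom C B Y" "jointly_epi C f g"
    "y \<in> hom C Y (Cod C a)" "regular_mono C y" "y \<cdot> f = a" "y \<cdot> g = b"
    using jointly_epi_factorization[OF h] .
  have "regular_mono C f" "regular_mono C g"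
    using regular_mono_cancel_monic[OF _ regular_monic[OF f(5)] _ f(4)] f ab by metis+
  then have "(f, g) \<in> ?S" "y \<in> hom C (Cod C f) (Cod C a)"
    using f by (auto simp: hom_def)
  then show "\<exists>(f, g) \<in> ?S. \<exists>y \<in> hom C (Cod C f) (Cod C a). regular_mono C y \<and> a = y \<cdot> f \<and> b = y \<cdot> g"
    using f by blast
next
  fix a b
  assume ab: "regular_mono C a \<and> regular_mono C b \<and> Dom C a = A \<and> Dom C b = B \<and> Cod C a = Cod C b"
  have "\<exists>!\<phi>. iso_between C (Cod C f) (Cod C f') \<phi> \<and> \<phi> \<cdot> f = f' \<and> \<phi> \<cdot> g = g' \<and> y' \<cdot> \<phi> = y"
    if S: "(f, g) \<in> ?S" "(f', g') \<in> ?S" and y: "y \<in> hom C (Cod C f) (Cod C a)" "y' \<in> hom C (Cod C f') (Cod C a)"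
      and e: "regular_mono C y" "a = y \<cdot> f" "b = y \<cdot> g" "regular_mono C y'" "a = y' \<cdot> f'" "b = y' \<cdot> g'"
    for f g f' g' y y'
  proof -
    have h: "f \<in> hom C A (Cod C f)" "g \<in> hom C B (Cod C f)" "f' \<in> hom C A (Cod C f')" "g' \<in> hom C B (Cod C f')"
      and je: "jointly_epi C f g" "jointly_epi C f' g'"
      using S jointly_epi_hom[of f g] jointly_epi_hom[of f' g'] by auto
    have yy: "y \<cdot> f = y' \<cdot> f'" "y \<cdot> g = y' \<cdot> g'"
      using e(2,3,5,6) by metis+
    obtain s where s: "iso_between C (Cod C f) (Cod C f') s" "s \<cdot> f = f'" "s \<cdot> g = g'" "y' \<cdot> s = y"
      using jointly_epi_factorization_iso[OF je(1) h(1,2) je(2) h(3,4) e(1) y(1) e(4) y(2) yy] .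
    have "\<phi> = s" if "iso_between C (Cod C f) (Cod C f') \<phi>" "y' \<cdot> \<phi> = y" for \<phi>
      using monicD[OF regular_monic[OF e(4)] y(2) iso_between_hom[OF that(1)] iso_between_hom[OF s(1)]]
        that s by simp
    then show ?thesis
      using s by blast
  qed
  then show "\<forall>(f, g) \<in> ?S. \<forall>y \<in> hom C (Cod C f) (Cod C a).
     \<forall>(f', g') \<in> ?S. \<forall>y' \<in> hom C (Cod C f') (Cod C a).
       regular_mono C y \<and> a = y \<cdot> f \<and> b = y \<cdot> g \<and> regular_mono C y' \<and> a = y' \<cdot> f' \<and> b = y' \<cdot> g' \<longrightarrow>
       (\<exists>!\<phi>. iso_between C (Cod C f) (Cod C f') \<phi> \<and> \<phi> \<cdot> f = f' \<and> \<phi> \<cdot> g = g' \<and> y' \<cdot> \<phi> = y)"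
    by blast
qed

text \<open>A member \<open>(f, g)\<close> of a multi-sum \<open>S\<close> factors through its
  jointly epic part by \<open>y\<close>, and that part through some member of \<open>S\<close> by
  \<open>z\<close>. So \<open>(f, g)\<close> factors through members of \<open>S\<close> both by
  \<open>y \<cdot> z\<close> and by the identity, and essential uniqueness makes
  \<open>y \<cdot> z\<close> invertible. Hence \<open>y\<close> is split epi and
  \<open>(f, g)\<close> is itself jointly epic.\<close>

lemma Msum_iff: "(f, g) \<in> Msum C A B \<longleftrightarrow>
    regular_mono C f \<and> regular_mono C g \<and> Dom C f = A \<and> Dom C g = B \<and> jointly_epi C f g"
proof
  assume "(f, g) \<in> Msum C A B"
  then obtain S where S: "is_multi_sum C A B S" "(f, g) \<in> S"
    by (auto simp: Msum_def)
  have r: "regular_mono C f" "regular_mono C g" "Dom C f = A" "Dom C g = B" "Cod C f = Cod C g"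
    using S unfolding is_multi_sum_def by blast+
  then have h: "f \<in> hom C A (Cod C f)" "g \<in> hom C B (Cod C f)"
    using regular_mono_Arr by (auto simp: hom_def)
  obtain Y f1 g1 y where f1: "f1 \<in> hom C A Y" "g1 \<in> hom C B Y" "jointly_epi C f1 g1"
    "y \<in> hom C Y (Cod C f)" "regular_mono C y" "y \<cdot> f1 = f" "y \<cdot> g1 = g"
    using jointly_epi_factorization[OF h] .
  have "regular_mono C f1" "regular_mono C g1"
    using regular_mono_cancel_monic[OF _ regular_monic[OF f1(5)] _ f1(4)] f1 r by metis+
  moreover have "Cod C f1 = Y" "Dom C f1 = A" "Dom C g1 = B" "Cod C g1 = Y"
    using f1 by (auto simp: hom_def)
  ultimately obtain f2 g2 z where z: "(f2, g2) \<in> S" "z \<in> hom C (Cod C f2) Y" "regular_mono C z"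
      "f1 = z \<cdot> f2" "g1 = z \<cdot> g2"
    using S(1) unfolding is_multi_sum_def by (elim conjE allE[of _ f1] allE[of _ g1]) auto
  have h2: "f2 \<in> hom C A (Cod C f2)" "g2 \<in> hom C B (Cod C f2)"
    using S(1) z(1) regular_mono_Arr unfolding is_multi_sum_def by (fastforce simp: hom_def)+
  note T = f1(1,2,4)[THEN hom_conj] z(2)[THEN hom_conj]
    h2[THEN hom_conj] h[THEN hom_conj]
  have yz: "y \<cdot> z \<in> hom C (Cod C f2) (Cod C f)" "regular_mono C (y \<cdot> z)" "f = y \<cdot> z \<cdot> f2" "g = y \<cdot> z \<cdot> g2"
    using T z f1 regular_mono_comp[OF z(3,2) f1(5,4)] by (auto simp: hom_def)
  have i: "Id C (Cod C f) \<in> hom C (Cod C f) (Cod C f)" "regular_mono C (Id C (Cod C f))"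
    "f = Id C (Cod C f) \<cdot> f" "g = Id C (Cod C f) \<cdot> g"
    using T regular_mono_iso[OF iso_between_id] by (auto simp: hom_def)
  have r': "regular_mono C f \<and> regular_mono C g \<and> Dom C f = A \<and> Dom C g = B \<and> Cod C f = Cod C g"
    using r by blast
  have "(\<forall>(f1, g1) \<in> S. \<forall>y \<in> hom C (Cod C f1) (Cod C f).
         \<forall>(f', g') \<in> S. \<forall>y' \<in> hom C (Cod C f') (Cod C f).
           regular_mono C y \<and> f = y \<cdot> f1 \<and> g = y \<cdot> g1 \<and>
           regular_mono C y' \<and> f = y' \<cdot> f' \<and> g = y' \<cdot> g' \<longrightarrow>
           (\<exists>!\<phi>. iso_between C (Cod C f1) (Cod C f') \<phi> \<and>
              \<phi> \<cdot> f1 = f' \<and> \<phi> \<cdot> g1 = g' \<and> y' \<cdot> \<phi> = y))"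
    using S(1)[unfolded is_multi_sum_def, THEN conjunct2, THEN spec[of _ f], THEN spec[of _ g],
      THEN mp, OF r', THEN conjunct2] .
  then obtain \<phi> where \<phi>: "iso_between C (Cod C f2) (Cod C f) \<phi>" "Id C (Cod C f) \<cdot> \<phi> = y \<cdot> z"
    using z(1) S(2) yz i by blast
  then have "iso_between C (Cod C f2) (Cod C f) (y \<cdot> z)"
    using iso_between_hom[OF \<phi>(1)] by (auto simp: hom_def)
  then obtain k where k: "k \<in> hom C (Cod C f) (Cod C f2)" "y \<cdot> z \<cdot> k = Id C (Cod C f)"
    by (metis iso_betweenE)
  have "u = v" if uv: "u \<in> hom C (Cod C f) W" "v \<in> hom C (Cod C f) W" "u \<cdot> f = v \<cdot> f" "u \<cdot> g = v \<cdot> g" for W u v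
  proof -
    have "u \<cdot> y \<cdot> f1 = v \<cdot> y \<cdot> f1" "u \<cdot> y \<cdot> g1 = v \<cdot> y \<cdot> g1" "u \<cdot> y \<in> hom C (Cod C f1) W" "v \<cdot> y \<in> hom C (Cod C f1) W"
      using uv T f1(6,7) by (auto simp: hom_def)
    then have "u \<cdot> y = v \<cdot> y"
      using f1(3) unfolding jointly_epi_def by blast
    then have "u \<cdot> (y \<cdot> (z \<cdot> k)) = v \<cdot> (y \<cdot> (z \<cdot> k))"
      using T k uv comp_cancel[of u y "v \<cdot> y" "z \<cdot> k"] by (auto simp: hom_def)
    then show ?thesis
      using uv k T by (auto simp: hom_def)
  qed
  then have "jointly_epi C f g"
    unfolding jointly_epi_def using h r by (auto simp: hom_def)
  then show "regular_mono C f \<and> regular_mono C g \<and> Dom C f = A \<and> Dom C g = B \<and> jointly_epi C f g"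
    using r by blast
next
  assume "regular_mono C f \<and> regular_mono C g \<and> Dom C f = A \<and> Dom C g = B \<and> jointly_epi C f g"
  then show "(f, g) \<in> Msum C A B"
    using jointly_epi_multi_sum[of A B] unfolding Msum_def by blast
qed

end

section \<open>Direct derivations\<close>

context category
begin

lemma pullback_iso_leg:
  assumes pb: "is_pullback C f (g \<cdot> k) p q" and k: "iso_between C Y Y' k" and g: "g \<in> hom C Y' Z"
  shows "is_pullback C f g p (k \<cdot> q)"
proof -
  obtain k' where k': "k \<in> hom C Y Y'" "k' \<in> hom C Y' Y" "k \<cdot> k' = Id C Y'" "iso_between C Y' Y k'"
    "k' \<cdot> k = Id C Y"
    using iso_betweenE[OF k] by metis
  obtain X P where 1: "f \<in> hom C X Z" "p \<in> hom C P X" "q \<in> hom C P Y"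
    using pullbackE[OF pb] Comp_hom[OF k'(1) g] by (metis homD(2,3))
  note T = 1(1-3)[THEN hom_conj] k'(1,2)[THEN hom_conj]
    g[THEN hom_conj]
  have Ob: "P \<in> Ob C" "Y \<in> Ob C" "Y' \<in> Ob C" using 1 k' hom_Ob by blast+
  have "k' \<cdot> (k \<cdot> q) = q"
    using T k'(5)[THEN comp_cancel] by simp
  then have "is_pullback C k' q (k \<cdot> q) (Id C P)"
    using pullback_mono_self[OF iso_monic[OF k'(4)] k'(2), of "k \<cdot> q" P] T by (simp add: hom_def)
  from pullback_paste[OF pullback_sym[OF pb] this]
  have "is_pullback C g f (k \<cdot> q) p"
    using T Ob k'(3) by simp
  then show ?thesis by (rule pullback_sym)
qed

lemma pushout_iso_leg:
  assumes "is_pushout C f (k \<cdot> g) p q" "iso_between C Y Y' k" "g \<in> hom C Z Y"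
  shows "is_pushout C f g p (q \<cdot> k)"
  using category.pullback_iso_leg[OF opposite_category, of f g k p q Y' Y Z] assms by simp

end

lemma derivation_isoD:
  assumes "derivation_iso C x k y m d m' d'"
  shows "iso_between C (Cod C m) (Cod C m') x" "iso_between C (Dom C (fpc_g d)) (Dom C (fpc_g d')) k"
    "iso_between C (result C d) (result C d') y" "x \<cdot>\<^bsub>C\<^esub> m = m'" "k \<cdot>\<^bsub>C\<^esub> fpc_n d = fpc_n d'"
    "x \<cdot>\<^bsub>C\<^esub> fpc_g d = fpc_g d' \<cdot>\<^bsub>C\<^esub> k" "y \<cdot>\<^bsub>C\<^esub> comatch d = comatch d'"
    "y \<cdot>\<^bsub>C\<^esub> po_x d = po_x d' \<cdot>\<^bsub>C\<^esub> k"
  using assms unfolding derivation_iso_def by blast+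

context quasi_topos
begin

lemma derivationE:
  assumes "sqpo_derivation C r X m d" "out_leg r \<in> hom C K O'" "in_leg r \<in> hom C K I"
  obtains F Y where "regular_mono C m" "m \<in> hom C I X" "fpc_n d \<in> hom C K F" "fpc_g d \<in> hom C F X"
    "comatch d \<in> hom C O' Y" "po_x d \<in> hom C F Y" "m \<cdot> in_leg r = fpc_g d \<cdot> fpc_n d"
    "comatch d \<cdot> out_leg r = po_x d \<cdot> fpc_n d"
    "is_fpc C (in_leg r) m (fpc_n d) (fpc_g d)" "is_pushout C (out_leg r) (fpc_n d) (comatch d) (po_x d)"
    "result C d = Y" "Dom C (fpc_g d) = F" "Cod C m = X"
proof -
  have m: "regular_mono C m" "m \<in> hom C I X" and fpc: "is_fpc C (in_leg r) m (fpc_n d) (fpc_g d)"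
    and po: "is_pushout C (out_leg r) (fpc_n d) (comatch d) (po_x d)"
    using assms unfolding sqpo_derivation_def sqpo_match_def by (auto simp: hom_def)
  obtain F where 1: "fpc_n d \<in> hom C K F" "fpc_g d \<in> hom C F X" "m \<cdot> in_leg r = fpc_g d \<cdot> fpc_n d"
    using fpcE[OF fpc] m(2) assms(3) by (metis homD(2,3))
  have "comatch d \<in> hom C O' (result C d)" "po_x d \<in> hom C F (result C d)"
    "comatch d \<cdot> out_leg r = po_x d \<cdot> fpc_n d"
    using pushout_hom[OF po assms(2) 1(1)] by (simp_all add: result_def)
  then show ?thesis
    using that[OF m 1(1,2) _ _ 1(3) _ fpc po] 1 m by (metis homD(2,3))
qed

lemma derivation_exists:
  assumes m: "sqpo_match C r X m" and r: "is_rule C r"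
  obtains d where "sqpo_derivation C r X m d"
proof -
  have rm: "regular_mono C m" "m \<in> hom C (Cod C (in_leg r)) X"
    using m by (auto simp: sqpo_match_def)
  have i: "in_leg r \<in> hom C (Dom C (in_leg r)) (Cod C (in_leg r))"
    and o': "out_leg r \<in> hom C (Dom C (in_leg r)) (Cod C (out_leg r))"
    using r by (auto simp: is_rule_def hom_def)
  obtain F n g where n: "n \<in> hom C (Dom C (in_leg r)) F" and fpc: "is_fpc C (in_leg r) m n g"
    using fpc_of[OF rm i] by metis
  obtain p q where "is_pushout C (out_leg r) n p q"
    using pushout_of[OF o' n] by metis
  then have "sqpo_derivation C r X m \<lparr>fpc_n = n, fpc_g = g, comatch = p, po_x = q\<rparr>"
    using m fpc by (simp add: sqpo_derivation_def)
  then show ?thesis using that by blast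
qed

text \<open>An arbitrary isomorphism \<open>x\<close> of host objects is allowed because the second
  of two consecutive derivations is compared over an isomorphism between the results of the first
  ones.\<close>

lemma derivation_unique:
  assumes r: "is_rule C r" and d: "sqpo_derivation C r X m d" and d': "sqpo_derivation C r X' m' d'"
    and x: "iso_between C X X' x" and xm: "x \<cdot> m = m'"
  obtains k y where "derivation_iso C x k y m d m' d'"
proof -
  have i: "in_leg r \<in> hom C (Dom C (in_leg r)) (Cod C (in_leg r))"
    and o': "out_leg r \<in> hom C (Dom C (in_leg r)) (Cod C (out_leg r))"
    using r by (auto simp: is_rule_def hom_def)
  obtain F Y where 1: "m \<in> hom C (Cod C (in_leg r)) X" "fpc_n d \<in> hom C (Dom C (in_leg r)) F"
    "fpc_g d \<in> hom C F X" "comatch d \<in> hom C (Cod C (out_leg r)) Y" "po_x d \<in> hom C F Y"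
    "is_fpc C (in_leg r) m (fpc_n d) (fpc_g d)" "is_pushout C (out_leg r) (fpc_n d) (comatch d) (po_x d)"
    "result C d = Y" "Dom C (fpc_g d) = F" "Cod C m = X"
    using derivationE[OF d o' i] by metis
  obtain F' Y' where 2: "m' \<in> hom C (Cod C (in_leg r)) X'" "fpc_n d' \<in> hom C (Dom C (in_leg r)) F'"
    "fpc_g d' \<in> hom C F' X'" "comatch d' \<in> hom C (Cod C (out_leg r)) Y'" "po_x d' \<in> hom C F' Y'"
    "is_fpc C (in_leg r) m' (fpc_n d') (fpc_g d')" "is_pushout C (out_leg r) (fpc_n d') (comatch d') (po_x d')"
    "result C d' = Y'" "Dom C (fpc_g d') = F'" "Cod C m' = X'"
    using derivationE[OF d' o' i] by metis
  have "is_fpc C (in_leg r) m' (fpc_n d) (x \<cdot> fpc_g d)"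
    using fpc_iso_cod[OF 1(6), of X' x] x xm 1 by simp
  from fpc_iso[OF this 2(6)] obtain k where
    "iso_between C (Dom C (x \<cdot> fpc_g d)) (Dom C (fpc_g d')) k" "k \<cdot> fpc_n d = fpc_n d'"
    "fpc_g d' \<cdot> k = x \<cdot> fpc_g d" .
  moreover have "Dom C (x \<cdot> fpc_g d) = F"
    using 1 iso_between_hom[OF x] by (auto simp: hom_def)
  ultimately have k: "iso_between C F F' k" "k \<cdot> fpc_n d = fpc_n d'" "fpc_g d' \<cdot> k = x \<cdot> fpc_g d"
    using 2 by simp_all
  have "is_pushout C (out_leg r) (fpc_n d) (comatch d') (po_x d' \<cdot> k)"
    using pushout_iso_leg[of "out_leg r" k "fpc_n d" "comatch d'" "po_x d'"] 2(7) k 1(2) by simp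
  then obtain y where "iso_between C (Cod C (comatch d)) (Cod C (comatch d')) y"
    "y \<cdot> comatch d = comatch d'" "y \<cdot> po_x d = po_x d' \<cdot> k"
    using pushout_iso[OF 1(7)] by metis
  then have "derivation_iso C x k y m d m' d'"
    unfolding derivation_iso_def using 1 2 x k xm by (simp add: result_def)
  then show ?thesis using that by blast
qed

lemma derivation_result_unique:
  assumes "is_rule C r" "sqpo_derivation C r X m d" "sqpo_derivation C r X m d'"
  shows "isomorphic C (result C d) (result C d')"
proof -
  have m: "m \<in> hom C (Cod C (in_leg r)) X"
    using assms(2) by (auto simp: sqpo_derivation_def sqpo_match_def)
  then have "iso_between C X X (Id C X)" "Id C X \<cdot> m = m"
    using iso_between_id[OF hom_Ob(2)[OF m]] by (auto simp: hom_def)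
  then show ?thesis
    using derivation_unique[OF assms] derivation_isoD(3) by (metis isomorphic_def)
qed

text \<open>The pushout of the first derivation is pulled back along \<open>x1'\<close>, the final pullback
  complement of the second one along \<open>x1\<close>.\<close>

lemma span_composition:
  assumes m: "regular_mono C m" "m \<in> hom C I X0"
    and s1: "a1 \<in> hom C K1 J" "b1 \<in> hom C K1 I" and s2: "a2 \<in> hom C K2 O2" "b2 \<in> hom C K2 J"
    and fpc1: "is_fpc C b1 m n1 x0" and po1: "is_pushout C a1 n1 y x1"
    and fpc2: "is_fpc C b2 y n2 x1'" and po2: "is_pushout C a2 n2 w x2"
    and pb: "is_pullback C b2 a1 p q"
  obtains n g px where "is_fpc C (b1 \<cdot> q) m n g" "is_pushout C (a2 \<cdot> p) n w px"
proof -
  obtain F1 where 1: "n1 \<in> hom C K1 F1" "x0 \<in> hom C F1 X0" and pb1: "is_pullback C m x0 b1 n1"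
    using fpcE[OF fpc1] s1(2) m(2) by (metis homD(2,3))
  obtain X1 where 2: "y \<in> hom C J X1" "x1 \<in> hom C F1 X1" "y \<cdot> a1 = x1 \<cdot> n1"
    using pushout_hom[OF po1 s1(1) 1(1)] by metis
  obtain F2 where 3: "n2 \<in> hom C K2 F2" "x1' \<in> hom C F2 X1" "y \<cdot> b2 = x1' \<cdot> n2"
    and pb2: "is_pullback C y x1' b2 n2"
    using fpcE[OF fpc2] s2(2) 2(1) by (metis homD(2,3))
  obtain P where 4: "p \<in> hom C P K2" "q \<in> hom C P K1" "b2 \<cdot> p = a1 \<cdot> q"
    using pullback_hom[OF pb s2(2) s1(1)] by metis
  \<comment> \<open>\<open>E\<close> is the context of the composed derivation: the part of the
    first context that survives the second step.\<close>
  obtain E s t where st: "s \<in> hom C E F2" "t \<in> hom C E F1" and pbE: "is_pullback C x1' x1 s t"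
    using pullback_of[OF 3(2) 2(2)] .
  note T = s1[THEN hom_conj] s2[THEN hom_conj]
    1(1,2)[THEN hom_conj] 2(1,2)[THEN hom_conj]
    3(1,2)[THEN hom_conj] 4(1,2)[THEN hom_conj]
    st[THEN hom_conj]
  have Ob: "P \<in> Ob C" using 4 hom_Ob by blast
  have "x1' \<cdot> (n2 \<cdot> p) = x1 \<cdot> (n1 \<cdot> q)"
    using T 2(3)[symmetric, THEN comp_cancel] 3(3)[symmetric, THEN comp_cancel] 4(3) by simp
  then obtain n where n: "n \<in> hom C P E" "s \<cdot> n = n2 \<cdot> p" "t \<cdot> n = n1 \<cdot> q"
    using pullback_ex[OF pbE st, of "n2 \<cdot> p" P "n1 \<cdot> q"] T by (auto simp: hom_def)
  have n': "n \<in> hom C (Dom C p) (Dom C s)" "n \<in> hom C (Dom C q) (Dom C t)" "p \<in> hom C (Dom C q) (Dom C b2)"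
    using n T by (auto simp: hom_def)
  \<comment> \<open>The match is a regular mono, hence so is \<open>n1\<close>, and the pushout of
    the first derivation is also a pullback. This supplies the square along which the second
    complement is pulled back.\<close>
  have pbA: "is_pullback C y x1 a1 n1"
    using pushout_regular_mono(2)[OF po1 regular_mono_fpc[OF fpc1 m(1)]] .
  have "is_fpc C q n1 n t"
    using fpc_pullback[OF fpc2 2(2) pbA pbE pb n'(1) n(2,3)] .
  then have fpc: "is_fpc C (b1 \<cdot> q) m n (x0 \<cdot> t)"
    using fpc_horizontal[OF fpc1] by blast
  have "is_pullback C (y \<cdot> a1) x1' q (n2 \<cdot> p)"
    using pullback_paste[OF pb2 pullback_sym[OF pb]] .
  then have "is_pushout C p n n2 s"
    using pushout_stable[OF finite_limits lcc po1 3(2) pb2 pullback_sym[OF pbE] _ n'(3) 4(3) refl n'(2) n(3,2)]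
    by blast
  from pushout_paste[OF this po2]
  show ?thesis using that[OF fpc] by blast
qed

section \<open>Pairs of consecutive derivations and matches of composite rules\<close>


text \<open>The pullback condition of an FPC-augmentation. The pullback \<open>T\<close> of \<open>s\<close> and \<open>m\<close> is, by
  stability, a pushout of \<open>f\<close> along an identity, hence a copy of \<open>I1\<close>.\<close>

lemma pushout_mediator_pullback:
  assumes m: "monic C m" "m \<in> hom C I1 X0" and pb: "is_pullback C m x0 f (l \<cdot> k)"
    and f: "f \<in> hom C K1 I1" and k: "k \<in> hom C K1 K" and l: "monic C l" "l \<in> hom C K F"
    and po: "is_pushout C f k p q" and s: "s \<in> hom C (Cod C p) X0" "s \<cdot> p = m" "s \<cdot> q = x0 \<cdot> l"
  shows "is_pullback C s m p (Id C I1)"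
proof -
  obtain D where D: "p \<in> hom C I1 D" "q \<in> hom C K D" "p \<cdot> f = q \<cdot> k"
    using pushout_hom[OF po f k] by metis
  have s': "s \<in> hom C D X0" using s D by (simp add: hom_def)
  have lk: "l \<cdot> k \<in> hom C K1 F" using Comp_hom k l by blast
  have x0: "x0 \<in> hom C F X0"
    using pullbackE[OF pb] lk m(2) by (metis homD(3))
  obtain T \<tau> \<sigma> where \<tau>: "\<tau> \<in> hom C T D" "\<sigma> \<in> hom C T I1" and pbT: "is_pullback C s m \<tau> \<sigma>"
    using pullback_of[OF s' m(2)] .
  have Ob: "I1 \<in> Ob C" "K1 \<in> Ob C" using f hom_Ob by blast+
  note T = m(2)[THEN hom_conj] f[THEN hom_conj] k[THEN hom_conj]
    l(2)[THEN hom_conj] D(1,2)[THEN hom_conj] s'[THEN hom_conj]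
    x0[THEN hom_conj] \<tau>[THEN hom_conj]
  \<comment> \<open>\<open>\<theta>\<close> is the comparison of \<open>I1\<close> with the pullback
    \<open>T\<close>; the rest of the proof shows that it is invertible.\<close>
  obtain \<theta> where \<theta>: "\<theta> \<in> hom C I1 T" "\<tau> \<cdot> \<theta> = p" "\<sigma> \<cdot> \<theta> = Id C I1"
    using pullback_ex[OF pbT \<tau> D(1) Id_hom[OF Ob(1)]] s(2) T by auto
  note T' = \<theta>(1)[THEN hom_conj]
  have "is_pullback C (s \<cdot> p) m (Id C I1) (Id C I1)"
    using pullback_mono_self[OF m Id_hom[OF Ob(1)]] s(2) T by simp
  then have pbB: "is_pullback C p \<tau> (Id C I1) \<theta>"
    using T T' Ob \<theta>(2,3) by (intro pullback_unpaste[OF pbT _ D(1) s']) (auto simp: hom_def)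
  \<comment> \<open>The part of \<open>K\<close> lying over the match is exactly \<open>K1\<close>:
    since \<open>l\<close> is monic, the pullback of \<open>m\<close> and \<open>x0\<close> can be
    restricted along it.\<close>
  have "is_pullback C (x0 \<cdot> l) m k (f \<cdot> Id C K1)"
    using pullback_paste[OF pullback_sym[OF pb] pullback_mono_self[OF l k]] .
  then have "is_pullback C (s \<cdot> q) m k f"
    using T Ob s(3) by simp
  then have pbC: "is_pullback C q \<tau> k (\<theta> \<cdot> f)"
    using T T' Ob \<theta>(2,3)[THEN comp_cancel] D(3)
    by (intro pullback_unpaste[OF pbT _ D(2) s']) (auto simp: hom_def)
  have "s \<cdot> (p \<cdot> f) = m \<cdot> f"
    using T s(2)[THEN comp_cancel] by simp
  then have "is_pullback C (s \<cdot> (p \<cdot> f)) m (Id C K1) f"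
    using pullback_sym[OF pullback_mono_self[OF m f]] by simp
  then have pbA: "is_pullback C (p \<cdot> f) \<tau> (Id C K1) (\<theta> \<cdot> f)"
    using T T' Ob \<theta>(2,3)[THEN comp_cancel]
    by (intro pullback_unpaste[OF pbT _ Comp_hom[OF f D(1)] s']) (auto simp: hom_def)
  have "is_pushout C f (Id C K1) \<theta> (\<theta> \<cdot> f)"
    using T T' Ob
    by (intro pushout_stable[OF finite_limits lcc po \<tau>(1) pbB pbC pbA]) (auto simp: hom_def)
  then obtain \<phi> where \<phi>: "iso_between C (Cod C (Id C I1)) (Cod C \<theta>) \<phi>" "\<phi> \<cdot> Id C I1 = \<theta>"
    using pushout_iso[OF pushout_id[OF f]] by blast
  then have "\<phi> = \<theta>"
    using iso_between_hom[OF \<phi>(1)] Ob by (simp add: hom_def)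
  then have "iso_between C I1 (Dom C \<tau>) \<theta>"
    using \<phi>(1) T T' Ob by simp
  from pullback_iso_apex[OF pbT this] show ?thesis
    using \<theta> by simp
qed

end

section \<open>Rule matches and composite rules\<close>

locale rewriting = quasi_topos C for C :: "('o, 'a) cat" (structure) +
  fixes r1 r2 :: "'a rewrite_rule" and X0 :: 'o and K1 O1 I1 K2 O2 I2 :: 'o
  assumes r1: "out_leg r1 \<in> hom C K1 O1" "in_leg r1 \<in> hom C K1 I1"
    and r2: "out_leg r2 \<in> hom C K2 O2" "in_leg r2 \<in> hom C K2 I2"
begin

lemma rules: "is_rule C r1" "is_rule C r2"
  using r1 r2 by (auto simp: is_rule_def hom_def)

lemma rule_matchE:
  assumes "sqpo_rule_match C r2 r1 \<mu>"
  obtains J K I KK II where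
    "j2 \<mu> \<in> hom C I2 J" "j1 \<mu> \<in> hom C O1 J" "kj \<mu> \<in> hom C K1 K" "ko \<mu> \<in> hom C K J"
    "pI \<mu> \<in> hom C I1 I" "pK \<mu> \<in> hom C K I" "kkj \<mu> \<in> hom C K KK" "kki \<mu> \<in> hom C KK II" "iota \<mu> \<in> hom C I II"
    "regular_mono C (j2 \<mu>)" "regular_mono C (j1 \<mu>)" "regular_mono C (kj \<mu>)" "regular_mono C (kkj \<mu>)"
    "regular_mono C (iota \<mu> \<cdot> pI \<mu>)" "jointly_epi C (j2 \<mu>) (j1 \<mu>)" "epi C (iota \<mu>)"
    "is_pushout C (out_leg r1) (kj \<mu>) (j1 \<mu>) (ko \<mu>)" "is_pushout C (in_leg r1) (kj \<mu>) (pI \<mu>) (pK \<mu>)"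
    "is_fpc C (in_leg r1) (iota \<mu> \<cdot> pI \<mu>) (kkj \<mu> \<cdot> kj \<mu>) (kki \<mu>)" "kki \<mu> \<cdot> kkj \<mu> = iota \<mu> \<cdot> pK \<mu>"
    "j1 \<mu> \<cdot> out_leg r1 = ko \<mu> \<cdot> kj \<mu>" "pI \<mu> \<cdot> in_leg r1 = pK \<mu> \<cdot> kj \<mu>"
proof -
  note T = r1[THEN hom_conj] r2[THEN hom_conj]
  have 1: "regular_mono C (j2 \<mu>)" "regular_mono C (j1 \<mu>)" "jointly_epi C (j2 \<mu>) (j1 \<mu>)"
    "Dom C (j2 \<mu>) = I2" "Dom C (j1 \<mu>) = O1"
    using assms Msum_iff T unfolding sqpo_rule_match_def by metis+
  have 2: "regular_mono C (kj \<mu>)" "is_pushout C (out_leg r1) (kj \<mu>) (j1 \<mu>) (ko \<mu>)"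
    "is_pushout C (in_leg r1) (kj \<mu>) (pI \<mu>) (pK \<mu>)"
    using assms unfolding sqpo_rule_match_def mPOC_def by blast+
  have 3: "epi C (iota \<mu>)" "Dom C (iota \<mu>) = Cod C (pI \<mu>)" "regular_mono C (iota \<mu> \<cdot> pI \<mu>)"
    "kkj \<mu> \<in> hom C (Cod C (kj \<mu>)) (Dom C (kki \<mu>))"
    "is_fpc C (in_leg r1) (iota \<mu> \<cdot> pI \<mu>) (kkj \<mu> \<cdot> kj \<mu>) (kki \<mu>)"
    "kki \<mu> \<cdot> kkj \<mu> = iota \<mu> \<cdot> pK \<mu>" "regular_mono C (kkj \<mu>)"
    using assms unfolding sqpo_rule_match_def FPA_def by blast+
  have j: "j2 \<mu> \<in> hom C I2 (Cod C (j2 \<mu>))" "j1 \<mu> \<in> hom C O1 (Cod C (j2 \<mu>))"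
    using jointly_epi_hom[OF 1(3)] 1(4,5) by simp_all
  have kj: "kj \<mu> \<in> hom C K1 (Cod C (kj \<mu>))" "ko \<mu> \<in> hom C (Cod C (kj \<mu>)) (Cod C (j2 \<mu>))"
    "j1 \<mu> \<cdot> out_leg r1 = ko \<mu> \<cdot> kj \<mu>"
    using 2(2) T j unfolding is_pushout_def by (auto simp: hom_def)
  have p: "pI \<mu> \<in> hom C I1 (Cod C (pI \<mu>))" "pK \<mu> \<in> hom C (Cod C (kj \<mu>)) (Cod C (pI \<mu>))"
    "pI \<mu> \<cdot> in_leg r1 = pK \<mu> \<cdot> kj \<mu>"
    using pushout_hom[OF 2(3) r1(2) kj(1)] by metis+
  have i: "iota \<mu> \<in> hom C (Cod C (pI \<mu>)) (Cod C (iota \<mu>))"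
    using 3(1,2) by (simp add: epi_def hom_def)
  have "iota \<mu> \<cdot> pI \<mu> \<in> hom C I1 (Cod C (iota \<mu>))"
    using Comp_hom p(1) i by blast
  then have k: "kki \<mu> \<in> hom C (Dom C (kki \<mu>)) (Cod C (iota \<mu>))"
    using fpcE[OF 3(5)] by (metis homD(2,3))
  show ?thesis
    by (rule that[OF j kj(1,2) p(1,2) 3(4) k i]) (use 1 2 3 kj p in blast)+
qed

lemma composite_exists:
  assumes "sqpo_rule_match C r2 r1 \<mu>"
  obtains r21 where "sqpo_composite C r2 r1 \<mu> r21"
proof -
  obtain J K KK where M: "j2 \<mu> \<in> hom C I2 J" "ko \<mu> \<in> hom C K J" "kkj \<mu> \<in> hom C K KK"
    "regular_mono C (j2 \<mu>)" "regular_mono C (kkj \<mu>)"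
    using rule_matchE[OF assms] by metis
  obtain F2 n2 g2 where 1: "n2 \<in> hom C K2 F2" "g2 \<in> hom C F2 J" "is_fpc C (in_leg r2) (j2 \<mu>) n2 g2"
    using fpc_of[OF M(4,1) r2(2)] .
  obtain O21 u v where 2: "v \<in> hom C F2 O21" "is_pushout C (out_leg r2) n2 u v"
    using pushout_of[OF r2(1) 1(1)] by metis
  obtain J' jj kk where 3: "jj \<in> hom C J J'" "kk \<in> hom C KK J'" "is_pushout C (ko \<mu>) (kkj \<mu>) jj kk"
    using pushout_of[OF M(2,3)] .
  have jj: "regular_mono C jj" using pushout_regular_mono(1)[OF 3(3) M(5)] .
  obtain KK2 nn2 gg2 where 4: "nn2 \<in> hom C F2 KK2" "gg2 \<in> hom C KK2 J'" "is_fpc C g2 jj nn2 gg2"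
    using fpc_of[OF jj 3(1) 1(2)] .
  obtain w z where 5: "is_pushout C v nn2 w z"
    using pushout_of[OF 2(1) 4(1)] by metis
  obtain p q where 6: "is_pullback C gg2 kk p q"
    using pullback_of[OF 4(2) 3(2)] by metis
  have "sqpo_composite C r2 r1 \<mu> \<lparr>out_leg = z \<cdot> p, in_leg = kki \<mu> \<cdot> q\<rparr>"
    unfolding sqpo_composite_def using 1(3) 2(2) 3(3) 4(3) 5 6 by blast
  then show ?thesis using that by blast
qed

lemma compositeE:
  assumes "sqpo_rule_match C r2 r1 \<mu>" "sqpo_composite C r2 r1 \<mu> r21"
  shows "is_rule C r21" "Cod C (in_leg r21) = Cod C (kki \<mu>)"
proof -
  obtain J K KK II where M: "ko \<mu> \<in> hom C K J" "kkj \<mu> \<in> hom C K KK" "kki \<mu> \<in> hom C KK II"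
    using rule_matchE[OF assms(1)] by metis
  obtain n2 g2 u v jj kk nn2 gg2 w z p q where S: "is_pushout C (ko \<mu>) (kkj \<mu>) jj kk"
    "is_fpc C g2 jj nn2 gg2" "is_pushout C v nn2 w z" "is_pullback C gg2 kk p q"
    "r21 = \<lparr>out_leg = z \<cdot> p, in_leg = kki \<mu> \<cdot> q\<rparr>"
    using assms(2) unfolding sqpo_composite_def by blast
  obtain KK2 J' where 1: "nn2 \<in> hom C (Dom C nn2) KK2" "gg2 \<in> hom C KK2 J'"
    using fpcE[OF S(2)] by (metis homD(2))
  have kk: "kk \<in> hom C KK (Cod C jj)" using pushout_hom(3)[OF S(1) M(1,2)] .
  have pq: "p \<in> hom C (Dom C p) KK2" "q \<in> hom C (Dom C p) KK"
    using pullback_hom[OF S(4) 1(2) kk] by blast+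
  have z: "z \<in> hom C KK2 (Cod C w)"
    using pushoutE[OF S(3)] 1(1) by (metis homD(3))
  show "is_rule C r21" "Cod C (in_leg r21) = Cod C (kki \<mu>)"
    using M(3) pq z S(5) by (auto simp: is_rule_def hom_def)
qed

text \<open>All composites along \<open>\<mu>\<close> have the codomain of \<open>kki \<mu>\<close>
  as input object, whatever intermediate constructions are chosen, and at least one composite
  exists; so the quantifier over \<open>r21\<close> disappears.\<close>

lemma composite_matches_iff:
  "(\<mu>, m) \<in> composite_matches C r2 r1 X0 \<longleftrightarrow>
     sqpo_rule_match C r2 r1 \<mu> \<and> regular_mono C m \<and> m \<in> hom C (Cod C (kki \<mu>)) X0"
  unfolding composite_matches_def sqpo_match_def using compositeE(2) composite_exists
  by auto (metis compositeE(2) composite_exists)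

text \<open>\<open>y\<close> embeds the overlap \<open>J\<^sub>2\<^sub>1\<close> into \<open>X\<^sub>1\<close> and \<open>h\<close> embeds \<open>K\<^sub>1\<^sup>=\<close> into \<open>X\<^sub>0\<^sup>-\<close>.\<close>

definition compatible_via ::
  "'a \<Rightarrow> 'a \<Rightarrow> 'a \<Rightarrow> 'a derivation \<Rightarrow> 'a \<Rightarrow> 'a derivation \<Rightarrow> 'a rule_match \<Rightarrow> 'a \<Rightarrow> bool" where
  "compatible_via y h m1 d1 m2 d2 \<mu> m21 \<longleftrightarrow>
     sqpo_derivation C r1 X0 m1 d1 \<and> sqpo_derivation C r2 (result C d1) m2 d2 \<and>
     sqpo_rule_match C r2 r1 \<mu> \<and> regular_mono C m21 \<and> m21 \<in> hom C (Cod C (kki \<mu>)) X0 \<and>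
     y \<in> hom C (Cod C (j1 \<mu>)) (result C d1) \<and> h \<in> hom C (Cod C (kkj \<mu>)) (Dom C (fpc_g d1)) \<and>
     m1 = m21 \<cdot> (iota \<mu> \<cdot> pI \<mu>) \<and> y \<cdot> j2 \<mu> = m2 \<and> y \<cdot> j1 \<mu> = comatch d1 \<and>
     fpc_g d1 \<cdot> h = m21 \<cdot> kki \<mu> \<and> h \<cdot> (kkj \<mu> \<cdot> kj \<mu>) = fpc_n d1 \<and>
     po_x d1 \<cdot> (h \<cdot> kkj \<mu>) = y \<cdot> ko \<mu>"

section \<open>Synthesis and analysis\<close>

text \<open>Each part of \<open>\<mu>\<close> is cut out of the given derivations: \<open>K\<close>
  is the part of the context lying over the overlap \<open>J\<close>, and \<open>KK\<close> the part
  lying over the image \<open>II\<close> in \<open>X0\<close>. The universal properties required of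
  \<open>\<mu>\<close> then come from those of \<open>d1\<close>, for the pushout by stability and
  for the complement by \<open>fpc_restrict\<close>.\<close>

lemma synthesis:
  assumes d1: "sqpo_derivation C r1 X0 m1 d1" and d2: "sqpo_derivation C r2 (result C d1) m2 d2"
  obtains \<mu> m21 y h where "compatible_via y h m1 d1 m2 d2 \<mu> m21"
proof -
  define n1 x0 cm x1 where "n1 = fpc_n d1" "x0 = fpc_g d1" "cm = comatch d1" "x1 = po_x d1"
  note defs = this
  obtain F X1 where D: "regular_mono C m1" "m1 \<in> hom C I1 X0" "n1 \<in> hom C K1 F" "x0 \<in> hom C F X0"
    "cm \<in> hom C O1 X1" "x1 \<in> hom C F X1" "m1 \<cdot> in_leg r1 = x0 \<cdot> n1" "cm \<cdot> out_leg r1 = x1 \<cdot> n1"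
    and fpc1: "is_fpc C (in_leg r1) m1 n1 x0" and po1: "is_pushout C (out_leg r1) n1 cm x1"
    and res: "result C d1 = X1" "Dom C x0 = F"
    using derivationE[OF d1 r1] unfolding defs by metis
  have m2: "regular_mono C m2" "m2 \<in> hom C I2 X1"
    using derivationE[OF d2 r2] res by metis+
  have n1: "regular_mono C n1" using regular_mono_fpc[OF fpc1 D(1)] .
  have cm: "regular_mono C cm" using pushout_regular_mono(1)[OF po1 n1] .
  obtain J j2' j1' y where J: "j2' \<in> hom C I2 J" "j1' \<in> hom C O1 J" "jointly_epi C j2' j1'"
    "y \<in> hom C J X1" "regular_mono C y" "y \<cdot> j2' = m2" "y \<cdot> j1' = cm"
    using jointly_epi_factorization[OF m2(2) D(5)] .
  note ym = regular_monic[OF J(5)]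
  have rj: "regular_mono C j2'" "regular_mono C j1'"
    using regular_mono_cancel_monic[OF _ ym _ J(4)] J m2 cm by metis+
  obtain K ko' l where K: "ko' \<in> hom C K J" "l \<in> hom C K F" and pbK: "is_pullback C y x1 ko' l"
    using pullback_of[OF J(4) D(6)] .
  have l: "regular_mono C l" using regular_mono_pullback[OF pullback_sym[OF pbK] J(5)] .
  note T = r1[THEN hom_conj] r2[THEN hom_conj]
    D(2-6)[THEN hom_conj] J(1,2,4)[THEN hom_conj]
    K[THEN hom_conj]
  have Ob: "K1 \<in> Ob C" "O1 \<in> Ob C" using r1 hom_Ob by blast+
  have "y \<cdot> (j1' \<cdot> out_leg r1) = x1 \<cdot> n1"
    using T J(7)[THEN comp_cancel] D(8) by simp
  then obtain kj' where kj': "kj' \<in> hom C K1 K" "ko' \<cdot> kj' = j1' \<cdot> out_leg r1" "l \<cdot> kj' = n1"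
    using pullback_ex[OF pbK K Comp_hom[OF r1(1) J(2)] D(3)] by metis
  have rkj: "regular_mono C kj'"
    using regular_mono_cancel_monic[OF _ regular_monic[OF l] kj'(1) K(2)] kj'(3) n1 by simp
  note T' = kj'(1)[THEN hom_conj]
  \<comment> \<open>The pushout of \<open>d1\<close> is restricted along \<open>y\<close>. Over
    \<open>O1\<close> and \<open>K1\<close> nothing is lost, because the comatch already factors
    through \<open>y\<close>.\<close>
  have poJ: "is_pushout C (out_leg r1) kj' j1' ko'"
  proof (rule pushout_stable[OF finite_limits lcc po1 J(4) _ pullback_sym[OF pbK], of "Id C O1" j1'
        "Id C K1" "j1' \<cdot> out_leg r1"])
    show "is_pullback C cm y (Id C O1) j1'"
      using pullback_sym[OF pullback_mono_self[OF ym J(4,2)]] J(7) by simp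
    show "is_pullback C (cm \<cdot> out_leg r1) y (Id C K1) (j1' \<cdot> out_leg r1)"
      using pullback_sym[OF pullback_mono_self[OF ym J(4) Comp_hom[OF r1(1) J(2)]]] J(7)[THEN comp_cancel] T
      by simp
  qed (use T T' Ob kj' in \<open>auto simp: hom_def\<close>)
  obtain I pI' pK' where I: "pI' \<in> hom C I1 I" "pK' \<in> hom C K I" and poI: "is_pushout C (in_leg r1) kj' pI' pK'"
    using pushout_of[OF r1(2) kj'(1)] .
  have "m1 \<cdot> in_leg r1 = x0 \<cdot> l \<cdot> kj'"
    using T T' D(7) kj'(3) by simp
  then obtain s where s: "s \<in> hom C I X0" "s \<cdot> pI' = m1" "s \<cdot> pK' = x0 \<cdot> l"
    using pushout_ex[OF poI I D(2) Comp_hom[OF K(2) D(4)]] by metis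
  \<comment> \<open>\<open>s\<close> glues the match to the context part \<open>K\<close>. It may
    fail to be monic where \<open>in_leg r1\<close> clones, which is why \<open>II\<close> is its
    image and not \<open>I\<close> itself.\<close>
  obtain II \<iota> m21 where II: "\<iota> \<in> hom C I II" "m21 \<in> hom C II X0" "epi C \<iota>" "regular_mono C m21" "m21 \<cdot> \<iota> = s"
    using regular_image[OF s(1)] .
  note mm = regular_monic[OF II(4)]
  obtain KK kki' h where KK: "kki' \<in> hom C KK II" "h \<in> hom C KK F" and pbKK: "is_pullback C m21 x0 kki' h"
    using pullback_of[OF II(2) D(4)] .
  have h: "regular_mono C h" using regular_mono_pullback[OF pullback_sym[OF pbKK] II(4)] .
  note T2 = I[THEN hom_conj] II(1,2)[THEN hom_conj]
    KK[THEN hom_conj]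
  have "m21 \<cdot> (\<iota> \<cdot> pK') = x0 \<cdot> l"
    using T T' T2 II(5)[THEN comp_cancel] s(3) by simp
  then obtain kkj' where kkj': "kkj' \<in> hom C K KK" "kki' \<cdot> kkj' = \<iota> \<cdot> pK'" "h \<cdot> kkj' = l"
    using pullback_ex[OF pbKK KK Comp_hom[OF I(2) II(1)] K(2)] by metis
  have rkkj: "regular_mono C kkj'"
    using regular_mono_cancel_monic[OF _ regular_monic[OF h] kkj'(1) KK(2)] kkj'(3) l by simp
  note T3 = kkj'(1)[THEN hom_conj]
  have ip: "\<iota> \<cdot> pI' \<in> hom C I1 II" and m1: "m21 \<cdot> (\<iota> \<cdot> pI') = m1"
    using T T2 II(5)[THEN comp_cancel] s(2) by (auto simp: hom_def)
  have rip: "regular_mono C (\<iota> \<cdot> pI')"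
    using regular_mono_cancel_monic[OF _ mm ip II(2)] m1 D(1) by simp
  have "is_pullback C m1 x0 (in_leg r1) (l \<cdot> kj')"
    using fpc1 kj'(3) by (simp add: is_fpc_def)
  then have "is_pullback C s m1 pI' (Id C I1)"
    using pushout_mediator_pullback[OF regular_monic[OF D(1)] D(2) _ r1(2) kj'(1) regular_monic[OF l] K(2) poI]
      s I by (simp add: hom_def)
  \<comment> \<open>The square over \<open>X0\<close> descends to the image \<open>II\<close>, since
    \<open>m21\<close> is monic.\<close>
  then have "is_pullback C \<iota> (\<iota> \<cdot> pI') pI' (Id C I1)"
    using pullback_mono_comp[OF mm II(2,1) ip] II(5) m1 by simp
  moreover have fpcK: "is_fpc C (in_leg r1) (\<iota> \<cdot> pI') (kkj' \<cdot> kj') kki'"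
  proof (rule fpc_restrict[OF _ mm II(2) ip pbKK])
    show "is_fpc C (in_leg r1) (m21 \<cdot> (\<iota> \<cdot> pI')) n1 x0"
      using fpc1 m1 by simp
    have "pI' \<cdot> in_leg r1 = pK' \<cdot> kj'" using poI by (simp add: is_pushout_def)
    then show "kki' \<cdot> (kkj' \<cdot> kj') = \<iota> \<cdot> pI' \<cdot> in_leg r1"
      using T T' T2 T3 kkj'(2)[THEN comp_cancel] by simp
  qed (use T T' T2 T3 kkj'(3)[THEN comp_cancel] kj'(3) in \<open>auto simp: hom_def\<close>)
  ultimately have fpa: "(kkj', kki', \<iota>) \<in> FPA C kj' (in_leg r1) pI' pK'"
    unfolding FPA_def using rkj poI II(3) T T' T2 T3 rip kkj' rkkj by (auto simp: hom_def)
  define \<mu> where "\<mu> = \<lparr>j2 = j2', j1 = j1', kj = kj', ko = ko', pI = pI', pK = pK', kkj = kkj', kki = kki', iota = \<iota>\<rparr>"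
  have \<mu>: "sqpo_rule_match C r2 r1 \<mu>"
    unfolding sqpo_rule_match_def \<mu>_def mPOC_def using Msum_iff J(3) rj rkj poJ poI fpa T by simp
  have "h \<cdot> (kkj' \<cdot> kj') = n1" "x1 \<cdot> (h \<cdot> kkj') = y \<cdot> ko'"
    using T T' T2 T3 kkj'(3) kkj'(3)[THEN comp_cancel] kj'(3) pbK by (auto simp: is_pullback_def)
  moreover have "x0 \<cdot> h = m21 \<cdot> kki'" using pbKK by (simp add: is_pullback_def)
  ultimately have "compatible_via y h m1 d1 m2 d2 \<mu> m21"
    unfolding compatible_via_def using d1 d2 \<mu> II(2,4) J(4,6,7) KK(2) m1
    by (simp add: \<mu>_def T T2 T3 res defs[symmetric])
  then show ?thesis using that by blast
qed

text \<open>The first derivation arises by pasting: the complement contained in \<open>\<mu>\<close>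
  is continued by that of \<open>kki \<mu>\<close> along \<open>m21\<close>, and \<open>X1\<close>
  is built by three successive pushouts, from \<open>O1\<close> through \<open>J\<close> and
  \<open>J'\<close>, where \<open>J'\<close> is the object at which the composite rule joins its two
  spans. The match of \<open>r2\<close> is then read off through \<open>J\<close> and
  \<open>J'\<close>.\<close>

lemma analysis:
  assumes \<mu>: "sqpo_rule_match C r2 r1 \<mu>" and m21: "regular_mono C m21" "m21 \<in> hom C (Cod C (kki \<mu>)) X0"
  obtains m1 d1 m2 d2 y h where "compatible_via y h m1 d1 m2 d2 \<mu> m21"
proof -
  obtain J K I KK II where M: "j2 \<mu> \<in> hom C I2 J" "j1 \<mu> \<in> hom C O1 J" "kj \<mu> \<in> hom C K1 K" "ko \<mu> \<in> hom C K J"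
    "pI \<mu> \<in> hom C I1 I" "pK \<mu> \<in> hom C K I" "kkj \<mu> \<in> hom C K KK" "kki \<mu> \<in> hom C KK II" "iota \<mu> \<in> hom C I II"
    and R: "regular_mono C (j2 \<mu>)" "regular_mono C (kkj \<mu>)" "regular_mono C (iota \<mu> \<cdot> pI \<mu>)"
    and po: "is_pushout C (out_leg r1) (kj \<mu>) (j1 \<mu>) (ko \<mu>)"
    and fpc: "is_fpc C (in_leg r1) (iota \<mu> \<cdot> pI \<mu>) (kkj \<mu> \<cdot> kj \<mu>) (kki \<mu>)"
    using rule_matchE[OF \<mu>] by metis
  note T = M[THEN hom_conj] r1[THEN hom_conj] r2[THEN hom_conj]
  have m21': "m21 \<in> hom C II X0" using m21 T by simp
  obtain F h x0 where h: "h \<in> hom C KK F" "x0 \<in> hom C F X0" "is_fpc C (kki \<mu>) m21 h x0"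
    using fpc_of[OF m21(1) m21' M(8)] .
  obtain J' jj kk where J': "jj \<in> hom C J J'" "kk \<in> hom C KK J'" "is_pushout C (ko \<mu>) (kkj \<mu>) jj kk"
    using pushout_of[OF M(4,7)] .
  obtain X1 y' x1 where X1: "y' \<in> hom C J' X1" "x1 \<in> hom C F X1" "is_pushout C kk h y' x1"
    using pushout_of[OF J'(2) h(1)] .
  have rh: "regular_mono C h" using regular_mono_fpc[OF h(3) m21(1)] .
  have ry: "regular_mono C y'" "regular_mono C jj"
    using pushout_regular_mono(1) X1(3) rh J'(3) R(2) by blast+
  note T' = m21'[THEN hom_conj] h(1,2)[THEN hom_conj]
    J'(1,2)[THEN hom_conj] X1(1,2)[THEN hom_conj]
  have eqs: "x0 \<cdot> h = m21 \<cdot> kki \<mu>" "jj \<cdot> ko \<mu> = kk \<cdot> kkj \<mu>" "y' \<cdot> kk = x1 \<cdot> h"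
    using h(3) J'(3) X1(3) by (simp_all add: is_fpc_def is_pullback_def is_pushout_def)
  define m1 d1 where "m1 = m21 \<cdot> (iota \<mu> \<cdot> pI \<mu>)"
    and "d1 = \<lparr>fpc_n = h \<cdot> (kkj \<mu> \<cdot> kj \<mu>), fpc_g = x0, comatch = y' \<cdot> jj \<cdot> j1 \<mu>, po_x = x1\<rparr>"
  have ip: "iota \<mu> \<cdot> pI \<mu> \<in> hom C I1 II" using T by (simp add: hom_def)
  have m1: "regular_mono C m1" "m1 \<in> hom C I1 X0"
    unfolding m1_def using regular_mono_comp[OF R(3) ip m21(1) m21'] Comp_hom[OF ip m21'] by blast+
  have "is_pushout C (ko \<mu>) (h \<cdot> kkj \<mu>) (y' \<cdot> jj) x1"
    using pushout_sym[OF pushout_paste[OF pushout_sym[OF J'(3)] pushout_sym[OF X1(3)]]] .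
  then have poX: "is_pushout C (out_leg r1) (h \<cdot> kkj \<mu> \<cdot> kj \<mu>) (y' \<cdot> jj \<cdot> j1 \<mu>) x1"
    using pushout_sym[OF pushout_paste[OF pushout_sym[OF po] pushout_sym]] by blast
  have d1: "sqpo_derivation C r1 X0 m1 d1"
    unfolding sqpo_derivation_def sqpo_match_def d1_def
    using m1 fpc_vertical[OF finite_limits fpc h(3)] poX T T' by (simp add: m1_def)
  have res: "result C d1 = X1" using T T' by (simp add: result_def d1_def)
  define m2 where "m2 = y' \<cdot> jj \<cdot> j2 \<mu>"
  have yjj: "regular_mono C (y' \<cdot> jj)" "y' \<cdot> jj \<in> hom C J X1"
    using regular_mono_comp[OF ry(2) J'(1) ry(1) X1(1)] Comp_hom[OF J'(1) X1(1)] by blast+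
  have "sqpo_match C r2 X1 m2"
    unfolding sqpo_match_def m2_def using regular_mono_comp[OF R(1) M(1) yjj] Comp_hom[OF M(1) yjj(2)] T by simp
  then obtain d2 where d2: "sqpo_derivation C r2 X1 m2 d2"
    using derivation_exists rules(2) by blast
  have "x1 \<cdot> (h \<cdot> kkj \<mu>) = y' \<cdot> jj \<cdot> ko \<mu>"
    using T T' eqs(2) eqs(3)[symmetric, THEN comp_cancel] by simp
  then have "compatible_via (y' \<cdot> jj) h m1 d1 m2 d2 \<mu> m21"
    unfolding compatible_via_def using d1 d2 \<mu> m21 res yjj(2) h(1) eqs(1) T T'
    by (simp add: m1_def d1_def m2_def)
  then show ?thesis using that by blast
qed


section \<open>Consequences of compatibility\<close>

lemma compatible_viaD:
  assumes "compatible_via y h m1 d1 m2 d2 \<mu> m21"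
  shows "sqpo_derivation C r1 X0 m1 d1" "sqpo_derivation C r2 (result C d1) m2 d2"
    "sqpo_rule_match C r2 r1 \<mu>" "regular_mono C m21" "m21 \<in> hom C (Cod C (kki \<mu>)) X0"
    "y \<in> hom C (Cod C (j1 \<mu>)) (result C d1)" "h \<in> hom C (Cod C (kkj \<mu>)) (Dom C (fpc_g d1))"
    "m1 = m21 \<cdot> (iota \<mu> \<cdot> pI \<mu>)" "y \<cdot> j2 \<mu> = m2" "y \<cdot> j1 \<mu> = comatch d1"
    "fpc_g d1 \<cdot> h = m21 \<cdot> kki \<mu>" "h \<cdot> (kkj \<mu> \<cdot> kj \<mu>) = fpc_n d1"
    "po_x d1 \<cdot> (h \<cdot> kkj \<mu>) = y \<cdot> ko \<mu>"
  using assms unfolding compatible_via_def by blast+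

text \<open>\<open>compatible_via\<close> asks for equations only. The squares of
  \<open>\<mu>\<close> and those of \<open>d1\<close> are both universal, and cancelling the former
  from the latter makes the remaining squares universal too: \<open>fpc_decompose\<close> for
  \<open>h\<close>, \<open>pushout_unpaste\<close> for \<open>y\<close>. Regularity of
  \<open>h\<close> and \<open>y\<close> follows from this.\<close>

lemma compatible_via_constructions:
  assumes c: "compatible_via y h m1 d1 m2 d2 \<mu> m21"
  shows "is_fpc C (kki \<mu>) m21 h (fpc_g d1)" "regular_mono C h" "regular_mono C (h \<cdot> kkj \<mu>)"
    "is_pushout C (ko \<mu>) (h \<cdot> kkj \<mu>) y (po_x d1)" "regular_mono C y"
    "is_pullback C y (po_x d1) (ko \<mu>) (h \<cdot> kkj \<mu>)"
proof -
  note c = compatible_viaD[OF c]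
  obtain J K I KK II where M: "j1 \<mu> \<in> hom C O1 J" "kj \<mu> \<in> hom C K1 K" "ko \<mu> \<in> hom C K J"
    "pI \<mu> \<in> hom C I1 I" "kkj \<mu> \<in> hom C K KK" "kki \<mu> \<in> hom C KK II" "iota \<mu> \<in> hom C I II"
    and R: "regular_mono C (kkj \<mu>)"
    and po: "is_pushout C (out_leg r1) (kj \<mu>) (j1 \<mu>) (ko \<mu>)"
    and fpc: "is_fpc C (in_leg r1) (iota \<mu> \<cdot> pI \<mu>) (kkj \<mu> \<cdot> kj \<mu>) (kki \<mu>)"
    using rule_matchE[OF c(3)] by metis
  obtain F X1 where D: "m1 \<in> hom C I1 X0" "fpc_n d1 \<in> hom C K1 F" "fpc_g d1 \<in> hom C F X0"
    "comatch d1 \<in> hom C O1 X1" "po_x d1 \<in> hom C F X1"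
    and fpc1: "is_fpc C (in_leg r1) m1 (fpc_n d1) (fpc_g d1)"
    and po1: "is_pushout C (out_leg r1) (fpc_n d1) (comatch d1) (po_x d1)"
    and res: "result C d1 = X1" "Dom C (fpc_g d1) = F"
    using derivationE[OF c(1) r1] by metis
  note T = M[THEN hom_conj] D[THEN hom_conj]
  have m21: "m21 \<in> hom C II X0" and y: "y \<in> hom C J X1" and h: "h \<in> hom C KK F"
    using c(5-7) T res by simp_all
  note T' = m21[THEN hom_conj] y[THEN hom_conj] h[THEN hom_conj]
  show fpcK: "is_fpc C (kki \<mu>) m21 h (fpc_g d1)"
    using fpc_decompose[OF finite_limits lcc fpc _ regular_monic[OF c(4)], of "fpc_n d1" "fpc_g d1" X0 h]
      fpc1 c(8,11,12) T T' by (simp add: hom_def)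
  show rh: "regular_mono C h"
    using regular_mono_fpc[OF fpcK c(4)] .
  show rl: "regular_mono C (h \<cdot> kkj \<mu>)"
    using regular_mono_comp[OF R M(5) rh h] .
  have hk: "h \<cdot> kkj \<mu> \<in> hom C K F" "h \<cdot> kkj \<mu> \<cdot> kj \<mu> = fpc_n d1"
    using T T' c(12) by (auto simp: hom_def)
  have "is_pushout C (h \<cdot> kkj \<mu> \<cdot> kj \<mu>) (out_leg r1) (po_x d1) (comatch d1)"
    using pushout_sym[OF po1] hk(2) by simp
  from pushout_unpaste[OF pushout_sym[OF po] this hk(1) M(2) _ c(13,10)]
  show poy: "is_pushout C (ko \<mu>) (h \<cdot> kkj \<mu>) y (po_x d1)"
    using y T pushout_sym by simp
  show "regular_mono C y" "is_pullback C y (po_x d1) (ko \<mu>) (h \<cdot> kkj \<mu>)"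
    using pushout_regular_mono[OF poy rl] .
qed

text \<open>One object \<open>X2\<close> is the result of two derivations: pasting the squares of
  the composite shows that \<open>r2\<close> rewrites \<open>X1\<close> at \<open>m2\<close> into
  it, and \<open>span_composition\<close> that \<open>r21\<close> rewrites \<open>X0\<close> at
  \<open>m21\<close> into it. Uniqueness of results then compares it with \<open>d2\<close> and
  \<open>d21\<close>.\<close>

lemma compatible_results_isomorphic:
  assumes c: "compatible_via y h m1 d1 m2 d2 \<mu> m21"
    and comp: "sqpo_composite C r2 r1 \<mu> r21" and d21: "sqpo_derivation C r21 X0 m21 d21"
  shows "isomorphic C (result C d21) (result C d2)"
proof -
  note c' = compatible_viaD[OF c] and cc = compatible_via_constructions[OF c]
  obtain J K KK II where M: "j2 \<mu> \<in> hom C I2 J" "j1 \<mu> \<in> hom C O1 J" "ko \<mu> \<in> hom C K J"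
    "kkj \<mu> \<in> hom C K KK" "kki \<mu> \<in> hom C KK II" and R: "regular_mono C (kkj \<mu>)"
    using rule_matchE[OF c'(3)] by metis
  obtain F X1 where D: "fpc_g d1 \<in> hom C F X0" "po_x d1 \<in> hom C F X1"
    and res: "result C d1 = X1" "Dom C (fpc_g d1) = F"
    using derivationE[OF c'(1) r1] by metis
  obtain n2 g2 u v jj kk nn2 gg2 w z p q where S: "is_fpc C (in_leg r2) (j2 \<mu>) n2 g2"
    "is_pushout C (out_leg r2) n2 u v" "is_pushout C (ko \<mu>) (kkj \<mu>) jj kk"
    "is_fpc C g2 jj nn2 gg2" "is_pushout C v nn2 w z" "is_pullback C gg2 kk p q"
    and r21: "r21 = \<lparr>out_leg = z \<cdot> p, in_leg = kki \<mu> \<cdot> q\<rparr>"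
    using comp unfolding sqpo_composite_def by blast
  obtain F2 where 1: "n2 \<in> hom C K2 F2" "g2 \<in> hom C F2 J"
    using fpcE[OF S(1)] r2(2) M(1) by (metis homD(2,3))
  obtain O21 where 2: "u \<in> hom C O2 O21" "v \<in> hom C F2 O21"
    using pushout_hom[OF S(2) r2(1) 1(1)] by blast
  obtain J' where 3: "jj \<in> hom C J J'" "kk \<in> hom C KK J'"
    using pushout_hom[OF S(3) M(3,4)] by blast
  obtain KK2 where 4: "nn2 \<in> hom C F2 KK2" "gg2 \<in> hom C KK2 J'"
    using fpcE[OF S(4)] 1(2) 3(1) by (metis homD(2,3))
  obtain O' where 5: "w \<in> hom C O21 O'" "z \<in> hom C KK2 O'"
    using pushout_hom[OF S(5) 2(2) 4(1)] by blast
  note T = M[THEN hom_conj] D[THEN hom_conj]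
    1[THEN hom_conj] 2[THEN hom_conj] 3[THEN hom_conj]
    4[THEN hom_conj] 5[THEN hom_conj]
  have m21: "m21 \<in> hom C II X0" and y: "y \<in> hom C J X1" and h: "h \<in> hom C KK F"
    using c'(5-7) T res by simp_all
  note T' = m21[THEN hom_conj] y[THEN hom_conj] h[THEN hom_conj]
  have "y \<cdot> ko \<mu> = po_x d1 \<cdot> h \<cdot> kkj \<mu>"
    using c'(13) T T' by simp
  then obtain y' where y': "y' \<in> hom C J' X1" "y' \<cdot> jj = y" "y' \<cdot> kk = po_x d1 \<cdot> h"
    using pushout_ex[OF S(3) 3 y Comp_hom[OF h D(2)]] by metis
  have "is_pushout C (h \<cdot> kkj \<mu>) (ko \<mu>) (po_x d1) y"
    using pushout_sym[OF cc(4)] .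
  then have po': "is_pushout C kk h y' (po_x d1)"
    using pushout_sym[OF pushout_unpaste[OF pushout_sym[OF S(3)] _ h M(4) _ y'(3)[symmetric] y'(2)]] y'(1) T
    by simp
  have ry': "regular_mono C y'"
    using pushout_regular_mono(1)[OF po' cc(2)] .
  \<comment> \<open>From here the second rule is represented by the span \<open>(z, gg2)\<close>
    with match \<open>y'\<close>, and the first by \<open>(kk, kki \<mu>)\<close> with match
    \<open>m21\<close>; the output of the one and the input of the other are both
    \<open>J'\<close>.\<close>
  obtain F3 n3 g3 where 6: "n3 \<in> hom C KK2 F3" "g3 \<in> hom C F3 X1" "is_fpc C gg2 y' n3 g3"
    using fpc_of[OF ry' y'(1) 4(2)] .
  obtain X2 W x2 where 7: "W \<in> hom C O' X2" "x2 \<in> hom C F3 X2" "is_pushout C z n3 W x2"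
    using pushout_of[OF 5(2) 6(1)] .
  have m2: "y' \<cdot> (jj \<cdot> j2 \<mu>) = m2"
    using c'(9) y'(1,2) T comp_cancel[OF y'(2)] by (auto simp: hom_def)
  have "is_fpc C (in_leg r2) m2 (n3 \<cdot> (nn2 \<cdot> n2)) g3"
    using fpc_vertical[OF finite_limits fpc_vertical[OF finite_limits S(1,4)] 6(3)] m2 by simp
  moreover have "is_pushout C (out_leg r2) (n3 \<cdot> (nn2 \<cdot> n2)) (W \<cdot> (w \<cdot> u)) x2"
    using pushout_sym[OF pushout_paste[OF pushout_paste[OF pushout_sym[OF S(2)] pushout_sym[OF S(5)]]
        pushout_sym[OF 7(3)]]] .
  moreover have "sqpo_match C r2 X1 m2"
    using c'(2) res by (simp add: sqpo_derivation_def)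
  ultimately have "sqpo_derivation C r2 X1 m2
      \<lparr>fpc_n = n3 \<cdot> (nn2 \<cdot> n2), fpc_g = g3, comatch = W \<cdot> (w \<cdot> u), po_x = x2\<rparr>"
    by (simp add: sqpo_derivation_def)
  from derivation_result_unique[OF rules(2) this] c'(2) res(1)
  have iso2: "isomorphic C X2 (result C d2)"
    using T 7(1) by (simp add: result_def hom_def)
  obtain n g px where "is_fpc C (kki \<mu> \<cdot> q) m21 n g" "is_pushout C (z \<cdot> p) n W px"
    using span_composition[OF c'(4) m21 3(2) M(5) 5(2) 4(2) cc(1) po' 6(3) 7(3) S(6)] .
  then have "sqpo_derivation C r21 X0 m21 \<lparr>fpc_n = n, fpc_g = g, comatch = W, po_x = px\<rparr>"
    using d21 r21 by (simp add: sqpo_derivation_def)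
  from derivation_result_unique[OF compositeE(1)[OF c'(3) comp] d21 this]
  have "isomorphic C (result C d21) X2"
    using 7(1) by (simp add: result_def hom_def)
  then show ?thesis
    using isomorphic_trans iso2 by blast
qed

section \<open>Uniqueness up to isomorphism, and invariance under it\<close>

text \<open>The comparison isomorphisms are forced one after another: for \<open>J\<close> by
  jointly epic factorizations in \<open>X1\<close>, for \<open>K\<close> by pullbacks along them,
  for \<open>I\<close> by pushouts, for \<open>II\<close> by images in \<open>X0\<close>, for
  \<open>KK\<close> by pullbacks along those. Equations between arrows into \<open>K'\<close> or
  \<open>KK'\<close> are tested after the monic embeddings into the context of
  \<open>d1\<close>.\<close>

lemma compatible_unique_composite_match:
  assumes c: "compatible_via y h m1 d1 m2 d2 \<mu> m21" and c': "compatible_via y' h' m1 d1 m2 d2 \<mu>' m21'"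
  shows "((\<mu>, m21), (\<mu>', m21')) \<in> composite_matches_rel C r2 r1 X0"
proof -
  note D = compatible_viaD[OF c] and D' = compatible_viaD[OF c']
  note E = compatible_via_constructions[OF c] and E' = compatible_via_constructions[OF c']
  obtain J K I KK II where M: "j2 \<mu> \<in> hom C I2 J" "j1 \<mu> \<in> hom C O1 J" "kj \<mu> \<in> hom C K1 K" "ko \<mu> \<in> hom C K J"
    "pI \<mu> \<in> hom C I1 I" "pK \<mu> \<in> hom C K I" "kkj \<mu> \<in> hom C K KK" "kki \<mu> \<in> hom C KK II" "iota \<mu> \<in> hom C I II"
    and R: "jointly_epi C (j2 \<mu>) (j1 \<mu>)" "epi C (iota \<mu>)" "is_pushout C (in_leg r1) (kj \<mu>) (pI \<mu>) (pK \<mu>)"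
      "kki \<mu> \<cdot> kkj \<mu> = iota \<mu> \<cdot> pK \<mu>"
    using rule_matchE[OF D(3)] by metis
  obtain J' K' I' KK' II' where M': "j2 \<mu>' \<in> hom C I2 J'" "j1 \<mu>' \<in> hom C O1 J'" "kj \<mu>' \<in> hom C K1 K'"
    "ko \<mu>' \<in> hom C K' J'" "pI \<mu>' \<in> hom C I1 I'" "pK \<mu>' \<in> hom C K' I'" "kkj \<mu>' \<in> hom C K' KK'"
    "kki \<mu>' \<in> hom C KK' II'" "iota \<mu>' \<in> hom C I' II'"
    and R': "jointly_epi C (j2 \<mu>') (j1 \<mu>')" "epi C (iota \<mu>')" "is_pushout C (in_leg r1) (kj \<mu>') (pI \<mu>') (pK \<mu>')"
      "kki \<mu>' \<cdot> kkj \<mu>' = iota \<mu>' \<cdot> pK \<mu>'"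
    using rule_matchE[OF D'(3)] by metis
  obtain F X1 where F: "fpc_n d1 \<in> hom C K1 F" "fpc_g d1 \<in> hom C F X0" "po_x d1 \<in> hom C F X1"
    and res: "result C d1 = X1" "Dom C (fpc_g d1) = F"
    using derivationE[OF D(1) r1] by metis
  note T = M[THEN hom_conj] M'[THEN hom_conj] F[THEN hom_conj]
  have m: "m21 \<in> hom C II X0" "m21' \<in> hom C II' X0" and y: "y \<in> hom C J X1" "y' \<in> hom C J' X1"
    and h: "h \<in> hom C KK F" "h' \<in> hom C KK' F"
    using D(5-7) D'(5-7) T res by simp_all
  note T' = m[THEN hom_conj] y[THEN hom_conj] h[THEN hom_conj]
  have yy: "y \<cdot> j2 \<mu> = y' \<cdot> j2 \<mu>'" "y \<cdot> j1 \<mu> = y' \<cdot> j1 \<mu>'"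
    using D(9,10) D'(9,10) by simp_all
  obtain \<phi>J where J: "iso_between C J J' \<phi>J" "\<phi>J \<cdot> j2 \<mu> = j2 \<mu>'" "\<phi>J \<cdot> j1 \<mu> = j1 \<mu>'" "y' \<cdot> \<phi>J = y"
    using jointly_epi_factorization_iso[OF R(1) M(1,2) R'(1) M'(1,2) E(5) y(1) E'(5) y(2) yy] .
  have "is_pullback C (po_x d1) (y' \<cdot> \<phi>J) (h \<cdot> kkj \<mu>) (ko \<mu>)"
    using pullback_sym[OF E(6)] J(4) by simp
  then have "is_pullback C (po_x d1) y' (h \<cdot> kkj \<mu>) (\<phi>J \<cdot> ko \<mu>)"
    using pullback_iso_leg J(1) y(2) by blast
  then obtain \<phi>K where "iso_between C (Dom C (h \<cdot> kkj \<mu>)) (Dom C (h' \<cdot> kkj \<mu>')) \<phi>K"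
    and K: "h' \<cdot> kkj \<mu>' \<cdot> \<phi>K = h \<cdot> kkj \<mu>" "ko \<mu>' \<cdot> \<phi>K = \<phi>J \<cdot> ko \<mu>"
    using pullback_iso[OF _ pullback_sym[OF E'(6)]] by blast
  then have \<phi>K: "iso_between C K K' \<phi>K" using T T' by simp
  note T2 = iso_between_hom[OF J(1), THEN hom_conj] iso_between_hom[OF \<phi>K, THEN hom_conj]
  have hk': "h' \<cdot> kkj \<mu>' \<in> hom C K' F" using T T' by (simp add: hom_def)
  have Kkj: "\<phi>K \<cdot> kj \<mu> = kj \<mu>'"
    using T T' T2 K(1)[THEN comp_cancel, of "kj \<mu>"] D(12) D'(12)
    apply - by (rule monicD[OF regular_monic[OF E'(3)] hk', of _ K1]) (auto simp: hom_def)
  have "is_pushout C (in_leg r1) (kj \<mu>) (pI \<mu>') (pK \<mu>' \<cdot> \<phi>K)"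
    using pushout_iso_leg[of "in_leg r1" \<phi>K "kj \<mu>" "pI \<mu>'" "pK \<mu>'", OF _ \<phi>K M(3)] R'(3) Kkj by simp
  then obtain \<phi>I where "iso_between C (Cod C (pI \<mu>)) (Cod C (pI \<mu>')) \<phi>I"
    and I: "\<phi>I \<cdot> pI \<mu> = pI \<mu>'" "\<phi>I \<cdot> pK \<mu> = pK \<mu>' \<cdot> \<phi>K"
    using pushout_iso[OF R(3)] by metis
  then have \<phi>I: "iso_between C I I' \<phi>I" using T by simp
  note T3 = iso_between_hom[OF \<phi>I, THEN hom_conj]
  have i: "iota \<mu>' \<cdot> \<phi>I \<in> hom C I II'" using T T3 by (simp add: hom_def)
  \<comment> \<open>With this, \<open>m21\<close> and \<open>m21'\<close> belong to two epi and
    regular mono factorizations of one arrow from \<open>I\<close> to \<open>X0\<close>.\<close>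
  have "epi C (iota \<mu>' \<cdot> \<phi>I)"
  proof (rule epiI[OF i])
    fix S u v
    assume uv: "u \<in> hom C II' S" "v \<in> hom C II' S" "u \<cdot> (iota \<mu>' \<cdot> \<phi>I) = v \<cdot> (iota \<mu>' \<cdot> \<phi>I)"
    obtain \<psi> where \<psi>: "\<psi> \<in> hom C I' I" "\<phi>I \<cdot> \<psi> = Id C I'"
      using iso_betweenE[OF \<phi>I] by metis
    have "u \<cdot> (iota \<mu>' \<cdot> \<phi>I) \<cdot> \<psi> = v \<cdot> (iota \<mu>' \<cdot> \<phi>I) \<cdot> \<psi>"
      using uv(3) by simp
    then have "u \<cdot> iota \<mu>' = v \<cdot> iota \<mu>'"
      using T T3 \<psi> uv(1,2) by (simp add: hom_def)
    then show "u = v" using epiD[OF R'(2) M'(9) uv(1,2)] by blast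
  qed
  note je = epi_jointly_epi[OF R(2)] epi_jointly_epi[OF this]
  have "m21 \<cdot> (iota \<mu> \<cdot> pI \<mu>) = m21' \<cdot> (iota \<mu>' \<cdot> \<phi>I \<cdot> pI \<mu>)"
    using D(8) D'(8) I(1) T T3 by simp
  \<comment> \<open>On \<open>K\<close> both sides pass through the context of \<open>d1\<close>,
    where \<open>\<phi>K\<close> already identifies the two embeddings.\<close>
  moreover have "m21 \<cdot> (iota \<mu> \<cdot> pK \<mu>) = m21' \<cdot> (iota \<mu>' \<cdot> \<phi>I \<cdot> pK \<mu>)"
  proof -
    have "m21 \<cdot> (iota \<mu> \<cdot> pK \<mu>) = fpc_g d1 \<cdot> (h \<cdot> kkj \<mu>)"
      using T T' R(4) D(11)[THEN comp_cancel, of "kkj \<mu>"] by simp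
    also have "\<dots> = fpc_g d1 \<cdot> (h' \<cdot> (kkj \<mu>' \<cdot> \<phi>K))"
      using T T' T2 K(1) by simp
    also have "\<dots> = m21' \<cdot> (kki \<mu>' \<cdot> (kkj \<mu>' \<cdot> \<phi>K))"
      using T T' T2 D'(11)[THEN comp_cancel, of "kkj \<mu>' \<cdot> \<phi>K"] by simp
    also have "\<dots> = m21' \<cdot> (iota \<mu>' \<cdot> \<phi>I \<cdot> pK \<mu>)"
      using T T' T2 T3 R'(4)[THEN comp_cancel] I(2) by simp
    finally show ?thesis .
  qed
  ultimately have mi: "m21 \<cdot> iota \<mu> = m21' \<cdot> (iota \<mu>' \<cdot> \<phi>I)"
    using T T' T3 apply - by (rule pushout_unique[OF R(3) M(5), of _ X0]) (auto simp: hom_def)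
  obtain \<phi>II where II: "iso_between C II II' \<phi>II" "\<phi>II \<cdot> iota \<mu> = iota \<mu>' \<cdot> \<phi>I" "m21' \<cdot> \<phi>II = m21"
    using jointly_epi_factorization_iso[OF je(1) M(9,9) je(2) i i D(4) m(1) D'(4) m(2) mi mi] by metis
  have "is_pullback C (fpc_g d1) (m21' \<cdot> \<phi>II) h (kki \<mu>)" "is_pullback C (fpc_g d1) m21' h' (kki \<mu>')"
    using E(1) E'(1) II(3) pullback_sym by (simp_all add: is_fpc_def)
  then obtain \<phi>KK where "iso_between C (Dom C h) (Dom C h') \<phi>KK"
    and KK: "h' \<cdot> \<phi>KK = h" "kki \<mu>' \<cdot> \<phi>KK = \<phi>II \<cdot> kki \<mu>"
    using pullback_iso[OF pullback_iso_leg[OF _ II(1) m(2)]] by metis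
  then have \<phi>KK: "iso_between C KK KK' \<phi>KK" using T' by simp
  note T4 = iso_between_hom[OF \<phi>KK, THEN hom_conj]
  have "\<phi>KK \<cdot> kkj \<mu> = kkj \<mu>' \<cdot> \<phi>K"
    using T T' T2 T4 K(1) KK(1)[THEN comp_cancel, of "kkj \<mu>"]
    apply - by (rule monicD[OF regular_monic[OF E'(2)] h(2), of _ K]) (auto simp: hom_def)
  then have "rule_match_iso C \<phi>J \<phi>K \<phi>I \<phi>KK \<phi>II \<mu> \<mu>'"
    unfolding rule_match_iso_def using J K Kkj I II KK \<phi>I \<phi>K \<phi>KK T by simp
  moreover have "(\<mu>, m21) \<in> composite_matches C r2 r1 X0" "(\<mu>', m21') \<in> composite_matches C r2 r1 X0"
    using composite_matches_iff D D' by blast+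
  ultimately show ?thesis
    unfolding composite_matches_rel_def using II(3) by blast
qed

text \<open>\<open>m1\<close> is a composite of arrows of \<open>\<mu>\<close> with
  \<open>m21\<close>, so the first derivations share it and are isomorphic. Universal properties
  show that this isomorphism carries \<open>h\<close> to \<open>h'\<close> and \<open>y\<close> to
  \<open>y'\<close>, hence \<open>m2\<close> to \<open>m2'\<close>.\<close>

lemma compatible_unique_sequential_match:
  assumes c: "compatible_via y h m1 d1 m2 d2 \<mu> m21" and c': "compatible_via y' h' m1' d1' m2' d2' \<mu> m21"
  shows "(((m1, d1), (m2, d2)), ((m1', d1'), (m2', d2'))) \<in> sequential_matches_rel C r2 r1 X0"
proof -
  note D = compatible_viaD[OF c] and D' = compatible_viaD[OF c']
  obtain J K I KK II where M: "j2 \<mu> \<in> hom C I2 J" "j1 \<mu> \<in> hom C O1 J" "kj \<mu> \<in> hom C K1 K" "ko \<mu> \<in> hom C K J"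
    "pI \<mu> \<in> hom C I1 I" "kkj \<mu> \<in> hom C K KK" "kki \<mu> \<in> hom C KK II" "iota \<mu> \<in> hom C I II"
    and po: "is_pushout C (out_leg r1) (kj \<mu>) (j1 \<mu>) (ko \<mu>)"
    and fpc: "is_fpc C (in_leg r1) (iota \<mu> \<cdot> pI \<mu>) (kkj \<mu> \<cdot> kj \<mu>) (kki \<mu>)"
    using rule_matchE[OF D(3)] by metis
  obtain F X1 where F: "m1 \<in> hom C I1 X0" "fpc_n d1 \<in> hom C K1 F" "fpc_g d1 \<in> hom C F X0" "po_x d1 \<in> hom C F X1"
    and res: "result C d1 = X1" "Dom C (fpc_g d1) = F"
    using derivationE[OF D(1) r1] by metis
  obtain F' X1' where F': "fpc_n d1' \<in> hom C K1 F'" "fpc_g d1' \<in> hom C F' X0" "po_x d1' \<in> hom C F' X1'"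
    and fpc1': "is_fpc C (in_leg r1) m1' (fpc_n d1') (fpc_g d1')"
    and res': "result C d1' = X1'" "Dom C (fpc_g d1') = F'"
    using derivationE[OF D'(1) r1] by metis
  note T = M[THEN hom_conj] F[THEN hom_conj] F'[THEN hom_conj]
    r1[THEN hom_conj]
  have m: "m21 \<in> hom C II X0" and y: "y \<in> hom C J X1" "y' \<in> hom C J X1'" and h: "h \<in> hom C KK F" "h' \<in> hom C KK F'"
    using D(5-7) D'(6-7) T res res' by simp_all
  note T' = m[THEN hom_conj] y[THEN hom_conj] h[THEN hom_conj]
  have Ob: "X0 \<in> Ob C" "K1 \<in> Ob C" using m M(3) hom_Ob by blast+
  have mm: "m1 = m1'" using D(8) D'(8) by simp
  then have "Id C X0 \<cdot> m1 = m1'" using F(1) by (simp add: hom_def)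
  then obtain k1 y1 where d1: "derivation_iso C (Id C X0) k1 y1 m1 d1 m1' d1'"
    using derivation_unique[OF rules(1) D(1) D'(1) iso_between_id[OF Ob(1)]] by blast
  note I1 = derivation_isoD[OF d1]
  have k1: "k1 \<in> hom C F F'" and y1: "y1 \<in> hom C X1 X1'"
    using iso_between_hom[OF I1(2)] iso_between_hom[OF I1(3)] res res' by simp_all
  note T2 = k1[THEN hom_conj] y1[THEN hom_conj]
  have ip: "iota \<mu> \<cdot> pI \<mu> \<in> hom C I1 II" using T by (simp add: hom_def)
  have "is_pullback C (iota \<mu> \<cdot> pI \<mu>) (kki \<mu>) (in_leg r1) (kkj \<mu> \<cdot> kj \<mu>)"
    using fpc by (simp add: is_fpc_def)
  then have pb: "is_pullback C m1' (m21 \<cdot> kki \<mu>) (in_leg r1 \<cdot> Id C K1) (kkj \<mu> \<cdot> kj \<mu>)"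
    using pullback_mono_comp[OF regular_monic[OF D(4)] m ip M(7)] D'(8) T Ob by simp
  have g: "fpc_g d1 = fpc_g d1' \<cdot> k1" using I1(6) T T2 by simp
  \<comment> \<open>Both sides solve one finality problem, whose test square is the complement of
    \<open>\<mu>\<close> continued along the monic \<open>m21\<close>.\<close>
  have kh: "k1 \<cdot> h = h'"
  proof (rule fpc_unique[OF fpc1' r1(2) F'(2) Id_hom[OF Ob(2)] pb])
    show "fpc_g d1' \<cdot> (k1 \<cdot> h) = m21 \<cdot> kki \<mu>"
      using D(11) g T T' T2 by simp
    show "k1 \<cdot> h \<cdot> (kkj \<mu> \<cdot> kj \<mu>) = fpc_n d1' \<cdot> Id C K1"
      using D(12) I1(5) T T' T2 Ob by simp
  qed (use D'(11,12) T T' T2 Ob in \<open>auto simp: hom_def\<close>)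
  have yy: "y1 \<cdot> y = y'"
  proof (rule pushout_unique[OF po M(2)])
    show "y1 \<cdot> y \<cdot> j1 \<mu> = y' \<cdot> j1 \<mu>"
      using D(10) D'(10) I1(7) T T' T2 by simp
    have "y1 \<cdot> y \<cdot> ko \<mu> = y1 \<cdot> (po_x d1 \<cdot> (h \<cdot> kkj \<mu>))"
      using D(13) T T' T2 by simp
    also have "\<dots> = po_x d1' \<cdot> (k1 \<cdot> h \<cdot> kkj \<mu>)"
      using I1(8)[THEN comp_cancel, of "h \<cdot> kkj \<mu>"] T T' T2 by simp
    also have "\<dots> = y' \<cdot> ko \<mu>"
      using D'(13) kh by simp
    finally show "y1 \<cdot> y \<cdot> ko \<mu> = y' \<cdot> ko \<mu>" .
  qed (use T T' T2 in \<open>auto simp: hom_def\<close>)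
  have "y1 \<cdot> m2 = m2'"
    using D(9) D'(9) yy comp_cancel[OF yy, of "j2 \<mu>"] T T' T2 by auto
  then obtain k2 y2 where "derivation_iso C y1 k2 y2 m2 d2 m2' d2'"
    using derivation_unique[OF rules(2) D(2) D'(2) I1(3)] by blast
  then show ?thesis
    using d1 D(1,2) D'(1,2) by (auto simp: sequential_matches_rel_def sequential_matches_def)
qed

lemma compatible_sequential_invariant:
  assumes c: "compatible_via y h m1 d1 m2 d2 \<mu> m21"
    and rel: "(((m1, d1), (m2, d2)), ((m1', d1'), (m2', d2'))) \<in> sequential_matches_rel C r2 r1 X0"
  obtains y' h' where "compatible_via y' h' m1' d1' m2' d2' \<mu> m21"
proof -
  note D = compatible_viaD[OF c]
  obtain k1 y1 k2 y2 where i1: "derivation_iso C (Id C X0) k1 y1 m1 d1 m1' d1'"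
    and i2: "derivation_iso C y1 k2 y2 m2 d2 m2' d2'"
    and d: "sqpo_derivation C r1 X0 m1' d1'" "sqpo_derivation C r2 (result C d1') m2' d2'"
    using rel by (auto simp: sequential_matches_rel_def sequential_matches_def)
  note I1 = derivation_isoD[OF i1] and I2 = derivation_isoD[OF i2]
  obtain J K KK II where M: "j2 \<mu> \<in> hom C I2 J" "j1 \<mu> \<in> hom C O1 J" "kj \<mu> \<in> hom C K1 K" "ko \<mu> \<in> hom C K J"
    "kkj \<mu> \<in> hom C K KK" "kki \<mu> \<in> hom C KK II"
    using rule_matchE[OF D(3)] by metis
  obtain F X1 where F: "m1 \<in> hom C I1 X0" "fpc_g d1 \<in> hom C F X0" "po_x d1 \<in> hom C F X1"
    and res: "result C d1 = X1" "Dom C (fpc_g d1) = F"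
    using derivationE[OF D(1) r1] by metis
  obtain F' X1' where F': "fpc_g d1' \<in> hom C F' X0" "po_x d1' \<in> hom C F' X1'"
    and res': "result C d1' = X1'" "Dom C (fpc_g d1') = F'"
    using derivationE[OF d(1) r1] by metis
  have y: "y \<in> hom C J X1" and h: "h \<in> hom C KK F" and k1: "k1 \<in> hom C F F'" and y1: "y1 \<in> hom C X1 X1'"
    using D(6,7) M res res' iso_between_hom[OF I1(2)] iso_between_hom[OF I1(3)] by (auto simp: hom_def)
  note T = M[THEN hom_conj] F[THEN hom_conj] F'[THEN hom_conj]
    y[THEN hom_conj] h[THEN hom_conj] k1[THEN hom_conj]
    y1[THEN hom_conj]
  have mm: "m1 = m1'" using I1(4) T by simp
  have g: "fpc_g d1' \<cdot> k1 = fpc_g d1" using I1(6) T by simp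
  have "y1 \<cdot> y \<cdot> ko \<mu> = y1 \<cdot> (po_x d1 \<cdot> (h \<cdot> kkj \<mu>))"
    using D(13) T by simp
  also have "\<dots> = po_x d1' \<cdot> (k1 \<cdot> h \<cdot> kkj \<mu>)"
    using I1(8)[THEN comp_cancel, of "h \<cdot> kkj \<mu>"] T by simp
  finally have ko: "po_x d1' \<cdot> (k1 \<cdot> h \<cdot> kkj \<mu>) = y1 \<cdot> y \<cdot> ko \<mu>" ..
  have "compatible_via (y1 \<cdot> y) (k1 \<cdot> h) m1' d1' m2' d2' \<mu> m21"
    unfolding compatible_via_def
  proof (intro conjI)
    show "y1 \<cdot> y \<cdot> j2 \<mu> = m2'" using D(9) I2(4) T by simp
    show "y1 \<cdot> y \<cdot> j1 \<mu> = comatch d1'" using D(10) I1(7) T by simp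
    show "fpc_g d1' \<cdot> (k1 \<cdot> h) = m21 \<cdot> kki \<mu>" using D(11) g[THEN comp_cancel, of h] T by simp
    show "k1 \<cdot> h \<cdot> (kkj \<mu> \<cdot> kj \<mu>) = fpc_n d1'" using D(12) I1(5) T by simp
  qed (use D d ko mm res' T in \<open>auto simp: hom_def\<close>)
  then show ?thesis using that by blast
qed

lemma compatible_composite_invariant:
  assumes c: "compatible_via y h m1 d1 m2 d2 \<mu> m21"
    and rel: "((\<mu>, m21), (\<mu>', m21')) \<in> composite_matches_rel C r2 r1 X0"
  obtains y' h' where "compatible_via y' h' m1 d1 m2 d2 \<mu>' m21'"
proof -
  note D = compatible_viaD[OF c]
  obtain \<phi>J \<phi>K \<phi>I \<phi>KK \<phi>II where iso: "rule_match_iso C \<phi>J \<phi>K \<phi>I \<phi>KK \<phi>II \<mu> \<mu>'" and mII: "m21' \<cdot> \<phi>II = m21"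
    and d: "sqpo_rule_match C r2 r1 \<mu>'" "regular_mono C m21'" "m21' \<in> hom C (Cod C (kki \<mu>')) X0"
    using rel composite_matches_iff unfolding composite_matches_rel_def by blast
  obtain J K I KK II where M: "j2 \<mu> \<in> hom C I2 J" "j1 \<mu> \<in> hom C O1 J" "kj \<mu> \<in> hom C K1 K" "ko \<mu> \<in> hom C K J"
    "pI \<mu> \<in> hom C I1 I" "kkj \<mu> \<in> hom C K KK" "kki \<mu> \<in> hom C KK II" "iota \<mu> \<in> hom C I II"
    using rule_matchE[OF D(3)] by metis
  obtain J' K' I' KK' II' where M': "j2 \<mu>' \<in> hom C I2 J'" "j1 \<mu>' \<in> hom C O1 J'" "kj \<mu>' \<in> hom C K1 K'"
    "ko \<mu>' \<in> hom C K' J'" "pI \<mu>' \<in> hom C I1 I'" "kkj \<mu>' \<in> hom C K' KK'"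
    "kki \<mu>' \<in> hom C KK' II'" "iota \<mu>' \<in> hom C I' II'"
    using rule_matchE[OF d(1)] by metis
  obtain F X1 where F: "fpc_g d1 \<in> hom C F X0" "po_x d1 \<in> hom C F X1"
    and res: "result C d1 = X1" "Dom C (fpc_g d1) = F"
    using derivationE[OF D(1) r1] by metis
  have isos: "iso_between C J J' \<phi>J" "iso_between C K K' \<phi>K" "iso_between C I I' \<phi>I"
    "iso_between C KK KK' \<phi>KK" "iso_between C II II' \<phi>II"
    and e: "\<phi>J \<cdot> j2 \<mu> = j2 \<mu>'" "\<phi>J \<cdot> j1 \<mu> = j1 \<mu>'" "\<phi>K \<cdot> kj \<mu> = kj \<mu>'" "\<phi>J \<cdot> ko \<mu> = ko \<mu>' \<cdot> \<phi>K"
    "\<phi>I \<cdot> pI \<mu> = pI \<mu>'" "\<phi>KK \<cdot> kkj \<mu> = kkj \<mu>' \<cdot> \<phi>K" "\<phi>II \<cdot> kki \<mu> = kki \<mu>' \<cdot> \<phi>KK"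
    "\<phi>II \<cdot> iota \<mu> = iota \<mu>' \<cdot> \<phi>I"
    using iso M M' unfolding rule_match_iso_def by (auto simp: hom_def)
  obtain J1 where J1: "J1 \<in> hom C J' J" "J1 \<cdot> \<phi>J = Id C J"
    using iso_betweenE[OF isos(1)] by metis
  obtain K1' where K1': "K1' \<in> hom C K' K" "\<phi>K \<cdot> K1' = Id C K'"
    using iso_betweenE[OF isos(2)] by metis
  obtain KK1 where KK1: "KK1 \<in> hom C KK' KK" "KK1 \<cdot> \<phi>KK = Id C KK" "\<phi>KK \<cdot> KK1 = Id C KK'"
    using iso_betweenE[OF isos(4)] by metis
  have m: "m21 \<in> hom C II X0" "m21' \<in> hom C II' X0" and y: "y \<in> hom C J X1" and h: "h \<in> hom C KK F"
    using D(5-7) d(3) M M' res by (auto simp: hom_def)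
  note T = M[THEN hom_conj] M'[THEN hom_conj] F[THEN hom_conj]
    isos[THEN iso_between_hom, THEN hom_conj] J1(1)[THEN hom_conj]
    K1'(1)[THEN hom_conj] KK1(1)[THEN hom_conj]
    m[THEN hom_conj] y[THEN hom_conj] h[THEN hom_conj]
  have Ob: "J \<in> Ob C" "K' \<in> Ob C" "KK \<in> Ob C" "KK' \<in> Ob C"
    using T Dom_Ob Cod_Ob by metis+
  note canc = J1(2)[THEN comp_cancel] K1'(2)[THEN comp_cancel] KK1(2,3)[THEN comp_cancel]
  \<comment> \<open>The arrows out of \<open>K'\<close> are expressed through the inverse of
    \<open>\<phi>K\<close>, because the equations known for \<open>\<mu>\<close> concern arrows out
    of \<open>K\<close>.\<close>
  have kkj': "kkj \<mu>' = \<phi>KK \<cdot> (kkj \<mu> \<cdot> K1')"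
    using T Ob K1'(2) e(6)[THEN comp_cancel, of K1'] by simp
  have ko': "ko \<mu>' = \<phi>J \<cdot> (ko \<mu> \<cdot> K1')"
    using T Ob K1'(2) e(4)[THEN comp_cancel, of K1'] by simp
  have "compatible_via (y \<cdot> J1) (h \<cdot> KK1) m1 d1 m2 d2 \<mu>' m21'"
    unfolding compatible_via_def
  proof (intro conjI)
    show "y \<cdot> J1 \<cdot> j2 \<mu>' = m2" "y \<cdot> J1 \<cdot> j1 \<mu>' = comatch d1"
      using D(9,10) e(1,2)[symmetric] T Ob canc by simp_all
    have "m21' \<cdot> (iota \<mu>' \<cdot> pI \<mu>') = m21' \<cdot> (\<phi>II \<cdot> (iota \<mu> \<cdot> pI \<mu>))"
      using e(5)[symmetric] e(8)[THEN comp_cancel, of "pI \<mu>"] T by simp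
    then show "m1 = m21' \<cdot> (iota \<mu>' \<cdot> pI \<mu>')"
      using D(8) mII[THEN comp_cancel, of "iota \<mu> \<cdot> pI \<mu>"] T by simp
    have "fpc_g d1 \<cdot> (h \<cdot> KK1) = m21' \<cdot> \<phi>II \<cdot> kki \<mu> \<cdot> KK1"
      using D(11)[THEN comp_cancel, of KK1] mII T by simp
    also have "\<dots> = m21' \<cdot> kki \<mu>'"
      using e(7)[THEN comp_cancel, of KK1] KK1(3) T Ob by simp
    finally show "fpc_g d1 \<cdot> (h \<cdot> KK1) = m21' \<cdot> kki \<mu>'" .
    have "kkj \<mu>' \<cdot> kj \<mu>' = \<phi>KK \<cdot> (kkj \<mu> \<cdot> kj \<mu>)"
      using e(3)[symmetric] e(6)[THEN comp_cancel, of "kj \<mu>"] T by simp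
    then show "h \<cdot> KK1 \<cdot> (kkj \<mu>' \<cdot> kj \<mu>') = fpc_n d1"
      using D(12) T Ob canc by simp
    show "po_x d1 \<cdot> (h \<cdot> KK1 \<cdot> kkj \<mu>') = y \<cdot> J1 \<cdot> ko \<mu>'"
      unfolding kkj' ko' using D(13)[THEN comp_cancel, of K1'] T Ob canc by simp
  qed (use D d res T in \<open>auto simp: hom_def\<close>)
  then show ?thesis using that by blast
qed

end

section \<open>From a relation to a bijection of quotients\<close>

text \<open>Uniqueness and invariance together compute a class from the relation alone: the class of
  \<open>s\<close> consists of everything related to the same \<open>c\<close>. This takes the place
  of a separate proof that \<open>q1\<close> and \<open>q2\<close> are equivalence relations. The
  second conclusion says that any two representatives of corresponding classes are related.\<close>

lemma quotient_bij_betw: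
  assumes dom: "\<And>s c. R s c \<Longrightarrow> s \<in> A \<and> c \<in> B"
    and ex: "\<And>s. s \<in> A \<Longrightarrow> \<exists>c. R s c" "\<And>c. c \<in> B \<Longrightarrow> \<exists>s. R s c"
    and uniq: "\<And>s c c'. R s c \<Longrightarrow> R s c' \<Longrightarrow> (c, c') \<in> q2" "\<And>s s' c. R s c \<Longrightarrow> R s' c \<Longrightarrow> (s, s') \<in> q1"
    and inv: "\<And>s s' c. R s c \<Longrightarrow> (s, s') \<in> q1 \<Longrightarrow> R s' c" "\<And>s c c'. R s c \<Longrightarrow> (c, c') \<in> q2 \<Longrightarrow> R s c'"
  defines "\<Phi> \<equiv> \<lambda>X. {c. \<exists>s \<in> X. R s c}"
  shows "bij_betw \<Phi> (A // q1) (B // q2)"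
    and "X \<in> A // q1 \<Longrightarrow> s \<in> X \<Longrightarrow> c \<in> \<Phi> X \<Longrightarrow> R s c"
proof -
  have q1: "q1 `` {s} = {s'. R s' c}" if "R s c" for s c
    using that uniq inv by blast
  have q2: "q2 `` {c} = {c'. R s c'}" if "R s c" for s c
    using that uniq inv by blast
  have \<Phi>: "\<Phi> (q1 `` {s}) = q2 `` {c}" if "R s c" for s c
    unfolding \<Phi>_def q1[OF that] q2[OF that] using that uniq inv by blast
  show "bij_betw \<Phi> (A // q1) (B // q2)"
    unfolding bij_betw_def
  proof
    show "inj_on \<Phi> (A // q1)"
    proof (rule inj_onI)
      fix X Y
      assume "X \<in> A // q1" "Y \<in> A // q1" and eq: "\<Phi> X = \<Phi> Y"
      then obtain s t c e where s: "X = q1 `` {s}" "R s c" and t: "Y = q1 `` {t}" "R t e"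
        using ex(1) by (metis quotientE)
      have "q2 `` {c} = q2 `` {e}" using eq \<Phi> s t by simp
      \<comment> \<open>Uniqueness applied to \<open>R t e\<close> twice puts \<open>e\<close> into
        its own class, which is also the class of \<open>c\<close>.\<close>
      then have "(c, e) \<in> q2" using uniq(1)[OF t(2) t(2)] by blast
      then have "R s e" using inv(2) s by blast
      then show "X = Y" using q1 s t by simp
    qed
    show "\<Phi> ` (A // q1) = B // q2"
    proof (intro equalityI subsetI)
      fix Z assume "Z \<in> \<Phi> ` (A // q1)"
      then obtain s where s: "s \<in> A" "Z = \<Phi> (q1 `` {s})" by (auto elim!: quotientE)
      then obtain c where "R s c" using ex by blast
      then show "Z \<in> B // q2" using \<Phi> s dom by (simp add: quotientI)
    next
      fix Z assume "Z \<in> B // q2"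
      then obtain c where c: "c \<in> B" "Z = q2 `` {c}" by (rule quotientE)
      then obtain s where "R s c" using ex by blast
      then show "Z \<in> \<Phi> ` (A // q1)"
        using \<Phi> c dom by (metis image_eqI quotientI)
    qed
  qed
  show "R s c" if X: "X \<in> A // q1" "s \<in> X" "c \<in> \<Phi> X"
  proof -
    obtain t e where "X = q1 `` {t}" "R t e"
      using X(1) ex(1) by (metis quotientE)
    then show ?thesis
      using X(2,3) uniq inv unfolding \<Phi>_def by blast
  qed
qed

theorem theorem3:
  fixes C :: "('o, 'a) cat" and X0 :: 'o and r1 r2 :: "'a rewrite_rule"
  assumes "quasi_topos C" and "X0 \<in> Ob C" and "is_rule C r1" and "is_rule C r2"
  shows
    "(\<forall>m1 d1 m2 d2.
        sqpo_match C r1 X0 m1 \<and> sqpo_derivation C r1 X0 m1 d1 \<and>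
        sqpo_match C r2 (result C d1) m2 \<and> sqpo_derivation C r2 (result C d1) m2 d2 \<longrightarrow>
        (\<exists>\<mu> r21 m21 d21.
           sqpo_rule_match C r2 r1 \<mu> \<and> sqpo_composite C r2 r1 \<mu> r21 \<and>
           sqpo_match C r21 X0 m21 \<and> sqpo_derivation C r21 X0 m21 d21 \<and>
           isomorphic C (result C d21) (result C d2)))
     \<and>
     (\<forall>\<mu> r21 m21 d21.
        sqpo_rule_match C r2 r1 \<mu> \<and> sqpo_composite C r2 r1 \<mu> r21 \<and>
        sqpo_match C r21 X0 m21 \<and> sqpo_derivation C r21 X0 m21 d21 \<longrightarrow>
        (\<exists>m1 d1 m2 d2.
           sqpo_match C r1 X0 m1 \<and> sqpo_derivation C r1 X0 m1 d1 \<and>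
           sqpo_match C r2 (result C d1) m2 \<and> sqpo_derivation C r2 (result C d1) m2 d2 \<and>
           isomorphic C (result C d2) (result C d21)))
     \<and>
     (finitary C \<longrightarrow>
        (\<exists>\<Phi>. bij_betw \<Phi>
             (sequential_matches C r2 r1 X0 // sequential_matches_rel C r2 r1 X0)
             (composite_matches C r2 r1 X0 // composite_matches_rel C r2 r1 X0) \<and>
           (\<forall>c \<in> sequential_matches C r2 r1 X0 // sequential_matches_rel C r2 r1 X0.
            \<forall>((m1, d1), (m2, d2)) \<in> c. \<forall>(\<mu>, m21) \<in> \<Phi> c. \<forall>r21 d21.
              sqpo_composite C r2 r1 \<mu> r21 \<and> sqpo_derivation C r21 X0 m21 d21 \<longrightarrow>
              isomorphic C (result C d21) (result C d2))))"
proof -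
  interpret quasi_topos C by fact
  interpret rewriting C r1 r2 X0 "Dom C (out_leg r1)" "Cod C (out_leg r1)" "Cod C (in_leg r1)"
    "Dom C (out_leg r2)" "Cod C (out_leg r2)" "Cod C (in_leg r2)"
    using assms(3,4) by unfold_locales (auto simp: is_rule_def hom_def)
  \<comment> \<open>The embeddings \<open>y\<close> and \<open>h\<close> are hidden, so that
    \<open>R\<close> relates only the data that are counted.\<close>
  define R where "R = (\<lambda>((m1, d1), (m2, d2)) (\<mu>, m21). \<exists>y h. compatible_via y h m1 d1 m2 d2 \<mu> m21)"
  have R: "R ((m1, d1), (m2, d2)) (\<mu>, m21) \<longleftrightarrow> (\<exists>y h. compatible_via y h m1 d1 m2 d2 \<mu> m21)"
    for m1 d1 m2 d2 \<mu> m21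
    by (simp add: R_def)
  let ?A = "sequential_matches C r2 r1 X0" and ?q1 = "sequential_matches_rel C r2 r1 X0"
  let ?B = "composite_matches C r2 r1 X0" and ?q2 = "composite_matches_rel C r2 r1 X0"
  define \<Phi> where "\<Phi> = (\<lambda>X. {c. \<exists>s \<in> X. R s c})"
  have dom: "s \<in> ?A \<and> c \<in> ?B" if sc_rel: "R s c" for s c
  proof -
    obtain m1 d1 m2 d2 \<mu> m21 where sc: "s = ((m1, d1), (m2, d2))" "c = (\<mu>, m21)"
      by (metis surj_pair)
    then obtain y h where "compatible_via y h m1 d1 m2 d2 \<mu> m21" using sc_rel R by blast
    from compatible_viaD[OF this] show ?thesis
      unfolding sc composite_matches_iff by (simp add: sequential_matches_def)
  qed
  have ex1: "\<exists>c. R s c" if "s \<in> ?A" for s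
  proof -
    obtain m1 d1 m2 d2 where s: "s = ((m1, d1), (m2, d2))" by (metis surj_pair)
    have "sqpo_derivation C r1 X0 m1 d1" "sqpo_derivation C r2 (result C d1) m2 d2"
      using that by (simp_all add: s sequential_matches_def)
    then obtain \<mu> m21 y h where "compatible_via y h m1 d1 m2 d2 \<mu> m21" by (rule synthesis)
    then show ?thesis unfolding s using R by blast
  qed
  have ex2: "\<exists>s. R s c" if "c \<in> ?B" for c
  proof -
    obtain \<mu> m21 where c: "c = (\<mu>, m21)" by (metis surj_pair)
    have "sqpo_rule_match C r2 r1 \<mu>" "regular_mono C m21" "m21 \<in> hom C (Cod C (kki \<mu>)) X0"
      using that composite_matches_iff c by blast+
    then obtain m1 d1 m2 d2 y h where "compatible_via y h m1 d1 m2 d2 \<mu> m21" by (rule analysis)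
    then show ?thesis unfolding c using R by blast
  qed
  have uniq: "R s c \<Longrightarrow> R s c' \<Longrightarrow> (c, c') \<in> ?q2" "R s c \<Longrightarrow> R s' c \<Longrightarrow> (s, s') \<in> ?q1"
    and inv: "R s c \<Longrightarrow> (s, s') \<in> ?q1 \<Longrightarrow> R s' c" "R s c \<Longrightarrow> (c, c') \<in> ?q2 \<Longrightarrow> R s c'" for s s' c c'
  proof -
    obtain m1 d1 m2 d2 where s: "s = ((m1, d1), (m2, d2))" by (metis surj_pair)
    obtain m1' d1' m2' d2' where s': "s' = ((m1', d1'), (m2', d2'))" by (metis surj_pair)
    obtain \<mu> m21 where c: "c = (\<mu>, m21)" by (metis surj_pair)
    obtain \<mu>' m21' where c': "c' = (\<mu>', m21')" by (metis surj_pair)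
    show "(c, c') \<in> ?q2" if "R s c" "R s c'"
      using that unfolding s c c' R by (elim exE) (rule compatible_unique_composite_match)
    show "(s, s') \<in> ?q1" if "R s c" "R s' c"
      using that unfolding s s' c R by (elim exE) (rule compatible_unique_sequential_match)
    show "R s' c" if "R s c" "(s, s') \<in> ?q1"
      using that unfolding s s' c R
      by (elim exE) (erule (1) compatible_sequential_invariant, intro exI)
    show "R s c'" if "R s c" "(c, c') \<in> ?q2"
      using that unfolding s c c' R
      by (elim exE) (erule (1) compatible_composite_invariant, intro exI)
  qed
  have bij: "bij_betw \<Phi> (?A // ?q1) (?B // ?q2)"
    unfolding \<Phi>_def
    by (rule quotient_bij_betw(1)) (rule dom ex1 ex2 uniq inv; assumption)+
  \<comment> \<open>Compatibility of all representatives of corresponding classes lets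
    \<open>compatible_results_isomorphic\<close> apply to every pair of them.\<close>
  have \<Phi>: "R s c" if "X \<in> ?A // ?q1" "s \<in> X" "c \<in> \<Phi> X" for X s c
    by (rule quotient_bij_betw(2)[where R = R])
      ((rule dom ex1 ex2 uniq inv; assumption) | use that in \<open>simp add: \<Phi>_def\<close>)+
  have match: "sqpo_match C r X m" if "sqpo_derivation C r X m d" for r X m d
    using that by (simp add: sqpo_derivation_def)
  show ?thesis
  proof (intro conjI allI impI)
    fix m1 d1 m2 d2
    assume "sqpo_match C r1 X0 m1 \<and> sqpo_derivation C r1 X0 m1 d1 \<and>
        sqpo_match C r2 (result C d1) m2 \<and> sqpo_derivation C r2 (result C d1) m2 d2"
    then obtain \<mu> m21 y h where c: "compatible_via y h m1 d1 m2 d2 \<mu> m21"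
      using synthesis by metis
    note D = compatible_viaD[OF c]
    obtain r21 where r21: "sqpo_composite C r2 r1 \<mu> r21"
      using composite_exists[OF D(3)] .
    have m: "sqpo_match C r21 X0 m21"
      using D(4,5) compositeE(2)[OF D(3) r21] by (simp add: sqpo_match_def)
    then obtain d21 where "sqpo_derivation C r21 X0 m21 d21"
      using derivation_exists compositeE(1)[OF D(3) r21] by blast
    then show "\<exists>\<mu> r21 m21 d21.
           sqpo_rule_match C r2 r1 \<mu> \<and> sqpo_composite C r2 r1 \<mu> r21 \<and>
           sqpo_match C r21 X0 m21 \<and> sqpo_derivation C r21 X0 m21 d21 \<and>
           isomorphic C (result C d21) (result C d2)"
      using D(3) r21 m compatible_results_isomorphic[OF c r21] by blast
  next
    fix \<mu> r21 m21 d21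
    assume *: "sqpo_rule_match C r2 r1 \<mu> \<and> sqpo_composite C r2 r1 \<mu> r21 \<and>
        sqpo_match C r21 X0 m21 \<and> sqpo_derivation C r21 X0 m21 d21"
    then have "regular_mono C m21" "m21 \<in> hom C (Cod C (kki \<mu>)) X0"
      using compositeE(2) by (metis sqpo_match_def)+
    then obtain m1 d1 m2 d2 y h where c: "compatible_via y h m1 d1 m2 d2 \<mu> m21"
      using analysis * by metis
    then show "\<exists>m1 d1 m2 d2.
           sqpo_match C r1 X0 m1 \<and> sqpo_derivation C r1 X0 m1 d1 \<and>
           sqpo_match C r2 (result C d1) m2 \<and> sqpo_derivation C r2 (result C d1) m2 d2 \<and>
           isomorphic C (result C d2) (result C d21)"
      using compatible_viaD[OF c] match isomorphic_sym[OF compatible_results_isomorphic[OF c]] * by blast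
  next
    show "\<exists>\<Phi>. bij_betw \<Phi> (?A // ?q1) (?B // ?q2) \<and>
           (\<forall>c \<in> ?A // ?q1.
            \<forall>((m1, d1), (m2, d2)) \<in> c. \<forall>(\<mu>, m21) \<in> \<Phi> c. \<forall>r21 d21.
              sqpo_composite C r2 r1 \<mu> r21 \<and> sqpo_derivation C r21 X0 m21 d21 \<longrightarrow>
              isomorphic C (result C d21) (result C d2))"
    proof (intro exI[of _ \<Phi>] conjI bij ballI)
      fix X s
      assume X: "X \<in> ?A // ?q1" and s: "s \<in> X"
      obtain m1 d1 m2 d2 where s': "s = ((m1, d1), (m2, d2))" by (metis surj_pair)
      have "isomorphic C (result C d21) (result C d2)"
        if "(\<mu>, m21) \<in> \<Phi> X" "sqpo_composite C r2 r1 \<mu> r21" "sqpo_derivation C r21 X0 m21 d21" for \<mu> m21 r21 d21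
        using \<Phi>[OF X s that(1)] compatible_results_isomorphic that(2,3) unfolding s' R by blast
      then show "case s of (x, y) \<Rightarrow> (case x of (m1, d1) \<Rightarrow> \<lambda>(m2, d2). \<forall>(\<mu>, m21) \<in> \<Phi> X. \<forall>r21 d21.
              sqpo_composite C r2 r1 \<mu> r21 \<and> sqpo_derivation C r21 X0 m21 d21 \<longrightarrow>
              isomorphic C (result C d21) (result C d2)) y"
        unfolding s' by auto
    qed
  qed
qed

end
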